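(* Let $Z\in C^1(\mathbb R_+;B_b(S\times A))$ satisfy, for $t>0$, $$\partial_tZ_t(s,a)=-\big(Q^{\pi_t}_\tau(s,a)+\tau Z_t(s,a)-V^{\pi_t}_\tau(s)\big),\qquad Z|_{t=0}=Z_0\in B_b(S\times A),$$ where $\pi_t=\boldsymbol\pi(Z_t)$ for all $t\ge0$. Then for all $\rho\in\mathcal P(S)$ and $t>0$, $$V^{\pi_t}_\tau(\rho)-V^{\pi^*_\tau}_\tau(\rho)\le\frac{\tau}{(1-\gamma)(e^{\tau t}-1)}\int_S\mathrm{KL}(\pi^*_\tau(\cdot|s)|\pi_0(\cdot|s))\,d^{\pi^*_\tau}_\rho(ds),$$ and $$\int_S\|\pi_t(\cdot|s)-\pi^*_\tau(\cdot|s)\|^2_{\mathcal M(A)}\,d^{\pi^*_\tau}_\rho(ds)\le2e^{-\tau t}\int_S\mathrm{KL}(\pi^*_\tau(\cdot|s)|\pi_0(\cdot|s))\,d^{\pi^*_\tau}_\rho(ds).$$ The same convergence result also holds for the unique solution $\pi\in C^1(\mathbb R_+;\Pi_\mu)$, with initial condition $\pi|_{t=0}=\pi_0\in\Pi_\mu$, of $$\partial_t\pi_t(da|s)=-\Big(Q^{\pi_t}_\tau(s,a)+\tau\ln\frac{\mathrm d\pi_t}{\mathrm d\mu}(a|s)-V^{\pi_t}_\tau(s)\Big)\pi_t(da|s),\qquad t>0.$$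
   Context: $\mathbb R_+=[0,\infty)$. $S,A$ are Polish spaces (with Borel $\sigma$-algebras), $P$ is a probability kernel from $S\times A$ to $S$ (written $P(ds'|s,a)$), $c:S\times A\to\mathbb R$ is bounded measurable, $\gamma\in[0,1)$, $\mu\in\mathcal P(A)$, $\tau\in(0,\infty)$. $\mathcal P(E)$: Borel probability measures; $B_b(E)$: bounded measurable real functions with sup norm; $\mathcal M(A)$: finite signed measures on $A$ with total variation norm $\|m\|_{\mathcal M(A)}=|m|(A)$; $b\mathcal M(A|S)$: bounded signed kernels from $S$ to $A$ with norm $\sup_s\|k(\cdot|s)\|_{\mathcal M(A)}$. $\mathrm{KL}(m|m')=\int\ln\frac{\mathrm dm}{\mathrm dm'}\,dm$ if $m\ll m'$, and $+\infty$ otherwise. For $f\in B_b(S\times A)$ put $\boldsymbol\pi(f)(da|s)=\frac{e^{f(s,a)}}{\int_A e^{f(s,a')}\mu(da')}\mu(da)$, and $\Pi_\mu=\{\boldsymbol\pi(f): f\in B_b(S\times A)\}$. For $\pi\in\Pi_\mu$, $\frac{\mathrm d\pi}{\mathrm d\mu}(a|s)$ is the density of $\pi(\cdot|s)$ with respect to $\mu$. $\pi\in C^1(\mathbb R_+;\Pi_\mu)$ means $\pi\in C^1(\mathbb R_+;b\mathcal M(A|S))$ and $\pi_t\in\Pi_\mu$ for all $t$. General policies: $\Pi$ is the set of sequences $\pi=\{\pi_n\}_{n\ge0}$, $\pi_n$ a probability kernel from the history space $H_n=(S\times A)^n\times S$ to $A$. For $\pi\in\Pi$, $\mathbb E^\pi_s$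 is expectation under the law of $(s_0,a_0,s_1,a_1,\dots)$ with $s_0=s$, $a_n\sim\pi_n(\cdot|h_n)$ given $h_n=(s_0,a_0,\dots,a_{n-1},s_n)$, and $s_{n+1}\sim P(\cdot|s_n,a_n)$. $V^\pi_\tau(s)=\mathbb E^\pi_s\big[\sum_{n\ge0}\gamma^n\big(c(s_n,a_n)+\tau\,\mathrm{KL}(\pi_n(\cdot|h_n)|\mu)\big)\big]\in\mathbb R\cup\{\infty\}$. Elements of $\Pi_\mu$ are identified with stationary policies ($\pi_n(\cdot|h_n)=\pi(\cdot|s_n)$). For $\pi\in\Pi_\mu$: $Q^\pi_\tau(s,a)=c(s,a)+\gamma\int_SV^\pi_\tau(s')P(ds'|s,a)$. Optimal quantities: $V^*_\tau(s)=\inf_{\pi\in\Pi}V^\pi_\tau(s)$ (which belongs to $B_b(S)$), $Q^*_\tau(s,a)=c(s,a)+\gamma\int_SV^*_\tau(s')P(ds'|s,a)$, and the optimal policy is $\pi^*_\tau(da|s)=\exp\big(-\tfrac1\tau(Q^*_\tau(s,a)-V^*_\tau(s))\big)\mu(da)\in\Pi_\mu$. For $\rho\in\mathcal P(S)$: $V^\pi_\tau(\rho)=\int_SV^\pi_\tau\,d\rho$. With $P_\pi(ds'|s)=\int_AP(ds'|s,a)\pi(da|s)$ and $P^n_\pi$ its $n$-fold product ($P^0_\pi(\cdot|s)=\delta_s$), $d^\pi(ds'|s)=(1-\gamma)\sum_{n\ge0}\gamma^nP^n_\pi(ds'|s)$ and $d^\pi_\rho(ds)=\int_Sd^\pi(ds|s')\rho(ds')$.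 *)

theory Defs
  imports "HOL-Probability.Probability"
begin

section \<open>Extended integrals and relative entropy\<close>

text \<open>The integral of an extended real function, as positive part minus negative part.
  Unlike the Bochner integral it does not default to 0 when the integral is infinite.
  It is only applied to functions whose negative part has a finite integral.\<close>

definition ext_integral :: "'x measure \<Rightarrow> ('x \<Rightarrow> ereal) \<Rightarrow> ereal" where
  "ext_integral N f =
     enn2ereal (\<integral>\<^sup>+x. e2ennreal (f x) \<partial>N) - enn2ereal (\<integral>\<^sup>+x. e2ennreal (- f x) \<partial>N)"

text \<open>The argument order is that of \<open>KL(m|m')\<close>, whereas \<^const>\<open>absolutely_continuous\<close> and
  \<^const>\<open>RN_deriv\<close> take the dominating measure first.\<close>

definition KL :: "'x measure \<Rightarrow> 'x measure \<Rightarrow> ereal" where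
  "KL m m' =
     (if absolutely_continuous m' m
      then ext_integral m (\<lambda>x. ereal (ln (enn2real (RN_deriv m' m x))))
      else \<infinity>)"


section \<open>Bounded measurable functions and bounded signed kernels\<close>

definition Bb :: "('x::topological_space \<Rightarrow> real) set" where
  "Bb = {f \<in> borel_measurable borel. bounded (range f)}"

definition sup_norm :: "('x \<Rightarrow> real) \<Rightarrow> ereal" where
  "sup_norm f = (SUP x. ereal \<bar>f x\<bar>)"

text \<open>A finite signed measure is a real-valued set function; only its values on Borel sets matter.\<close>

definition finite_signed_measure :: "('a::topological_space set \<Rightarrow> real) \<Rightarrow> bool" where
  "finite_signed_measure m \<longleftrightarrow>
     (\<forall>F :: nat \<Rightarrow> 'a set. range F \<subseteq> sets borel \<longrightarrow> disjoint_family F \<longrightarrow>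
        (\<lambda>i. m (F i)) sums m (\<Union>i. F i))"

definition tv_norm :: "('a::topological_space set \<Rightarrow> real) \<Rightarrow> ereal" where
  "tv_norm m =
     (SUP \<B> \<in> {\<B>. finite \<B> \<and> \<B> \<subseteq> sets borel \<and> partition_on UNIV \<B>}.
        \<Sum>B\<in>\<B>. ereal \<bar>m B\<bar>)"

text \<open>A signed kernel is represented by \<open>(s, B) \<mapsto> k(B|s)\<close>.\<close>

definition kernel_norm :: "('s \<times> 'a::topological_space set \<Rightarrow> real) \<Rightarrow> ereal" where
  "kernel_norm k = (SUP s. tv_norm (\<lambda>B. k (s, B)))"

definition bounded_signed_kernels ::
    "('s::topological_space \<times> 'a::topological_space set \<Rightarrow> real) set" where
  "bounded_signed_kernels =
     {k. (\<forall>s. finite_signed_measure (\<lambda>B. k (s, B))) \<and>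
         (\<forall>B\<in>sets borel. (\<lambda>s. k (s, B)) \<in> borel_measurable borel) \<and>
         kernel_norm k < \<infinity>}"

definition kernel_of :: "('s \<Rightarrow> 'a measure) \<Rightarrow> 's \<times> 'a set \<Rightarrow> real" where
  "kernel_of \<pi> = (\<lambda>(s, B). measure (\<pi> s) B)"


section \<open>Paths on the half-line with values in a normed space of functions\<close>

text \<open>\<open>X\<close> is the space and \<open>N\<close> its norm. Times are restricted to \<open>{0..}\<close>, so the derivative at
  \<open>0\<close> is one-sided.\<close>

definition has_path_derivative ::
    "('x \<Rightarrow> real) set \<Rightarrow> (('x \<Rightarrow> real) \<Rightarrow> ereal) \<Rightarrow> (real \<Rightarrow> 'x \<Rightarrow> real) \<Rightarrow> ('x \<Rightarrow> real) \<Rightarrow> real \<Rightarrow> bool" where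
  "has_path_derivative X N z z' t \<longleftrightarrow>
     z' \<in> X \<and> ((\<lambda>r. N (\<lambda>x. (z r x - z t x) / (r - t) - z' x)) \<longlongrightarrow> 0) (at t within {0..})"

definition C1_path ::
    "('x \<Rightarrow> real) set \<Rightarrow> (('x \<Rightarrow> real) \<Rightarrow> ereal) \<Rightarrow> (real \<Rightarrow> 'x \<Rightarrow> real) \<Rightarrow> bool" where
  "C1_path X N z \<longleftrightarrow>
     (\<forall>t\<ge>0. z t \<in> X) \<and>
     (\<exists>z'. (\<forall>t\<ge>0. has_path_derivative X N z (z' t) t) \<and>
           (\<forall>t\<ge>0. ((\<lambda>r. N (\<lambda>x. z' r x - z' t x)) \<longlongrightarrow> 0) (at t within {0..})))"


section \<open>Entropy-regularised Markov decision processes\<close>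

record ('s, 'a) mdp =
  transition :: "'s \<times> 'a \<Rightarrow> 's measure"
  cost :: "'s \<times> 'a \<Rightarrow> real"
  discount :: real
  ref_measure :: "'a measure"
  temperature :: real

definition regularised_mdp :: "('s::polish_space, 'a::polish_space) mdp \<Rightarrow> bool" where
  "regularised_mdp M \<longleftrightarrow>
     transition M \<in> borel \<rightarrow>\<^sub>M prob_algebra borel \<and>
     cost M \<in> Bb \<and>
     0 \<le> discount M \<and> discount M < 1 \<and>
     ref_measure M \<in> space (prob_algebra borel) \<and>
     0 < temperature M"

text \<open>The history \<open>h\<^sub>n = (s\<^sub>0, a\<^sub>0, \<dots>, a\<^sub>n\<^sub>-\<^sub>1, s\<^sub>n)\<close> is encoded as \<open>(\<omega>, s\<^sub>n)\<close>, where \<open>\<omega>\<close> is the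
  function \<open>i \<mapsto> (s\<^sub>i, a\<^sub>i)\<close> on \<open>{0..<n}\<close>.\<close>

type_synonym ('s, 'a) policy = "nat \<Rightarrow> (nat \<Rightarrow> 's \<times> 'a) \<times> 's \<Rightarrow> 'a measure"

definition policies :: "('s::polish_space, 'a::polish_space) policy set" where
  "policies = {\<pi>. \<forall>n. \<pi> n \<in> PiM {0..<n} (\<lambda>_. borel) \<Otimes>\<^sub>M borel \<rightarrow>\<^sub>M prob_algebra borel}"

definition stationary :: "('s \<Rightarrow> 'a measure) \<Rightarrow> ('s, 'a) policy" where
  "stationary \<pi> = (\<lambda>n (\<omega>, s). \<pi> s)"

text \<open>The conditional law of \<open>(s\<^sub>n, a\<^sub>n)\<close> given \<open>(s\<^sub>i, a\<^sub>i)\<^sub>i\<^sub><\<^sub>n\<close>, when the initial state is \<open>s\<close>.\<close>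

definition step_kernel ::
    "('s::polish_space, 'a::polish_space) mdp \<Rightarrow> ('s, 'a) policy \<Rightarrow> 's \<Rightarrow>
     nat \<Rightarrow> (nat \<Rightarrow> 's \<times> 'a) \<Rightarrow> ('s \<times> 'a) measure" where
  "step_kernel M \<pi> s n \<omega> =
     do {
       s' \<leftarrow> (if n = 0 then return borel s else transition M (\<omega> (n - 1)));
       a \<leftarrow> \<pi> n (\<omega>, s');
       return borel (s', a)
     }"

text \<open>The law of the trajectory, given by the Ionescu-Tulcea theorem.\<close>

definition trajectory_law ::
    "('s::polish_space, 'a::polish_space) mdp \<Rightarrow> ('s, 'a) policy \<Rightarrow> 's \<Rightarrow> (nat \<Rightarrow> 's \<times> 'a) measure" where
  "trajectory_law M \<pi> s =
     projective_family.lim UNIV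
       (Ionescu_Tulcea.CI (step_kernel M \<pi> s) (\<lambda>_. borel)) (\<lambda>_. borel)"

definition value_fun ::
    "('s::polish_space, 'a::polish_space) mdp \<Rightarrow> ('s, 'a) policy \<Rightarrow> 's \<Rightarrow> ereal" where
  "value_fun M \<pi> s =
     ext_integral (trajectory_law M \<pi> s)
       (\<lambda>\<omega>. \<Sum>n. ereal (discount M ^ n) *
          (ereal (cost M (\<omega> n)) +
           ereal (temperature M) *
             KL (\<pi> n (restrict \<omega> {0..<n}, fst (\<omega> n))) (ref_measure M)))"

text \<open>The state-action function \<open>c + \<gamma> \<integral> V dP\<close> attached to a value function \<open>V\<close>. It is only applied
  to the value functions of Gibbs policies and to the optimal value function, which are bounded.\<close>

definition q_fun ::
    "('s::polish_space, 'a::polish_space) mdp \<Rightarrow> ('s \<Rightarrow> ereal) \<Rightarrow> 's \<times> 'a \<Rightarrow> real" where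
  "q_fun M V sa =
     cost M sa + discount M * (LINT s'|transition M sa. real_of_ereal (V s'))"


section \<open>Gibbs policies and the optimal policy\<close>

definition gibbs ::
    "('s::polish_space, 'a::polish_space) mdp \<Rightarrow> ('s \<times> 'a \<Rightarrow> real) \<Rightarrow> 's \<Rightarrow> 'a measure" where
  "gibbs M f s =
     density (ref_measure M)
       (\<lambda>a. ennreal (exp (f (s, a)) / (LINT a'|ref_measure M. exp (f (s, a')))))"

definition gibbs_policies ::
    "('s::polish_space, 'a::polish_space) mdp \<Rightarrow> ('s \<Rightarrow> 'a measure) set" where
  "gibbs_policies M = gibbs M ` Bb"

definition V_pol ::
    "('s::polish_space, 'a::polish_space) mdp \<Rightarrow> ('s \<Rightarrow> 'a measure) \<Rightarrow> 's \<Rightarrow> ereal" where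
  "V_pol M \<pi> = value_fun M (stationary \<pi>)"

definition Q_pol ::
    "('s::polish_space, 'a::polish_space) mdp \<Rightarrow> ('s \<Rightarrow> 'a measure) \<Rightarrow> 's \<times> 'a \<Rightarrow> real" where
  "Q_pol M \<pi> = q_fun M (V_pol M \<pi>)"

definition V_opt :: "('s::polish_space, 'a::polish_space) mdp \<Rightarrow> 's \<Rightarrow> ereal" where
  "V_opt M s = (INF \<pi>\<in>policies. value_fun M \<pi> s)"

definition Q_opt :: "('s::polish_space, 'a::polish_space) mdp \<Rightarrow> 's \<times> 'a \<Rightarrow> real" where
  "Q_opt M = q_fun M (V_opt M)"

definition optimal_policy ::
    "('s::polish_space, 'a::polish_space) mdp \<Rightarrow> 's \<Rightarrow> 'a measure" where
  "optimal_policy M s =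
     density (ref_measure M)
       (\<lambda>a. ennreal (exp (- (1 / temperature M) * (Q_opt M (s, a) - real_of_ereal (V_opt M s)))))"


section \<open>Occupancy measures\<close>

definition policy_kernel ::
    "('s::polish_space, 'a::polish_space) mdp \<Rightarrow> ('s \<Rightarrow> 'a measure) \<Rightarrow> 's \<Rightarrow> 's measure" where
  "policy_kernel M \<pi> s = \<pi> s \<bind> (\<lambda>a. transition M (s, a))"

primrec policy_kernel_iter ::
    "('s::polish_space, 'a::polish_space) mdp \<Rightarrow> ('s \<Rightarrow> 'a measure) \<Rightarrow> nat \<Rightarrow> 's \<Rightarrow> 's measure" where
  "policy_kernel_iter M \<pi> 0 s = return borel s"
| "policy_kernel_iter M \<pi> (Suc n) s = policy_kernel_iter M \<pi> n s \<bind> policy_kernel M \<pi>"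

definition occupancy ::
    "('s::polish_space, 'a::polish_space) mdp \<Rightarrow> ('s \<Rightarrow> 'a measure) \<Rightarrow> 's \<Rightarrow> 's measure" where
  "occupancy M \<pi> s =
     measure_of UNIV (sets borel)
       (\<lambda>B. ennreal (1 - discount M) *
          (\<Sum>n. ennreal (discount M ^ n) * emeasure (policy_kernel_iter M \<pi> n s) B))"

definition occupancy_from ::
    "('s::polish_space, 'a::polish_space) mdp \<Rightarrow> ('s \<Rightarrow> 'a measure) \<Rightarrow> 's measure \<Rightarrow> 's measure" where
  "occupancy_from M \<pi> \<rho> = \<rho> \<bind> occupancy M \<pi>"


section \<open>The gradient flow\<close>

text \<open>The flow of the log-densities.\<close>

definition log_density_flow ::
    "('s::polish_space, 'a::polish_space) mdp \<Rightarrow> (real \<Rightarrow> 's \<times> 'a \<Rightarrow> real) \<Rightarrow> bool" where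
  "log_density_flow M Z \<longleftrightarrow>
     C1_path Bb sup_norm Z \<and>
     (\<forall>t>0. has_path_derivative Bb sup_norm Z
        (\<lambda>(s, a). - (Q_pol M (gibbs M (Z t)) (s, a) + temperature M * Z t (s, a)
                      - real_of_ereal (V_pol M (gibbs M (Z t)) s))) t)"

text \<open>The Fisher-Rao flow of policies started at \<open>\<pi>\<^sub>0\<close>. The right-hand side is the kernel
  with density \<open>-(Q + \<tau> ln (d\<pi>/d\<mu>) - V)\<close> with respect to the policy.\<close>

definition fisher_rao_flow ::
    "('s::polish_space, 'a::polish_space) mdp \<Rightarrow> ('s \<Rightarrow> 'a measure) \<Rightarrow>
     (real \<Rightarrow> 's \<Rightarrow> 'a measure) \<Rightarrow> bool" where
  "fisher_rao_flow M \<pi>\<^sub>0 \<pi> \<longleftrightarrow>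
     C1_path bounded_signed_kernels kernel_norm (\<lambda>t. kernel_of (\<pi> t)) \<and>
     (\<forall>t\<ge>0. \<pi> t \<in> gibbs_policies M) \<and>
     \<pi> 0 = \<pi>\<^sub>0 \<and>
     (\<forall>t>0. has_path_derivative bounded_signed_kernels kernel_norm (\<lambda>t. kernel_of (\<pi> t))
        (\<lambda>(s, B). - (LINT a:B|\<pi> t s.
             Q_pol M (\<pi> t) (s, a)
             + temperature M * ln (enn2real (RN_deriv (ref_measure M) (\<pi> t s) a))
             - real_of_ereal (V_pol M (\<pi> t) s))) t)"

end

theory Submission
  imports Defs
begin

text \<open>Along the flow the normalised log-density \<open>l = ln (d\<pi>/d\<mu>)\<close> satisfies \<open>\<partial>l = - A\<close>, where
  \<open>A = Q + \<tau> l - V\<close> is the advantage of \<open>\<pi>\<close>. Let \<open>y\<close> be the mean of \<open>KL(\<pi>*|\<pi>)\<close> under the occupancy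
  measure of \<open>\<pi>*\<close> and \<open>\<delta> = V(\<rho>) - V*(\<rho>)\<close>. Since \<open>KL(\<pi>*|\<pi>)\<close> is affine in \<open>l\<close>, the performance
  difference formula gives \<open>y' = - \<tau> y - (1 - \<gamma>) \<delta>\<close>; as \<open>\<delta>\<close> is nonnegative and nonincreasing,
  integration yields both bounds, the second one through Pinsker's inequality.

  The flow of the log-densities exists globally because its right-hand side is locally Lipschitz and
  grows at most linearly in the supremum norm. Uniqueness of the Fisher--Rao flow cannot be read off
  there, since the norm of kernels does not control log-densities: an a priori bound on the values
  first confines the densities, up to null sets, to a compact subset of \<open>(0, \<infinity>)\<close>, on which the
  right-hand side is Lipschitz in total variation.\<close>

section \<open>Differential equations and differential inequalities\<close>

text \<open>The value is never differentiated in time. Its monotonicity, the barriers for the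
  densities and uniqueness all come from one-sided difference inequalities and a Dini form of
  Gronwall's lemma; the quotients are taken from the left, so that the linearisation and its
  constants sit at the right endpoint. Values are fixed points of Bellman operators, so a statewise
  inequality for the difference of two values propagates at the cost of a factor
  \<open>1 / (1 - \<gamma>)\<close>. Only the divergence of the fixed optimal policy from the moving
  one is differentiated: up to a constant it is a bounded linear functional of the log-density, so
  no derivative has to be exchanged with an integral. The existence theorem is applied to
  \<open>Z\<close> and not to \<open>l\<close>, because \<open>Z\<close> ranges over a whole Banach
  space whereas normalised log-densities form a curved subset; normalisation then carries one flow
  to the other. The constants of the two bounds come from the integrating factor
  \<open>exp (\<tau> * t)\<close>: \<open>\<tau> / (exp (\<tau> * t) - 1)\<close> is the inverse of
  its integral over \<open>[0, t]\<close>.\<close>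

lemma at_left_le_at_within:
  fixes t :: real
  assumes "a < t" "{a<..<t} \<subseteq> S"
  shows "at_left t \<le> at t within S"
proof -
  have "at t within {a<..<t} = at_left t" using assms(1) by (intro at_within_nhd[of _ "{a<..}"]) auto
  moreover have "at t within {a<..<t} \<le> at t within S" by (rule at_le) (rule assms(2))
  ultimately show ?thesis by simp
qed

text \<open>If \<open>g t\<close> were positive, consider the exponential curve of rate
  \<open>L + 1\<close> through the point \<open>(t, g t)\<close> and the first time \<open>u\<close>
  at which \<open>g\<close> reaches it. Before \<open>u\<close> the graph of \<open>g\<close> lies
  below the curve, so just left of \<open>u\<close> it must climb at least as fast as the curve,
  which the difference inequality at \<open>u\<close> forbids.\<close>

lemma dini_gronwall:
  fixes g :: "real \<Rightarrow> real"
  assumes cont: "continuous_on {a..T} g" and ga: "g a \<le> 0" and L: "0 \<le> L"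
    and step: "\<And>t \<epsilon>. a < t \<Longrightarrow> t \<le> T \<Longrightarrow> 0 < \<epsilon> \<Longrightarrow>
      \<forall>\<^sub>F r in at_left t. g t - g r \<le> (t - r) * (L * g t + \<epsilon>)"
    and t: "a \<le> t" "t \<le> T"
  shows "g t \<le> 0"
proof (rule ccontr)
  assume "\<not> g t \<le> 0"
  \<comment> \<open>The surplus 1 over \<open>L\<close> leaves room for the error term, which is
    used below with half the height of the contact point.\<close>
  define k where "k = L + 1"
  define \<delta> where "\<delta> = g t * exp (- k * t)"
  have \<delta>: "0 < \<delta>" using \<open>\<not> g t \<le> 0\<close> by (simp add: \<delta>_def)
  define S where "S = {r \<in> {a..T}. \<delta> * exp (k * r) \<le> g r}"
  have "closed S" unfolding S_def
    by (intro continuous_on_closed_Collect_le cont continuous_intros)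
  moreover have "bounded S" by (rule bounded_subset[of "{a..T}"]) (auto simp: S_def)
  ultimately have "compact S" by (simp add: compact_eq_bounded_closed)
  moreover have "t \<in> S"
    using t by (auto simp: S_def \<delta>_def mult.assoc exp_add[symmetric])
  ultimately obtain u where u: "u \<in> S" and umin: "\<And>r. r \<in> S \<Longrightarrow> u \<le> r"
    using compact_attains_inf[of S] by blast
  define b where "b = \<delta> * exp (k * u)"
  have b: "0 < b" using \<delta> by (simp add: b_def)
  have "a \<noteq> u"
  proof
    assume "a = u"
    then have "b \<le> g a" using u by (simp add: S_def b_def)
    then show False using b ga by simp
  qed
  then have au: "a < u" "u \<le> T" using u by (auto simp: S_def)
  have left: "\<forall>\<^sub>F r in at_left u. a < r \<and> r < u"
    using eventually_at_left_real[OF au(1)] by (rule eventually_mono) auto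
  have below: "\<forall>\<^sub>F r in at_left u. g r < \<delta> * exp (k * r)"
    using left
  proof eventually_elim
    case (elim r)
    then have "r \<notin> S" using umin[of r] by auto
    then show ?case using elim au by (auto simp: S_def)
  qed
  have "(g \<longlongrightarrow> g u) (at_left u)"
  proof -
    have "(g \<longlongrightarrow> g u) (at u within {a..T})"
      using cont au by (auto simp: continuous_on_def)
    moreover have "at_left u \<le> at u within {a..T}"
      using au by (intro at_left_le_at_within[of a]) auto
    ultimately show ?thesis by (rule tendsto_mono[rotated])
  qed
  moreover have "((\<lambda>r. \<delta> * exp (k * r)) \<longlongrightarrow> b) (at_left u)"
    unfolding b_def by (intro tendsto_intros)
  ultimately have "g u \<le> b"
    using below by (intro tendsto_le[of "at_left u" _ b g]) (auto elim: eventually_mono)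
  then have gu: "g u = b" using u by (auto simp: S_def b_def)
  have "((\<lambda>r. \<delta> * exp (k * r)) has_real_derivative k * b) (at u)"
    by (auto intro!: derivative_eq_intros simp: b_def)
  then have "((\<lambda>r. (\<delta> * exp (k * r) - b) / (r - u)) \<longlongrightarrow> k * b) (at u within {..<u})"
    unfolding has_field_derivative_iff b_def by (rule filterlim_mono) (auto simp: at_le)
  then have "\<forall>\<^sub>F r in at_left u. (L + 1/2) * b < (\<delta> * exp (k * r) - b) / (r - u)"
    by (rule order_tendstoD) (use b in \<open>auto simp: k_def\<close>)
  \<comment> \<open>The curve reaches \<open>b\<close> with slope \<open>(L + 1) * b\<close>,
    whereas \<open>g\<close>, lying below it, reaches \<open>b\<close> with slope at most
    \<open>(L + 1/2) * b\<close>.\<close>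
  then have "\<forall>\<^sub>F r in at_left u. False"
    using step[OF au half_gt_zero[OF b]] below left
  proof eventually_elim
    case (elim r)
    then have "b - g r \<le> (u - r) * (L * b + b / 2)" by (simp add: gu)
    moreover have "(L * b + b / 2) * (r - u) = - ((u - r) * (L * b + b / 2))"
      by (simp add: field_simps)
    ultimately have "(L * b + b / 2) * (r - u) \<le> \<delta> * exp (k * r) - b"
      using elim by linarith
    then have "(\<delta> * exp (k * r) - b) / (r - u) \<le> L * b + b / 2"
      using elim by (simp add: neg_divide_le_eq)
    moreover have "(L + 1/2) * b = L * b + b / 2" by (simp add: algebra_simps)
    ultimately show ?case using elim(1) by linarith
  qed
  then show False by simp
qed

text \<open>A solution is sought as \<open>x t = y t / w t\<close> with \<open>y\<close> bounded, where the weight \<open>w\<close> decays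
  so fast that the integral operator becomes a contraction although the Lipschitz constant of \<open>F\<close>
  grows along the a priori bound \<open>R\<close>.\<close>

lemma global_solution:
  fixes F :: "'e::banach \<Rightarrow> 'e" and x0 :: 'e
  assumes growth: "\<And>x. norm (F x) \<le> b * (1 + norm x)"
    and lip: "\<And>x y. norm (F x - F y) \<le> K * (1 + max (norm x) (norm y)) * norm (x - y)"
  obtains x where "x 0 = x0" "\<And>t. 0 \<le> t \<Longrightarrow> (x has_vector_derivative F (x t)) (at t within {0..})"
proof -
  \<comment> \<open>\<open>b'\<close> is positive so that it can be divided by, and
    \<open>b' \<le> K'\<close> will make \<open>W\<close> dominate \<open>E - E 0\<close>.\<close>
  define b' where "b' = max b 1"
  define K' where "K' = max K b'"
  have b': "0 < b'" "b \<le> b'" and K': "0 < K'" "K \<le> K'" "b' \<le> K'"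
    by (auto simp: b'_def K'_def)
  \<comment> \<open>\<open>E - 1\<close> solves \<open>R' = b' * (1 + R)\<close> from the value
    \<open>norm x0\<close>; it is the a priori bound that linear growth gives.\<close>
  define E where "E t = (1 + norm x0) * exp (b' * t)" for t
  have E_pos: "1 \<le> E t" if "0 \<le> t" for t
    using mult_mono[of 1 "1 + norm x0" 1 "exp (b' * t)"] that b' by (simp add: E_def)
  have E_deriv: "(E has_real_derivative b' * E t) (at t within S)" for t S
    unfolding E_def by (auto intro!: derivative_eq_intros)
  \<comment> \<open>Integral of \<open>K' * E\<close>, where \<open>K' * E r\<close> is a Lipschitz
    constant of \<open>F\<close> on the ball of radius \<open>E r - 1\<close>.\<close>
  define W where "W t = K' / b' * (E t - E 0)" for t
  have W_deriv: "(W has_real_derivative K' * E t) (at t within S)" for t S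
    unfolding W_def using b' by (auto intro!: derivative_eq_intros E_deriv)
  have W0: "W 0 = 0" by (simp add: W_def)
  \<comment> \<open>The factor 2 produces the contraction constant 1/2: \<open>K' * E / w\<close> is
    \<open>W' * exp (2 * W)\<close>, whose integral is \<open>(1 / w - 1) / 2\<close>.\<close>
  define w where "w t = exp (- 2 * W t)" for t
  have w_pos: "0 < w t" for t by (simp add: w_def)
  have cont_E [continuous_intros]: "continuous_on S E" for S
    unfolding E_def by (intro continuous_intros)
  have cont_w [continuous_intros]: "continuous_on S w" for S
    unfolding w_def W_def by (intro continuous_intros)
  have w_int: "((\<lambda>r. K' * E r / w r) has_integral (1 / w t - 1) / 2) {0..t}" if "0 \<le> t" for t
  proof -
    have "((\<lambda>r. exp (2 * W r) / 2) has_real_derivative K' * E r / w r) (at r within {0..t})" for r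
      by (auto intro!: derivative_eq_intros W_deriv simp: w_def exp_minus field_simps)
    then have "((\<lambda>r. K' * E r / w r) has_integral exp (2 * W t) / 2 - exp (2 * W 0) / 2) {0..t}"
      using that by (intro fundamental_theorem_of_calculus)
        (auto simp: has_real_derivative_iff_has_vector_derivative[symmetric])
    moreover have "exp (2 * W t) / 2 - exp (2 * W 0) / 2 = (1 / w t - 1) / 2"
      by (simp add: w_def W0 exp_minus inverse_eq_divide diff_divide_distrib)
    ultimately show ?thesis by simp
  qed
  \<comment> \<open>Keeps the weighted iterates bounded uniformly in time, so that they belong to
    the space of bounded continuous functions.\<close>
  have wE: "w t * E t \<le> 1 + norm x0" if "0 \<le> t" for t
  proof -
    have "b' * t \<le> exp (b' * t) - 1" using exp_ge_add_one_self[of "b' * t"] by linarith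
    also have "\<dots> \<le> E t - E 0"
      using mult_right_mono[of 1 "1 + norm x0" "exp (b' * t) - 1"] b' that
      by (simp add: E_def algebra_simps)
    finally have le: "b' * t \<le> E t - E 0" .
    have nonneg: "0 \<le> b' * t" using b' that by simp
    have "1 * (E t - E 0) \<le> W t"
      unfolding W_def using b' K' le nonneg by (intro mult_right_mono) auto
    then have "b' * t \<le> W t" using le by simp
    then have "b' * t - 2 * W t \<le> 0" using nonneg by simp
    then have "exp (b' * t - 2 * W t) \<le> 1" by simp
    then have "(1 + norm x0) * exp (b' * t - 2 * W t) \<le> (1 + norm x0) * 1"
      by (intro mult_left_mono) auto
    then show ?thesis by (simp add: w_def E_def exp_diff exp_minus field_simps)
  qed
  have lipE: "norm (F x - F y) \<le> K' * E r * norm (x - y)"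
    if "0 \<le> r" "norm x \<le> E r - 1" "norm y \<le> E r - 1" for x y r
  proof -
    have "norm (F x - F y) \<le> K * (1 + max (norm x) (norm y)) * norm (x - y)" by (rule lip)
    also have "\<dots> \<le> K' * E r * norm (x - y)"
      using that K' by (intro mult_right_mono mult_mono) (auto simp: le_max_iff_disj add_nonneg_nonneg)
    finally show ?thesis .
  qed
  have cont_F: "continuous_on UNIV F"
  proof -
    have "continuous_on (ball 0 n) F" for n
    proof (cases "0 < n")
      case True
      have "(\<bar>K\<bar> * (1 + n))-lipschitz_on (ball 0 n) F"
      proof (rule lipschitz_onI)
        fix x y :: 'e assume "x \<in> ball 0 n" "y \<in> ball 0 n"
        then have "K * (1 + max (norm x) (norm y)) * norm (x - y) \<le> \<bar>K\<bar> * (1 + n) * norm (x - y)"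
          by (intro mult_right_mono mult_mono) (auto simp: le_max_iff_disj add_nonneg_nonneg)
        then show "dist (F x) (F y) \<le> \<bar>K\<bar> * (1 + n) * dist x y"
          using lip[of x y] by (simp add: dist_norm)
      qed (use True in simp)
      then show ?thesis by (rule lipschitz_on_continuous_on)
    next
      case False
      then have "ball (0::'e) n = {}" by simp
      then show ?thesis by (simp only: continuous_on_empty)
    qed
    then have "continuous_on (\<Union>n::real. ball 0 n) F"
      by (intro continuous_on_open_UN) blast+
    moreover have "(\<Union>n::real. ball (0::'e) n) = UNIV"
      by (auto intro: gt_ex)
    ultimately show ?thesis by simp
  qed
  \<comment> \<open>The unknown \<open>y\<close> stands for \<open>w * x\<close>, so the weight is
    undone before \<open>F\<close> is applied.\<close>
  define G where "G y r = F (inverse (w r) *\<^sub>R apply_bcontfun y r)" for y :: "real \<Rightarrow>\<^sub>C 'e" and r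
  have G_cont: "continuous_on S (G y)" for S y
    unfolding G_def
    by (intro continuous_on_compose2[OF cont_F] continuous_intros) (auto simp: w_pos less_imp_neq[symmetric])
  define \<Phi> where "\<Phi> y t = w t *\<^sub>R (x0 + integral {0..t} (G y))" for y t
  \<comment> \<open>Weighted form of \<open>norm x \<le> E - 1\<close>. Integrating the growth bound
    \<open>b' * E\<close> reproduces it, which makes the set invariant.\<close>
  define X where "X = {y :: real \<Rightarrow>\<^sub>C 'e. \<forall>t\<ge>0. norm (apply_bcontfun y t) \<le> w t * (E t - 1)}"
  have X_norm: "norm (inverse (w r) *\<^sub>R apply_bcontfun y r) \<le> E r - 1" if "y \<in> X" "0 \<le> r" for y r
    using that w_pos[of r] by (auto simp: X_def field_simps)
  have G_norm: "norm (G y r) \<le> b' * E r" if "y \<in> X" "0 \<le> r" for y r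
  proof -
    have "norm (G y r) \<le> b * (1 + norm (inverse (w r) *\<^sub>R apply_bcontfun y r))"
      unfolding G_def by (rule growth)
    also have "\<dots> \<le> b' * E r"
      using X_norm[OF that] b' by (intro mult_mono) auto
    finally show ?thesis .
  qed
  have \<Phi>_norm: "norm (\<Phi> y t) \<le> w t * (E t - 1)" if y: "y \<in> X" and t: "0 \<le> t" for y t
  proof -
    have "((\<lambda>r. b' * E r) has_integral E t - E 0) {0..t}"
      using t E_deriv by (intro fundamental_theorem_of_calculus)
        (auto simp: has_real_derivative_iff_has_vector_derivative[symmetric])
    then have "norm (integral {0..t} (G y)) \<le> E t - E 0"
      using G_norm[OF y]
      by (intro integral_norm_bound_integral[THEN order_trans, of _ _ "\<lambda>r. b' * E r"])
        (auto intro!: integrable_continuous_real G_cont continuous_intros eq_refl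
          simp only: integral_unique atLeastAtMost_iff)
    then have "norm (x0 + integral {0..t} (G y)) \<le> E t - 1"
      using norm_triangle_ineq[of x0 "integral {0..t} (G y)"] by (simp add: E_def)
    then show ?thesis
      using w_pos[of t] by (simp add: \<Phi>_def)
  qed
  have \<Phi>_cont: "continuous_on {0..} (\<Phi> y)" for y
  proof -
    have "continuous_on {0..} (\<lambda>t. integral {0..t} (G y))"
      unfolding continuous_on_eq_continuous_within
    proof
      fix t :: real assume "t \<in> {0..}"
      then have "((\<lambda>t. integral {0..t} (G y)) has_vector_derivative G y t) (at t within {0..t+1})"
        by (intro integral_has_vector_derivative G_cont) auto
      then have "continuous (at t within {0..t+1}) (\<lambda>t. integral {0..t} (G y))"
        by (rule has_vector_derivative_continuous)
      moreover have "at t within {0..t+1} = at t within {0..}"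
        using \<open>t \<in> {0..}\<close> by (intro at_within_nhd[of _ "{..<t+1}"]) auto
      ultimately show "continuous (at t within {0..}) (\<lambda>t. integral {0..t} (G y))" by simp
    qed
    then show ?thesis unfolding \<Phi>_def by (intro continuous_intros)
  qed
  \<comment> \<open>The function space lives on the whole line; negative times receive the value at
    0.\<close>
  define \<Psi> where "\<Psi> y = Bcontfun (\<lambda>t. \<Phi> y (max 0 t))" for y
  have \<Psi>: "apply_bcontfun (\<Psi> y) t = \<Phi> y (max 0 t)" if "y \<in> X" for y t
  proof -
    have "(\<lambda>t. \<Phi> y (max 0 t)) \<in> bcontfun"
    proof (rule bcontfun_normI)
      show "continuous_on UNIV (\<lambda>t. \<Phi> y (max 0 t))"
        by (rule continuous_on_compose2[OF \<Phi>_cont]) (auto intro!: continuous_intros)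
      fix t
      have "norm (\<Phi> y (max 0 t)) \<le> w (max 0 t) * E (max 0 t)"
        using \<Phi>_norm[OF that, of "max 0 t"] w_pos[of "max 0 t"] by (simp add: algebra_simps)
      also have "\<dots> \<le> 1 + norm x0" by (rule wE) simp
      finally show "norm (\<Phi> y (max 0 t)) \<le> 1 + norm x0" .
    qed
    then show ?thesis by (simp add: \<Psi>_def Bcontfun_inverse)
  qed
  have "closed X"
  proof -
    have "X = PiC {0..} (\<lambda>t. cball 0 (w t * (E t - 1)))"
      by (auto simp: X_def mem_PiC_iff Pi_iff)
    then show ?thesis by (simp add: closed_PiC)
  qed
  then have "Topological_Spaces.complete X" by (simp add: complete_eq_closed)
  moreover have "0 \<in> X"
    using E_pos w_pos by (auto simp: X_def less_imp_le)
  moreover have "\<Psi> y \<in> X" if "y \<in> X" for y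
    unfolding X_def using \<Psi>[OF that] \<Phi>_norm[OF that] by auto
  moreover have "dist (\<Psi> y) (\<Psi> z) \<le> 1/2 * dist y z" if y: "y \<in> X" and z: "z \<in> X" for y z
  proof (rule dist_bound)
    fix t' :: real
    define t where "t = max 0 t'"
    have t: "0 \<le> t" by (simp add: t_def)
    have G_diff: "norm (G y r - G z r) \<le> K' * E r / w r * dist y z" if "0 \<le> r" for r
    proof -
      have "norm (G y r - G z r) \<le>
          K' * E r * norm (inverse (w r) *\<^sub>R apply_bcontfun y r - inverse (w r) *\<^sub>R apply_bcontfun z r)"
        unfolding G_def using that y z by (intro lipE X_norm)
      also have "\<dots> = K' * E r / w r * dist (apply_bcontfun y r) (apply_bcontfun z r)"
        using w_pos[of r] by (simp add: scaleR_diff_right[symmetric] dist_norm divide_inverse)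
      also have "\<dots> \<le> K' * E r / w r * dist y z"
        using w_pos[of r] E_pos[OF that] K' by (intro mult_left_mono dist_bounded) (auto intro!: divide_nonneg_pos mult_nonneg_nonneg)
      finally show ?thesis .
    qed
    have "norm (integral {0..t} (\<lambda>r. G y r - G z r)) \<le> (1 / w t - 1) / 2 * dist y z"
      using G_diff has_integral_mult_left[OF w_int[OF t], of "dist y z"]
      by (intro integral_norm_bound_integral[THEN order_trans, of _ _ "\<lambda>r. K' * E r / w r * dist y z"])
        (auto intro!: integrable_continuous_real G_cont continuous_intros
          simp: integral_unique w_pos less_imp_neq[symmetric])
    then have "norm (integral {0..t} (G y) - integral {0..t} (G z)) \<le> (1 / w t - 1) / 2 * dist y z"
      by (subst integral_diff[symmetric]) (auto intro!: integrable_continuous_real G_cont)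
    then have "w t * norm (integral {0..t} (G y) - integral {0..t} (G z))
        \<le> w t * ((1 / w t - 1) / 2 * dist y z)"
      using w_pos[of t] by (intro mult_left_mono) auto
    also have "\<dots> = (1 - w t) / 2 * dist y z" using w_pos[of t] by (simp add: field_simps)
    also have "\<dots> \<le> 1/2 * dist y z" using w_pos[of t] by (intro mult_right_mono) auto
    finally show "dist (apply_bcontfun (\<Psi> y) t') (apply_bcontfun (\<Psi> z) t') \<le> 1/2 * dist y z"
      using w_pos[of t] by (simp add: \<Psi>[OF y] \<Psi>[OF z] t_def[symmetric] \<Phi>_def dist_norm
        scaleR_diff_right[symmetric])
  qed
  ultimately have "\<exists>!y\<in>X. \<Psi> y = y"
    by (intro Banach_fix[of X "1/2" \<Psi>]) auto
  then obtain y where y: "y \<in> X" "\<Psi> y = y" by blast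
  define x where "x t = x0 + integral {0..t} (G y)" for t
  have G_x: "G y t = F (x t)" if "0 \<le> t" for t
  proof -
    have "apply_bcontfun y t = w t *\<^sub>R x t"
      using \<Psi>[OF y(1), of t] y(2) that by (simp add: \<Phi>_def x_def)
    then show ?thesis using w_pos[of t] by (simp add: G_def)
  qed
  show ?thesis
  proof (rule that)
    show "x 0 = x0" by (simp add: x_def)
    fix t :: real assume t: "0 \<le> t"
    then have "((\<lambda>t. integral {0..t} (G y)) has_vector_derivative G y t) (at t within {0..t+1})"
      by (intro integral_has_vector_derivative G_cont) auto
    moreover have "at t within {0..t+1} = at t within {0..}"
      using t by (intro at_within_nhd[of _ "{..<t+1}"]) auto
    ultimately have "((\<lambda>t. x0 + integral {0..t} (G y)) has_vector_derivative G y t) (at t within {0..})"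
      by (auto intro!: derivative_eq_intros)
    then show "(x has_vector_derivative F (x t)) (at t within {0..})"
      by (simp add: x_def[abs_def] G_x[OF t, unfolded x_def])
  qed
qed

section \<open>The Banach space of bounded measurable functions\<close>

lemma BbI: "f \<in> borel_measurable borel \<Longrightarrow> (\<And>x. \<bar>f x\<bar> \<le> C) \<Longrightarrow> f \<in> Bb"
  by (auto simp: Bb_def bounded_iff)

lemma Bb_measurable: "f \<in> Bb \<Longrightarrow> f \<in> borel_measurable borel"
  by (simp add: Bb_def)

lemma Bb_bound: "f \<in> Bb \<Longrightarrow> bdd_above (range (\<lambda>x. \<bar>f x\<bar>))"
  by (auto simp: Bb_def bounded_iff bdd_above_def)

lemma Bb_const: "(\<lambda>_. c) \<in> Bb"
  by (rule BbI[of _ "\<bar>c\<bar>"]) auto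

lemma Bb_add: assumes "f \<in> Bb" "g \<in> Bb" shows "(\<lambda>x. f x + g x) \<in> Bb"
proof -
  obtain a b where "\<And>x. \<bar>f x\<bar> \<le> a" "\<And>x. \<bar>g x\<bar> \<le> b"
    using Bb_bound[OF assms(1)] Bb_bound[OF assms(2)] by (auto simp: bdd_above_def)
  then have "\<bar>f x + g x\<bar> \<le> a + b" for x by (meson abs_triangle_ineq add_mono order_trans)
  then show ?thesis using assms
    by (intro BbI[of _ "a + b"] borel_measurable_add) (auto simp: Bb_measurable)
qed

lemma Bb_mult: assumes "f \<in> Bb" "g \<in> Bb" shows "(\<lambda>x. f x * g x) \<in> Bb"
proof -
  obtain a b where ab: "\<And>x. \<bar>f x\<bar> \<le> a" "\<And>x. \<bar>g x\<bar> \<le> b"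
    using Bb_bound[OF assms(1)] Bb_bound[OF assms(2)] by (auto simp: bdd_above_def)
  then have "\<bar>f x * g x\<bar> \<le> a * b" for x
    unfolding abs_mult by (meson abs_ge_zero mult_mono order_trans)
  then show ?thesis using assms
    by (intro BbI[of _ "a * b"] borel_measurable_times) (auto simp: Bb_measurable)
qed

lemma Bb_cmult: "f \<in> Bb \<Longrightarrow> (\<lambda>x. c * f x) \<in> Bb"
  by (intro Bb_mult Bb_const)

lemma Bb_uminus: "f \<in> Bb \<Longrightarrow> (\<lambda>x. - f x) \<in> Bb"
  using Bb_cmult[of f "- 1"] by simp

lemma Bb_diff: "f \<in> Bb \<Longrightarrow> g \<in> Bb \<Longrightarrow> (\<lambda>x. f x - g x) \<in> Bb"
  using Bb_add[OF _ Bb_uminus, of f g] by simp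

lemma Bb_abs: "f \<in> Bb \<Longrightarrow> (\<lambda>x. \<bar>f x\<bar>) \<in> Bb"
  by (auto simp: Bb_def bounded_iff)

lemmas Bb_intros = Bb_const Bb_add Bb_mult Bb_cmult Bb_uminus Bb_diff

text \<open>A type of its own lets \<open>Bb\<close> become an instance of the class of Banach
  spaces, so that fixed point theorems, vector derivatives and the chain rule apply to it.\<close>

typedef (overloaded) 'x bmfun = "Bb :: ('x::topological_space \<Rightarrow> real) set"
  morphisms bm Bm
  by (intro exI[of _ "\<lambda>_. 0"] Bb_const)

setup_lifting type_definition_bmfun

lemma bm_inject_ext: "(\<And>x. bm f x = bm g x) \<Longrightarrow> f = g"
  by (metis bm_inject ext)

instantiation bmfun :: (topological_space) real_vector
begin

lift_definition zero_bmfun :: "'a bmfun" is "\<lambda>_. 0" by (rule Bb_const)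
lift_definition plus_bmfun :: "'a bmfun \<Rightarrow> 'a bmfun \<Rightarrow> 'a bmfun" is "\<lambda>f g x. f x + g x" by (rule Bb_add)
lift_definition minus_bmfun :: "'a bmfun \<Rightarrow> 'a bmfun \<Rightarrow> 'a bmfun" is "\<lambda>f g x. f x - g x" by (rule Bb_diff)
lift_definition uminus_bmfun :: "'a bmfun \<Rightarrow> 'a bmfun" is "\<lambda>f x. - f x" by (rule Bb_uminus)
lift_definition scaleR_bmfun :: "real \<Rightarrow> 'a bmfun \<Rightarrow> 'a bmfun" is "\<lambda>c f x. c * f x" by (rule Bb_cmult)

instance
  by standard (transfer; auto simp: algebra_simps)+

end

lemmas bm_simps [simp] = plus_bmfun.rep_eq minus_bmfun.rep_eq uminus_bmfun.rep_eq
  scaleR_bmfun.rep_eq zero_bmfun.rep_eq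

instantiation bmfun :: (topological_space) real_normed_vector
begin

definition norm_bmfun :: "'a bmfun \<Rightarrow> real" where "norm_bmfun f = (SUP x. \<bar>bm f x\<bar>)"
definition dist_bmfun :: "'a bmfun \<Rightarrow> 'a bmfun \<Rightarrow> real" where "dist_bmfun f g = norm (f - g)"
definition sgn_bmfun :: "'a bmfun \<Rightarrow> 'a bmfun" where "sgn_bmfun f = f /\<^sub>R norm f"
definition uniformity_bmfun :: "('a bmfun \<times> 'a bmfun) filter" where
  "uniformity_bmfun = (INF e\<in>{0<..}. principal {(x, y). dist x y < e})"
definition open_bmfun :: "'a bmfun set \<Rightarrow> bool" where
  "open_bmfun U = (\<forall>x\<in>U. \<forall>\<^sub>F (x', y) in uniformity. x' = x \<longrightarrow> y \<in> U)"

lemma abs_bm_le_norm: "\<bar>bm f x\<bar> \<le> norm f"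
  unfolding norm_bmfun_def using bm[of f] by (intro cSUP_upper Bb_bound) auto

lemma norm_bm_leI: "(\<And>x. \<bar>bm f x\<bar> \<le> C) \<Longrightarrow> norm f \<le> C"
  unfolding norm_bmfun_def by (intro cSUP_least) auto

instance
proof
  fix f g :: "'a bmfun" and c :: real
  have nn: "0 \<le> norm f" using abs_bm_le_norm[of f undefined] by linarith
  show "norm f = 0 \<longleftrightarrow> f = 0"
  proof
    assume "norm f = 0"
    then show "f = 0"
      using abs_bm_le_norm[of f] by (intro bm_inject_ext) simp
  next
    assume "f = 0"
    then have "norm f \<le> 0" by (intro norm_bm_leI) simp
    then show "norm f = 0" using nn by simp
  qed
  show "norm (f + g) \<le> norm f + norm g"
    by (intro norm_bm_leI) (simp add: abs_bm_le_norm abs_triangle_ineq[THEN order_trans] add_mono)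
  show "norm (c *\<^sub>R f) = \<bar>c\<bar> * norm f"
  proof (rule antisym)
    show "norm (c *\<^sub>R f) \<le> \<bar>c\<bar> * norm f"
      by (intro norm_bm_leI) (simp add: abs_mult abs_bm_le_norm mult_left_mono)
    show "\<bar>c\<bar> * norm f \<le> norm (c *\<^sub>R f)"
    proof (cases "c = 0")
      case True
      then show ?thesis using abs_bm_le_norm[of "c *\<^sub>R f" undefined] by simp
    next
      case False
      have "norm f \<le> norm (c *\<^sub>R f) / \<bar>c\<bar>"
        using abs_bm_le_norm[of "c *\<^sub>R f"] False
        by (intro norm_bm_leI) (simp add: abs_mult field_simps)
      then show ?thesis using False by (simp add: field_simps)
    qed
  qed
qed (rule dist_bmfun_def sgn_bmfun_def uniformity_bmfun_def open_bmfun_def)+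

end

text \<open>A Cauchy sequence converges pointwise, and letting one index of the Cauchy estimate tend
  to infinity makes the convergence uniform. Measurability survives as a pointwise limit,
  boundedness because some member lies within 1 of the limit.\<close>

instance bmfun :: (topological_space) banach
proof
  fix X :: "nat \<Rightarrow> 'a bmfun" assume X: "Cauchy X"
  have dist_bm: "\<bar>bm f x - bm g x\<bar> \<le> dist f g" for f g :: "'a bmfun" and x
    using abs_bm_le_norm[of "f - g" x] by (simp add: dist_norm)
  have "convergent (\<lambda>n. bm (X n) x)" for x
  proof (rule Cauchy_convergent, rule metric_CauchyI)
    fix e :: real assume "0 < e"
    then obtain N where "\<forall>m\<ge>N. \<forall>n\<ge>N. dist (X m) (X n) < e" using metric_CauchyD[OF X] by blast
    then show "\<exists>N. \<forall>m\<ge>N. \<forall>n\<ge>N. dist (bm (X m) x) (bm (X n) x) < e"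
      using dist_bm by (metis dist_real_def order_le_less_trans)
  qed
  then obtain f where f: "\<And>x. (\<lambda>n. bm (X n) x) \<longlonglongrightarrow> f x"
    unfolding convergent_def by metis
  have unif: "\<exists>N. \<forall>n\<ge>N. \<forall>x. \<bar>bm (X n) x - f x\<bar> \<le> e" if e: "0 < e" for e
  proof -
    obtain N where N: "\<forall>m\<ge>N. \<forall>n\<ge>N. dist (X m) (X n) < e" using metric_CauchyD[OF X e] by blast
    have "\<bar>bm (X n) x - f x\<bar> \<le> e" if "N \<le> n" for n x
    proof (rule tendsto_upperbound[OF _ _ sequentially_bot])
      show "(\<lambda>m. \<bar>bm (X n) x - bm (X m) x\<bar>) \<longlonglongrightarrow> \<bar>bm (X n) x - f x\<bar>"
        by (intro tendsto_intros f)
      show "\<forall>\<^sub>F m in sequentially. \<bar>bm (X n) x - bm (X m) x\<bar> \<le> e"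
        using N that dist_bm by (intro eventually_sequentiallyI[of N]) (meson less_imp_le order_trans)
    qed
    then show ?thesis by blast
  qed
  obtain N where N: "\<And>x. \<bar>bm (X N) x - f x\<bar> \<le> 1" using unif[of 1] by auto
  have "f \<in> Bb"
  proof (rule BbI)
    show "f \<in> borel_measurable borel"
      by (rule borel_measurable_LIMSEQ_real[OF f]) (rule Bb_measurable[OF bm])
    show "\<bar>f x\<bar> \<le> norm (X N) + 1" for x
      using N[of x] abs_bm_le_norm[of "X N" x] by linarith
  qed
  have "X \<longlonglongrightarrow> Bm f"
  proof (rule metric_LIMSEQ_I)
    fix e :: real assume "0 < e"
    then obtain N where N: "\<forall>n\<ge>N. \<forall>x. \<bar>bm (X n) x - f x\<bar> \<le> e / 2" using unif[of "e / 2"] by auto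
    have "dist (X n) (Bm f) < e" if "N \<le> n" for n
    proof -
      have "norm (X n - Bm f) \<le> e / 2"
        using N that \<open>f \<in> Bb\<close> by (intro norm_bm_leI) (simp add: Bm_inverse)
      then show ?thesis using \<open>0 < e\<close> by (simp add: dist_norm)
    qed
    then show "\<exists>N. \<forall>n\<ge>N. dist (X n) (Bm f) < e" by blast
  qed
  then show "convergent X" by (auto simp: convergent_def)
qed

lemma sup_norm_eq_norm: "f \<in> Bb \<Longrightarrow> sup_norm f = ereal (norm (Bm f))"
proof -
  assume f: "f \<in> Bb"
  have "sup_norm f \<le> ereal (norm (Bm f))"
    unfolding sup_norm_def using abs_bm_le_norm[of "Bm f"] by (auto intro!: SUP_least simp: Bm_inverse f)
  moreover have "ereal (norm (Bm f)) \<le> sup_norm f"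
  proof (cases "sup_norm f")
    case (real r)
    have "\<bar>f x\<bar> \<le> r" for x
      using SUP_upper[of x UNIV "\<lambda>x. ereal \<bar>f x\<bar>"] real by (simp add: sup_norm_def)
    then show ?thesis using real by (auto intro!: norm_bm_leI simp: Bm_inverse f)
  next
    case MInf
    then show ?thesis using SUP_upper[of undefined UNIV "\<lambda>x. ereal \<bar>f x\<bar>"] by (simp add: sup_norm_def)
  qed simp
  ultimately show ?thesis by (rule antisym)
qed

text \<open>Puts the derivative into the difference-quotient shape of
  \<open>has_path_derivative\<close>; dividing by \<open>r - t\<close> is harmless because the
  filter excludes \<open>r = t\<close>.\<close>

lemma has_vector_derivative_iff_quotient:
  "(f has_vector_derivative D) (at t within S) \<longleftrightarrow>
     ((\<lambda>r. (f r - f t) /\<^sub>R (r - t) - D) \<longlongrightarrow> 0) (at t within S)"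
proof -
  have "norm ((f r - f t - (r - t) *\<^sub>R D) /\<^sub>R norm (r - t)) = norm ((f r - f t) /\<^sub>R (r - t) - D)"
    if "r \<noteq> t" for r
  proof -
    have "(f r - f t) /\<^sub>R (r - t) - D = (f r - f t - (r - t) *\<^sub>R D) /\<^sub>R (r - t)"
      using that by (simp add: scaleR_diff_right)
    then show ?thesis by simp
  qed
  then have "((\<lambda>r. norm ((f r - f t - (r - t) *\<^sub>R D) /\<^sub>R norm (r - t))) \<longlongrightarrow> 0) (at t within S) \<longleftrightarrow>
     ((\<lambda>r. norm ((f r - f t) /\<^sub>R (r - t) - D)) \<longlongrightarrow> 0) (at t within S)"
    by (intro filterlim_cong) (auto simp: eventually_at_filter)
  moreover have "(\<lambda>r. (f r - f t - (r - t) *\<^sub>R D) /\<^sub>R norm (r - t)) =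
      (\<lambda>r. (1 / norm (r - t)) *\<^sub>R (f r - (f t + (r - t) *\<^sub>R D)))"
    by (simp only: diff_diff_eq inverse_eq_divide)
  ultimately show ?thesis
    unfolding tendsto_norm_zero_iff has_vector_derivative_def has_derivative_within
    by (simp only: bounded_linear_scaleR_left simp_thms)
qed

lemma eventually_at_within_nonneg:
  "(\<And>r. 0 \<le> r \<Longrightarrow> r \<noteq> t \<Longrightarrow> P r) \<Longrightarrow> \<forall>\<^sub>F r in at t within {0..}. P r" for t :: real
  by (auto simp: eventually_at_filter)

text \<open>Turns paths for \<open>sup_norm\<close> into ordinary differentiable curves in the
  Banach space \<open>bmfun\<close>.\<close>

lemma sup_norm_path_derivative_iff:
  assumes z: "\<And>r. 0 \<le> r \<Longrightarrow> z r \<in> Bb" and t: "0 \<le> t"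
  shows "has_path_derivative Bb sup_norm z z' t \<longleftrightarrow>
    z' \<in> Bb \<and> ((\<lambda>r. Bm (z r)) has_vector_derivative Bm z') (at t within {0..})"
proof -
  have "(((\<lambda>r. sup_norm (\<lambda>x. (z r x - z t x) / (r - t) - z' x)) \<longlongrightarrow> 0) (at t within {0..})) \<longleftrightarrow>
     ((\<lambda>r. (Bm (z r) - Bm (z t)) /\<^sub>R (r - t) - Bm z') \<longlongrightarrow> 0) (at t within {0..})"
    if z': "z' \<in> Bb"
  proof -
    have "sup_norm (\<lambda>x. (z r x - z t x) / (r - t) - z' x) =
        ereal (norm ((Bm (z r) - Bm (z t)) /\<^sub>R (r - t) - Bm z'))" if r: "0 \<le> r" for r
    proof -
      have Bb: "(\<lambda>x. (z r x - z t x) / (r - t) - z' x) \<in> Bb"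
        unfolding divide_inverse using z[OF r] z[OF t] z' by (intro Bb_intros)
      have "Bm (\<lambda>x. (z r x - z t x) / (r - t) - z' x) = (Bm (z r) - Bm (z t)) /\<^sub>R (r - t) - Bm z'"
        using z[OF r] z[OF t] z' Bb by (intro bm_inject_ext) (simp add: Bm_inverse divide_inverse mult.commute)
      then show ?thesis using sup_norm_eq_norm[OF Bb] by simp
    qed
    then have "(((\<lambda>r. sup_norm (\<lambda>x. (z r x - z t x) / (r - t) - z' x)) \<longlongrightarrow> 0) (at t within {0..})) \<longleftrightarrow>
       ((\<lambda>r. ereal (norm ((Bm (z r) - Bm (z t)) /\<^sub>R (r - t) - Bm z'))) \<longlongrightarrow> ereal 0) (at t within {0..})"
      by (intro filterlim_cong eventually_at_within_nonneg) (auto simp: zero_ereal_def)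
    then show ?thesis unfolding lim_ereal tendsto_norm_zero_iff .
  qed
  then show ?thesis unfolding has_path_derivative_def has_vector_derivative_iff_quotient by blast
qed

lemma sup_norm_tendsto_iff:
  fixes t :: real
  assumes z: "\<And>r. 0 \<le> r \<Longrightarrow> z r \<in> Bb" and t: "0 \<le> t"
  shows "((\<lambda>r. sup_norm (\<lambda>x. z r x - z t x)) \<longlongrightarrow> 0) (at t within {0..}) \<longleftrightarrow>
    ((\<lambda>r. Bm (z r)) \<longlongrightarrow> Bm (z t)) (at t within {0..})"
proof -
  have "sup_norm (\<lambda>x. z r x - z t x) = ereal (norm (Bm (z r) - Bm (z t)))" if r: "0 \<le> r" for r
  proof -
    have Bb: "(\<lambda>x. z r x - z t x) \<in> Bb" using z[OF r] z[OF t] by (intro Bb_intros)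
    have "Bm (\<lambda>x. z r x - z t x) = Bm (z r) - Bm (z t)"
      using z[OF r] z[OF t] Bb by (intro bm_inject_ext) (simp add: Bm_inverse)
    then show ?thesis using sup_norm_eq_norm[OF Bb] by simp
  qed
  then have "\<forall>\<^sub>F r in at t within {0..}. sup_norm (\<lambda>x. z r x - z t x) = ereal (norm (Bm (z r) - Bm (z t)))"
    by (intro eventually_at_within_nonneg) simp
  then have "((\<lambda>r. sup_norm (\<lambda>x. z r x - z t x)) \<longlongrightarrow> 0) (at t within {0..}) \<longleftrightarrow>
     ((\<lambda>r. ereal (norm (Bm (z r) - Bm (z t)))) \<longlongrightarrow> ereal 0) (at t within {0..})"
    by (intro filterlim_cong) (auto simp: zero_ereal_def)
  then show ?thesis unfolding lim_ereal tendsto_norm_zero_iff LIM_zero_iff .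
qed

section \<open>Relative entropy and total variation\<close>

text \<open>Holds for arbitrary functions, because \<open>nn_integral\<close> is monotone without
  measurability. This is what allows \<open>value_fun\<close> to be bounded below for policies whose
  relative entropies are not known to be measurable.\<close>

lemma ext_integral_mono_AE:
  "AE x in N. f x \<le> g x \<Longrightarrow> ext_integral N f \<le> ext_integral N g"
  unfolding ext_integral_def
  by (intro ereal_minus_mono) (auto simp: less_eq_ennreal.rep_eq[symmetric] elim!: eventually_mono
    intro!: nn_integral_mono_AE e2ennreal_mono)

lemma ext_integral_cong_AE:
  "AE x in N. f x = g x \<Longrightarrow> ext_integral N f = ext_integral N g"
  by (intro antisym ext_integral_mono_AE) (auto elim: eventually_mono)

lemma ext_integral_ereal:
  assumes "integrable N f"
  shows "ext_integral N (\<lambda>x. ereal (f x)) = ereal (LINT x|N. f x)"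
proof -
  have fin: "(\<integral>\<^sup>+x. ennreal (f x) \<partial>N) < \<infinity>" "(\<integral>\<^sup>+x. ennreal (- f x) \<partial>N) < \<infinity>"
    using assms by (auto simp: real_integrable_def less_top)
  then have "enn2ereal (\<integral>\<^sup>+x. ennreal (f x) \<partial>N) = ereal (enn2real (\<integral>\<^sup>+x. ennreal (f x) \<partial>N))"
    "enn2ereal (\<integral>\<^sup>+x. ennreal (- f x) \<partial>N) = ereal (enn2real (\<integral>\<^sup>+x. ennreal (- f x) \<partial>N))"
    by (metis enn2ereal_ennreal enn2real_nonneg ennreal_enn2real infinity_ennreal_def)+
  then show ?thesis
    by (simp add: ext_integral_def real_lebesgue_integral_def[OF assms] e2ennreal_ereal)
qed

lemma (in finite_measure) integrable_bounded:
  fixes f :: "'a \<Rightarrow> real"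
  shows "f \<in> borel_measurable M \<Longrightarrow> (\<And>x. \<bar>f x\<bar> \<le> C) \<Longrightarrow> integrable M f"
  by (rule integrable_const_bound[of _ C]) auto

lemma (in prob_space) integral_bounds:
  fixes f :: "'a \<Rightarrow> real"
  assumes "f \<in> borel_measurable M" "\<And>x. \<bar>f x\<bar> \<le> C"
  shows "\<bar>integral\<^sup>L M f\<bar> \<le> C"
proof -
  have "\<bar>integral\<^sup>L M f\<bar> \<le> (LINT x|M. \<bar>f x\<bar>)" by (rule integral_abs_bound)
  also have "\<dots> \<le> C" using assms by (intro integral_le_const integrable_bounded[of _ C]) auto
  finally show ?thesis .
qed

lemma RN_deriv_exp_density:
  assumes N: "prob_space N" and h: "h \<in> borel_measurable N"
  shows "AE x in N. ln (enn2real (RN_deriv N (density N (\<lambda>x. ennreal (exp (h x)))) x)) = h x"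
proof -
  interpret N: prob_space N by fact
  have "AE x in N. ennreal (exp (h x)) = RN_deriv N (density N (\<lambda>x. ennreal (exp (h x)))) x"
    using h by (intro N.RN_deriv_unique) auto
  then show ?thesis
    by (rule eventually_mono) (metis enn2real_ennreal exp_ge_zero ln_exp)
qed

lemma AE_density_exp_iff:
  "h \<in> borel_measurable N \<Longrightarrow> (AE x in density N (\<lambda>x. ennreal (exp (h x))). P x) \<longleftrightarrow> (AE x in N. P x)"
  by (subst AE_density) auto

lemma KL_density_exp:
  assumes N: "prob_space N" and m: "prob_space (density N (\<lambda>x. ennreal (exp (h x))))"
    and h: "h \<in> borel_measurable N" "\<And>x. \<bar>h x\<bar> \<le> C"
  shows "KL (density N (\<lambda>x. ennreal (exp (h x)))) N
    = ereal (LINT x|density N (\<lambda>x. ennreal (exp (h x))). h x)"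
proof -
  let ?m = "density N (\<lambda>x. ennreal (exp (h x)))"
  interpret m: prob_space ?m by fact
  have "absolutely_continuous N ?m"
    using h by (intro absolutely_continuousI_density) auto
  then have "KL ?m N = ext_integral ?m (\<lambda>x. ereal (ln (enn2real (RN_deriv N ?m x))))"
    by (simp add: KL_def)
  also have "\<dots> = ext_integral ?m (\<lambda>x. ereal (h x))"
    using RN_deriv_exp_density[OF N h(1)] AE_density_exp_iff[OF h(1)]
    by (intro ext_integral_cong_AE) (auto elim!: eventually_mono)
  also have "\<dots> = ereal (LINT x|?m. h x)"
    using h by (intro ext_integral_ereal m.integrable_bounded) auto
  finally show ?thesis .
qed

text \<open>The log-density \<open>u\<close> may fail to be integrable, so it is bounded below by an
  integrable function: \<open>exp z \<ge> 1 + z\<close> at \<open>z = g - K - u\<close> gives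
  \<open>u \<ge> g - K + 1 - exp (g - K - u)\<close>. A change of measure shows that the last
  exponential has \<open>m\<close>-integral at most 1, which cancels the constant 1.\<close>

lemma KL_variational:
  assumes m: "prob_space m" and N: "prob_space N" and sets: "sets m = sets N"
    and g: "g \<in> borel_measurable N" "\<And>x. \<bar>g x\<bar> \<le> C"
  shows "ereal ((LINT x|m. g x) - ln (LINT x|N. exp (g x))) \<le> KL m N"
proof (cases "absolutely_continuous N m")
  case False
  then show ?thesis by (simp add: KL_def)
next
  case ac: True
  interpret m: prob_space m by fact
  interpret N: prob_space N by fact
  have [measurable_cong]: "sets m = sets N" by fact
  note g(1)[measurable]
  define D where "D = RN_deriv N m"
  have [measurable]: "D \<in> borel_measurable N" by (simp add: D_def)
  have dens: "density N D = m"
    unfolding D_def using ac sets by (rule N.density_RN_deriv)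
  have fin: "AE x in N. D x \<noteq> \<infinity>"
    unfolding D_def using ac sets by (intro N.RN_deriv_finite m.sigma_finite_measure)
  define u where "u x = ln (enn2real (D x))" for x
  have [measurable]: "u \<in> borel_measurable N" unfolding u_def by measurable
  \<comment> \<open>Normalises \<open>g\<close>: the function \<open>exp (g - K)\<close> has
    \<open>N\<close>-mean 1.\<close>
  define K where "K = ln (LINT x|N. exp (g x))"
  have int_exp: "integrable N (\<lambda>x. exp (g x))"
  proof (rule N.integrable_bounded[of _ "exp C"])
    show "\<bar>exp (g x)\<bar> \<le> exp C" for x using g(2)[of x] by simp
  qed simp
  have "exp (- C) \<le> (LINT x|N. exp (g x))"
    using int_exp
  proof (rule N.integral_ge_const)
    have "- C \<le> g x" for x using g(2)[of x] by linarith
    then show "AE x in N. exp (- C) \<le> exp (g x)" by simp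
  qed
  then have pos: "0 < (LINT x|N. exp (g x))" by (rule less_le_trans[OF exp_gt_zero])
  have "(LINT x|N. exp (g x - K)) = 1"
    using pos by (simp add: exp_diff K_def)
  then have one: "(\<integral>\<^sup>+x. ennreal (exp (g x - K)) \<partial>N) = 1"
    using int_exp by (subst nn_integral_eq_integral) (auto simp: exp_diff)
  have "(\<integral>\<^sup>+x. ennreal (exp (g x - K - u x)) \<partial>m) = (\<integral>\<^sup>+x. D x * ennreal (exp (g x - K - u x)) \<partial>N)"
    unfolding dens[symmetric] by (subst nn_integral_density) auto
  also have "\<dots> \<le> (\<integral>\<^sup>+x. ennreal (exp (g x - K)) \<partial>N)"
  proof (rule nn_integral_mono_AE, use fin in eventually_elim)
    case (elim x)
    \<comment> \<open>Where \<open>D\<close> vanishes, \<open>u\<close> takes the default value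
      \<open>ln 0 = 0\<close>, but the factor \<open>D\<close> makes the left side 0. This is why
      only an inequality holds.\<close>
    show "D x * ennreal (exp (g x - K - u x)) \<le> ennreal (exp (g x - K))"
    proof (cases "D x = 0")
      case False
      then obtain r where r: "D x = ennreal r" "0 < r"
        using elim by (cases "D x") (auto simp: less_le)
      then have "u x = ln r" by (simp add: u_def)
      then have "r * exp (g x - K - u x) = exp (g x - K)" using r by (simp add: exp_diff)
      then show ?thesis using r by (simp add: ennreal_mult[symmetric])
    qed simp
  qed
  finally have le1: "(\<integral>\<^sup>+x. ennreal (exp (g x - K - u x)) \<partial>m) \<le> 1" by (simp add: one)
  then have int_u: "integrable m (\<lambda>x. exp (g x - K - u x))"
    by (intro integrableI_bounded) (auto intro: le_less_trans)
  have le1': "(LINT x|m. exp (g x - K - u x)) \<le> 1"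
    using le1 int_u by (subst (asm) nn_integral_eq_integral) auto
  have int_g: "integrable m g" using g by (intro m.integrable_bounded[of _ C]) auto
  have "AE x in m. ereal (g x - K + 1 - exp (g x - K - u x)) \<le> ereal (u x)"
  proof (rule AE_I2)
    fix x
    show "ereal (g x - K + 1 - exp (g x - K - u x)) \<le> ereal (u x)"
      using exp_ge_add_one_self[of "g x - K - u x"] unfolding ereal_less_eq by linarith
  qed
  then have "ext_integral m (\<lambda>x. ereal (g x - K + 1 - exp (g x - K - u x))) \<le> KL m N"
    using ac unfolding KL_def u_def D_def by (auto intro: ext_integral_mono_AE)
  moreover have "ext_integral m (\<lambda>x. ereal (g x - K + 1 - exp (g x - K - u x)))
      = ereal (LINT x|m. g x - K + 1 - exp (g x - K - u x))"
    using int_g int_u by (intro ext_integral_ereal) auto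
  moreover have "(LINT x|m. g x - K + 1 - exp (g x - K - u x))
      = (LINT x|m. g x) - K + 1 - (LINT x|m. exp (g x - K - u x))"
    using int_g int_u by (simp add: m.prob_space)
  ultimately have "ereal ((LINT x|m. g x) - K + 1 - (LINT x|m. exp (g x - K - u x))) \<le> KL m N" by simp
  moreover have "ereal ((LINT x|m. g x) - K)
      \<le> ereal ((LINT x|m. g x) - K + 1 - (LINT x|m. exp (g x - K - u x)))"
    using le1' by simp
  ultimately show ?thesis unfolding K_def by (rule order_trans[rotated])
qed

lemma KL_nonneg:
  assumes "prob_space m" "prob_space N" "sets m = sets N"
  shows "0 \<le> KL m N"
proof -
  interpret N: prob_space N by fact
  show ?thesis
    using KL_variational[OF assms, of "\<lambda>_. 0" 0] by (simp add: N.prob_space zero_ereal_def)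
qed

text \<open>Pinsker's inequality tested against one function: the variational bound for the multiple
  \<open>d * f\<close>, with Hoeffding's lemma controlling the exponential moment.\<close>

lemma pinsker_test_function:
  assumes N: "prob_space N" and m: "prob_space m" and sets: "sets m = sets N"
    and f: "f \<in> borel_measurable N" "\<And>x. \<bar>f x\<bar> \<le> 1" and KL: "KL m N = ereal k"
  shows "((LINT x|m. f x) - (LINT x|N. f x))\<^sup>2 \<le> 2 * k"
proof -
  interpret N: prob_space N by fact
  have pos: "((LINT x|m. f x) - (LINT x|N. f x))\<^sup>2 \<le> 2 * k"
    if f: "f \<in> borel_measurable N" "\<And>x. \<bar>f x\<bar> \<le> 1"
      and d_pos: "0 < (LINT x|m. f x) - (LINT x|N. f x)" for f
  proof -
    \<comment> \<open>The tilt equals the difference to be estimated, because that choice of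
      \<open>x\<close> maximises \<open>x * d - x\<^sup>2 / 2\<close> in words: the linear gain
      minus the Gaussian loss.\<close>
    define d where "d = (LINT x|m. f x) - (LINT x|N. f x)"
    have d: "0 < d" using d_pos by (simp add: d_def)
    interpret f: interval_bounded_random_variable N f "- 1" 1
      using f(1,2) by unfold_locales (auto simp: abs_le_iff minus_le_iff intro!: AE_I2)
    define E where "E = (LINT x|N. f x)"
    have int_exp: "integrable N (\<lambda>x. exp (d * f x))"
    proof (rule N.integrable_bounded[of _ "exp d"])
      show "\<bar>exp (d * f x)\<bar> \<le> exp d" for x using f(2)[of x] d by (auto simp: abs_le_iff)
    qed (use f in auto)
    have "exp (- d) \<le> (LINT x|N. exp (d * f x))"
      using int_exp
    proof (rule N.integral_ge_const)
      have "- d \<le> d * f x" for x using f(2)[of x] d mult_left_mono[of "- 1" "f x" d] by auto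
      then show "AE x in N. exp (- d) \<le> exp (d * f x)" by simp
    qed
    then have exp_pos: "0 < (LINT x|N. exp (d * f x))" by (rule less_le_trans[OF exp_gt_zero])
    \<comment> \<open>The values of \<open>f\<close> lie in an interval of length 2, so Hoeffding's
      exponent is \<open>4 / 8 = 1 / 2\<close> times the square of the tilt.\<close>
    have "(\<integral>\<^sup>+x. ennreal (exp (d * (f x - E))) \<partial>N) \<le> ennreal (exp (d\<^sup>2 * (1 - - 1)\<^sup>2 / 8))"
      unfolding E_def by (rule f.Hoeffdings_lemma_nn_integral[OF d])
    moreover have "(\<integral>\<^sup>+x. ennreal (exp (d * (f x - E))) \<partial>N)
        = ennreal (LINT x|N. exp (d * (f x - E)))"
      using int_exp by (intro nn_integral_eq_integral) (auto simp: right_diff_distrib exp_diff)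
    ultimately have "(LINT x|N. exp (d * (f x - E))) \<le> exp (d\<^sup>2 / 2)"
      by (simp add: ennreal_le_iff)
    then have "exp (d * E) * (LINT x|N. exp (d * (f x - E))) \<le> exp (d * E) * exp (d\<^sup>2 / 2)"
      by (intro mult_left_mono) auto
    moreover have "exp (d * E) * (LINT x|N. exp (d * (f x - E))) = (LINT x|N. exp (d * f x))"
      by (simp add: right_diff_distrib exp_diff)
    ultimately have "ln (LINT x|N. exp (d * f x)) \<le> ln (exp (d * E + d\<^sup>2 / 2))"
      using exp_pos by (subst ln_le_cancel_iff) (auto simp: exp_add)
    then have "ln (LINT x|N. exp (d * f x)) \<le> d * E + d\<^sup>2 / 2" by simp
    moreover have "ereal ((LINT x|m. d * f x) - ln (LINT x|N. exp (d * f x))) \<le> KL m N"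
      using f d by (intro KL_variational[OF m N sets, of _ d]) (auto simp: abs_mult)
    ultimately have "d * (LINT x|m. f x) - (d * E + d\<^sup>2 / 2) \<le> k"
      using KL by simp
    then show ?thesis by (simp add: E_def d_def power2_eq_square field_simps)
  qed
  \<comment> \<open>Hoeffding's lemma asks for a positive tilt; a negative difference is treated by
    passing to \<open>- f\<close>.\<close>
  consider "0 < (LINT x|m. f x) - (LINT x|N. f x)" | "(LINT x|m. f x) = (LINT x|N. f x)"
    | "0 < (LINT x|m. - f x) - (LINT x|N. - f x)" by fastforce
  then show ?thesis
  proof cases
    case 1
    then show ?thesis using pos[OF f] by simp
  next
    case 2
    then show ?thesis using KL_nonneg[OF m N sets] KL by (simp add: zero_ereal_def)
  next
    case 3
    then have "((LINT x|m. - f x) - (LINT x|N. - f x))\<^sup>2 \<le> 2 * k"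
      using f by (intro pos) auto
    then show ?thesis by (simp add: power2_commute)
  qed
qed

text \<open>The triangle inequality bounds the sum over any partition, and the Hahn decomposition
  into \<open>{x. 0 \<le> g x}\<close> and its complement attains the bound.\<close>

lemma tv_norm_density:
  fixes N :: "'a::topological_space measure"
  assumes sets: "sets N = sets borel" and g: "integrable N g"
    and k: "\<And>B. B \<in> sets borel \<Longrightarrow> k B = (LINT x:B|N. g x)"
  shows "tv_norm k = ereal (LINT x|N. \<bar>g x\<bar>)"
proof (rule antisym)
  have [measurable_cong]: "sets N = sets borel" by fact
  have space: "space N = UNIV" using sets_eq_imp_space_eq[OF sets] by simp
  have [measurable]: "g \<in> borel_measurable borel"
    using borel_measurable_integrable[OF g] by (simp cong: measurable_cong_sets add: sets)
  show "tv_norm k \<le> ereal (LINT x|N. \<bar>g x\<bar>)"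
    unfolding tv_norm_def
  proof (rule SUP_least)
    fix \<B> :: "'a set set" assume "\<B> \<in> {\<B>. finite \<B> \<and> \<B> \<subseteq> sets borel \<and> partition_on UNIV \<B>}"
    then have \<B>: "finite \<B>" "\<And>B. B \<in> \<B> \<Longrightarrow> B \<in> sets borel" "partition_on UNIV \<B>" by auto
    have int: "integrable N (\<lambda>x. indicator B x *\<^sub>R \<bar>g x\<bar>)" if "B \<in> \<B>" for B
      using g \<B>(2)[OF that] sets by (intro integrable_mult_indicator integrable_abs) auto
    have "(\<Sum>B\<in>\<B>. \<bar>k B\<bar>) \<le> (\<Sum>B\<in>\<B>. LINT x|N. indicator B x *\<^sub>R \<bar>g x\<bar>)"
    proof (rule sum_mono)
      fix B assume "B \<in> \<B>"
      then have "\<bar>k B\<bar> = \<bar>LINT x|N. indicator B x *\<^sub>R g x\<bar>"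
        using k \<B>(2) by (simp add: set_lebesgue_integral_def)
      also have "\<dots> \<le> (LINT x|N. \<bar>indicator B x *\<^sub>R g x\<bar>)" by (rule integral_abs_bound)
      finally show "\<bar>k B\<bar> \<le> (LINT x|N. indicator B x *\<^sub>R \<bar>g x\<bar>)" by (simp add: abs_mult)
    qed
    also have "\<dots> = (LINT x|N. (\<Sum>B\<in>\<B>. indicator B x *\<^sub>R \<bar>g x\<bar>))"
      using int by (subst Bochner_Integration.integral_sum) auto
    also have "\<dots> = (LINT x|N. \<bar>g x\<bar>)"
    proof (intro Bochner_Integration.integral_cong refl)
      fix x
      obtain B where B: "B \<in> \<B>" "x \<in> B" using \<B>(3) by (auto simp: partition_on_def)
      have "(\<Sum>B\<in>\<B>. indicator B x *\<^sub>R \<bar>g x\<bar>) = (\<Sum>B'\<in>\<B>. if B' = B then \<bar>g x\<bar> else 0)"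
        using B \<B>(3) by (intro sum.cong) (auto simp: indicator_def partition_on_def disjoint_def)
      then show "(\<Sum>B\<in>\<B>. indicator B x *\<^sub>R \<bar>g x\<bar>) = \<bar>g x\<bar>"
        using B \<B>(1) by simp
    qed
    finally show "(\<Sum>B\<in>\<B>. ereal \<bar>k B\<bar>) \<le> ereal (LINT x|N. \<bar>g x\<bar>)" by simp
  qed
  define A where "A = {x. 0 \<le> g x}"
  have A [measurable]: "A \<in> sets borel" unfolding A_def by measurable
  have int: "integrable N (\<lambda>x. indicator B x *\<^sub>R g x)" if "B \<in> sets borel" for B
    using g that sets by (intro integrable_mult_indicator) auto
  have "(LINT x|N. \<bar>g x\<bar>) = (LINT x|N. indicator A x *\<^sub>R g x - indicator (- A) x *\<^sub>R g x)"
    by (intro Bochner_Integration.integral_cong) (auto simp: A_def indicator_def)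
  also have "\<dots> = k A - k (- A)"
    using int[of A] int[of "- A"] k[of A] k[of "- A"]
    by (subst Bochner_Integration.integral_diff) (auto simp: set_lebesgue_integral_def)
  also have "\<dots> \<le> \<bar>k A\<bar> + \<bar>k (- A)\<bar>" by linarith
  finally have le: "ereal (LINT x|N. \<bar>g x\<bar>) \<le> ereal \<bar>k A\<bar> + ereal \<bar>k (- A)\<bar>" by simp
  have k0: "k {} = 0" using k[of "{}"] by (simp add: set_lebesgue_integral_def)
  \<comment> \<open>A partition has no empty block, so an empty half is discarded; it contributes 0
    to the sum.\<close>
  define \<B> where "\<B> = {A, - A} - {{}}"
  have "partition_on UNIV \<B>"
    by (auto simp: \<B>_def partition_on_def disjoint_def)
  then have "(\<Sum>B\<in>\<B>. ereal \<bar>k B\<bar>) \<le> tv_norm k"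
    unfolding tv_norm_def by (intro SUP_upper) (auto simp: \<B>_def)
  moreover have "(\<Sum>B\<in>\<B>. ereal \<bar>k B\<bar>) = (\<Sum>B\<in>{A, - A}. ereal \<bar>k B\<bar>)"
    unfolding \<B>_def by (intro sum.mono_neutral_left) (auto simp: k0 zero_ereal_def)
  moreover have "(\<Sum>B\<in>{A, - A}. ereal \<bar>k B\<bar>) = ereal \<bar>k A\<bar> + ereal \<bar>k (- A)\<bar>"
  proof -
    have "A \<noteq> - A" by auto
    then show ?thesis by simp
  qed
  ultimately show "ereal (LINT x|N. \<bar>g x\<bar>) \<le> tv_norm k" using le by (metis order_trans)
qed

section \<open>Trajectories\<close>

lemma measurable_to_prob_algebraD:
  assumes "K \<in> M \<rightarrow>\<^sub>M prob_algebra N" "x \<in> space M"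
  shows "prob_space (K x)" "sets (K x) = sets N"
  using measurable_space[OF assms] by (auto simp: space_prob_algebra)

lemma integral_bind_prob:
  fixes f :: "'b \<Rightarrow> real"
  assumes "prob_space m" "K \<in> m \<rightarrow>\<^sub>M prob_algebra N" "f \<in> borel_measurable N" "\<And>x. \<bar>f x\<bar> \<le> C"
  shows "(LINT y|(m \<bind> K). f y) = (LINT x|m. LINT y|K x. f y)"
proof (rule integral_bind[where B' = 1 and K = N])
  show "finite_measure m" using assms(1) by (rule prob_space.finite_measure)
  show "AE x in m. emeasure (K x) (space (K x)) \<le> ennreal 1"
    using measurable_to_prob_algebraD(1)[OF assms(2)]
    by (intro AE_I2) (simp add: prob_space.emeasure_space_1)
  show "K \<in> m \<rightarrow>\<^sub>M subprob_algebra N" using assms(2) by (rule measurable_prob_algebraD)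
qed (rule assms)+

text \<open>The integrand depends on the parameter as well. Pushing \<open>K x\<close> forward along
  \<open>y \<mapsto> (x, y)\<close> yields a kernel into the product space, against which a single
  fixed function is integrated.\<close>

lemma measurable_kernel_integral:
  fixes f :: "'a \<Rightarrow> 'b \<Rightarrow> real"
  assumes K: "K \<in> M \<rightarrow>\<^sub>M prob_algebra N"
    and f: "(\<lambda>(x, y). f x y) \<in> borel_measurable (M \<Otimes>\<^sub>M N)"
  shows "(\<lambda>x. LINT y|K x. f x y) \<in> borel_measurable M"
proof -
  have "(\<lambda>x. distr (K x) (M \<Otimes>\<^sub>M N) (\<lambda>y. (x, y))) \<in> M \<rightarrow>\<^sub>M subprob_algebra (M \<Otimes>\<^sub>M N)"
    by (rule measurable_distr2[where M = N]) (use measurable_prob_algebraD[OF K] in auto)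
  from measurable_compose[OF this integral_measurable_subprob_algebra[OF f]]
  have "(\<lambda>x. LINT z|distr (K x) (M \<Otimes>\<^sub>M N) (\<lambda>y. (x, y)). (case z of (x, y) \<Rightarrow> f x y)) \<in> borel_measurable M" .
  moreover have "(LINT z|distr (K x) (M \<Otimes>\<^sub>M N) (\<lambda>y. (x, y)). (case z of (x, y) \<Rightarrow> f x y)) = (LINT y|K x. f x y)"
    if x: "x \<in> space M" for x
  proof -
    have "Pair x \<in> K x \<rightarrow>\<^sub>M M \<Otimes>\<^sub>M N"
      using measurable_Pair1'[OF x] measurable_to_prob_algebraD(2)[OF K x] by (simp cong: measurable_cong_sets)
    then show ?thesis using f by (subst integral_distr) auto
  qed
  ultimately show ?thesis by (simp cong: measurable_cong)
qed

lemma kernel_integral_Bb: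
  assumes K: "K \<in> borel \<rightarrow>\<^sub>M prob_algebra borel" and f: "f \<in> Bb"
  shows "(\<lambda>x. LINT y|K x. f y) \<in> Bb"
proof -
  obtain C where C: "\<And>x. \<bar>f x\<bar> \<le> C" using Bb_bound[OF f] by (auto simp: bdd_above_def)
  show ?thesis
  proof (rule BbI)
    show "(\<lambda>x. LINT y|K x. f y) \<in> borel_measurable borel"
      by (rule measurable_compose[OF measurable_prob_algebraD[OF K]
        integral_measurable_subprob_algebra[OF Bb_measurable[OF f]]])
    fix x
    interpret prob_space "K x" using measurable_to_prob_algebraD(1)[OF K] by simp
    show "\<bar>LINT y|K x. f y\<bar> \<le> C"
      using measurable_to_prob_algebraD(2)[OF K, of x] Bb_measurable[OF f] C
      by (intro integral_bounds) (auto cong: measurable_cong_sets)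
  qed
qed

lemma measurable_fst_borel: "fst \<in> borel_measurable (borel :: ('a::second_countable_topology \<times> 'b::second_countable_topology) measure)"
  unfolding borel_prod[symmetric] by simp

lemma Bb_fst:
  fixes h :: "'a::second_countable_topology \<Rightarrow> real"
  shows "h \<in> Bb \<Longrightarrow> (\<lambda>x :: 'a \<times> 'b::second_countable_topology. h (fst x)) \<in> Bb"
proof -
  assume h: "h \<in> Bb"
  obtain C where "\<And>x. \<bar>h x\<bar> \<le> C" using Bb_bound[OF h] by (auto simp: bdd_above_def)
  then show ?thesis
    by (intro BbI[of _ C] measurable_compose[OF measurable_fst_borel Bb_measurable[OF h]])
qed

lemma BbE:
  assumes "f \<in> Bb"
  obtains C where "f \<in> borel_measurable borel" "\<And>x. \<bar>f x\<bar> \<le> C" "0 \<le> C"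
proof -
  obtain C where C: "\<And>x. \<bar>f x\<bar> \<le> C" using Bb_bound[OF assms] by (auto simp: bdd_above_def)
  then have "0 \<le> C" by (meson abs_ge_zero order_trans)
  with C Bb_measurable[OF assms] that show ?thesis by blast
qed

lemma Bb_slice:
  fixes f :: "'a::second_countable_topology \<times> 'b::second_countable_topology \<Rightarrow> real"
  assumes "f \<in> Bb"
  shows "(\<lambda>y. f (x, y)) \<in> Bb"
proof -
  obtain C where C: "f \<in> borel_measurable borel" "\<And>x. \<bar>f x\<bar> \<le> C" "0 \<le> C" by (rule BbE[OF assms]) blast
  have "Pair x \<in> borel \<rightarrow>\<^sub>M (borel :: ('a \<times> 'b) measure)" by (simp add: borel_prod[symmetric])
  from measurable_compose[OF this C(1)] show ?thesis using C(2) by (intro BbI[of _ C]) auto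
qed

locale entropy_mdp =
  fixes M :: "('s::polish_space, 'a::polish_space) mdp"
  assumes regularised: "regularised_mdp M"
begin

abbreviation "\<mu> \<equiv> ref_measure M"
abbreviation "\<gamma> \<equiv> discount M"
abbreviation "\<tau> \<equiv> temperature M"
abbreviation "c \<equiv> cost M"
abbreviation "P \<equiv> transition M"

lemma P_measurable [measurable]: "P \<in> borel \<rightarrow>\<^sub>M prob_algebra borel"
  and c_Bb: "c \<in> Bb"
  and \<gamma>: "0 \<le> \<gamma>" "\<gamma> < 1"
  and \<tau>: "0 < \<tau>"
  and prob_space_\<mu>: "prob_space \<mu>"
  and sets_\<mu> [simp, measurable_cong]: "sets \<mu> = sets borel"
  using regularised by (auto simp: regularised_mdp_def space_prob_algebra)

lemma space_\<mu> [simp]: "space \<mu> = UNIV"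
  using sets_eq_imp_space_eq[OF sets_\<mu>] by simp

lemma prob_space_P: "prob_space (P x)" and sets_P [simp, measurable_cong]: "sets (P x) = sets borel"
  using measurable_to_prob_algebraD[OF P_measurable, of x] by auto

definition next_mean :: "('s \<Rightarrow> real) \<Rightarrow> 's \<times> 'a \<Rightarrow> real" where
  "next_mean h x = (LINT s'|P x. h s')"

lemma next_mean_Bb: "h \<in> Bb \<Longrightarrow> next_mean h \<in> Bb"
  unfolding next_mean_def[abs_def] by (rule kernel_integral_Bb[OF P_measurable])

end

locale mdp_trajectory = entropy_mdp M for M :: "('s::polish_space, 'a::polish_space) mdp" +
  fixes \<pi> :: "('s, 'a) policy" and s :: 's
  assumes policy: "\<pi> \<in> policies"
begin

abbreviation "L \<equiv> trajectory_law M \<pi> s"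
abbreviation "hist \<omega> n \<equiv> (restrict \<omega> {0..<n}, fst (\<omega> n))"

lemma policy_measurable [measurable]:
  "\<pi> n \<in> PiM {0..<n} (\<lambda>_. borel) \<Otimes>\<^sub>M borel \<rightarrow>\<^sub>M prob_algebra borel"
  using policy by (auto simp: policies_def)

definition state_kernel :: "nat \<Rightarrow> (nat \<Rightarrow> 's \<times> 'a) \<Rightarrow> 's measure" where
  "state_kernel n \<omega> = (if n = 0 then return borel s else P (\<omega> (n - 1)))"

definition action_kernel :: "nat \<Rightarrow> (nat \<Rightarrow> 's \<times> 'a) \<Rightarrow> 's \<Rightarrow> ('s \<times> 'a) measure" where
  "action_kernel n \<omega> s' = \<pi> n (\<omega>, s') \<bind> (\<lambda>a. return borel (s', a))"

lemma step_kernel_eq: "step_kernel M \<pi> s n \<omega> = state_kernel n \<omega> \<bind> action_kernel n \<omega>"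
  by (simp add: step_kernel_def state_kernel_def action_kernel_def[abs_def])

lemma state_kernel_measurable: "state_kernel n \<in> PiM {0..<n} (\<lambda>_. borel) \<rightarrow>\<^sub>M prob_algebra borel"
proof (cases n)
  case 0
  have "return borel s \<in> space (prob_algebra borel)"
    by (auto simp: space_prob_algebra prob_space_return)
  then show ?thesis by (simp add: state_kernel_def[abs_def] 0)
next
  case (Suc k)
  then have "(\<lambda>\<omega>. P (\<omega> k)) \<in> PiM {0..<n} (\<lambda>_. borel) \<rightarrow>\<^sub>M prob_algebra borel"
    by (intro measurable_compose[where N = borel and g = P, OF _ P_measurable]
      measurable_component_singleton) auto
  then show ?thesis by (simp add: state_kernel_def[abs_def] Suc)
qed

lemma return_pair_measurable: "(\<lambda>a. return borel (s', a)) \<in> borel \<rightarrow>\<^sub>M prob_algebra (borel :: ('s \<times> 'a) measure)"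
  by (rule measurable_compose[OF _ measurable_return_prob_space]) (simp add: borel_prod[symmetric])

lemma action_kernel_measurable:
  "(\<lambda>(\<omega>, s'). action_kernel n \<omega> s') \<in> PiM {0..<n} (\<lambda>_. borel) \<Otimes>\<^sub>M borel \<rightarrow>\<^sub>M prob_algebra borel"
  unfolding action_kernel_def case_prod_beta
proof (rule measurable_bind_prob_space2[where N = borel])
  show "(\<lambda>x. \<pi> n (fst x, snd x)) \<in> PiM {0..<n} (\<lambda>_. borel) \<Otimes>\<^sub>M borel \<rightarrow>\<^sub>M prob_algebra borel"
    by simp
  have "(\<lambda>y. (snd (fst y), snd y)) \<in> (PiM {0..<n} (\<lambda>_. borel :: ('s \<times> 'a) measure) \<Otimes>\<^sub>M borel) \<Otimes>\<^sub>M borel \<rightarrow>\<^sub>M (borel :: ('s \<times> 'a) measure)"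
    unfolding borel_prod[symmetric] by measurable
  then show "(\<lambda>(x, y). return borel (snd x, y)) \<in> (PiM {0..<n} (\<lambda>_. borel :: ('s \<times> 'a) measure) \<Otimes>\<^sub>M borel) \<Otimes>\<^sub>M borel \<rightarrow>\<^sub>M prob_algebra (borel :: ('s \<times> 'a) measure)"
    unfolding case_prod_beta by (rule measurable_compose[OF _ measurable_return_prob_space])
qed

lemma step_kernel_measurable:
  "step_kernel M \<pi> s n \<in> PiM {0..<n} (\<lambda>_. borel) \<rightarrow>\<^sub>M prob_algebra borel"
proof -
  have "(\<lambda>\<omega>. state_kernel n \<omega> \<bind> action_kernel n \<omega>) \<in> PiM {0..<n} (\<lambda>_. borel) \<rightarrow>\<^sub>M prob_algebra borel"
    by (rule measurable_bind_prob_space2[OF state_kernel_measurable action_kernel_measurable])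
  then show ?thesis by (simp add: step_kernel_eq[abs_def])
qed

sublocale IT: Ionescu_Tulcea "step_kernel M \<pi> s" "\<lambda>_. borel"
proof (rule Ionescu_Tulcea.intro)
  show "step_kernel M \<pi> s i \<in> PiM {0..<i} (\<lambda>_. borel) \<rightarrow>\<^sub>M subprob_algebra borel" for i
    by (rule measurable_prob_algebraD[OF step_kernel_measurable])
  show "x \<in> space (PiM {0..<i} (\<lambda>_. borel)) \<Longrightarrow> prob_space (step_kernel M \<pi> s i x)" for i x
    by (rule measurable_to_prob_algebraD(1)[OF step_kernel_measurable])
qed

lemma sets_L [simp, measurable_cong]: "sets L = sets (PiM UNIV (\<lambda>_. borel))"
  unfolding trajectory_law_def by (rule IT.PF.sets_lim)

lemma space_L [simp]: "space L = UNIV"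
  using sets_eq_imp_space_eq[OF sets_L] by (simp add: space_PiM)

text \<open>The projective limit has the finite compositions of the step kernels as marginals; for
  an initial segment of times the cylinder embedding inside \<open>CI\<close> is the
  identity.\<close>

lemma distr_L: "distr L (PiM {0..<n} (\<lambda>_. borel)) (\<lambda>\<omega>. restrict \<omega> {0..<n}) = IT.C 0 n (\<lambda>_. undefined)"
proof -
  have "distr L (PiM {0..<n} (\<lambda>_. borel)) (\<lambda>\<omega>. restrict \<omega> {0..<n}) = IT.CI {0..<n}"
    unfolding trajectory_law_def by (rule IT.distr_lim) simp
  also have "\<dots> = IT.C 0 n (\<lambda>_. undefined)"
  proof (rule measure_eqI)
    show "sets (IT.CI {0..<n}) = sets (IT.C 0 n (\<lambda>_. undefined))"
      by (simp add: IT.CI_def IT.sets_C)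
    fix X assume "X \<in> sets (IT.CI {0..<n})"
    then have X: "X \<in> sets (PiM {0..<n} (\<lambda>_. borel))" by (simp add: IT.CI_def)
    then have "prod_emb {0..<n} (\<lambda>_. borel) {0..<n} X = X"
      using sets.sets_into_space[OF X] by (intro prod_emb_id) (simp add: space_PiM)
    then show "emeasure (IT.CI {0..<n}) X = emeasure (IT.C 0 n (\<lambda>_. undefined)) X"
      using IT.emeasure_CI[OF order_refl X] by simp
  qed
  finally show ?thesis .
qed

lemma prob_space_C0: "prob_space (IT.C 0 n (\<lambda>_. undefined))"
  by (rule IT.prob_space_C) simp

lemma restrict_L: "(\<lambda>\<omega>. restrict \<omega> {0..<n}) \<in> L \<rightarrow>\<^sub>M PiM {0..<n} (\<lambda>_. borel)"
  by (auto intro!: measurable_restrict measurable_component_singleton simp: measurable_cong_sets[OF sets_L refl])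

text \<open>Total mass can be read off any marginal, so the trivial one with no coordinate
  suffices.\<close>

lemma prob_space_L: "prob_space L"
proof (rule prob_space_distrD)
  show "(\<lambda>\<omega>. restrict \<omega> {0..<0}) \<in> L \<rightarrow>\<^sub>M PiM {0..<0} (\<lambda>_. borel)" by (rule restrict_L)
  show "prob_space (distr L (PiM {0..<0} (\<lambda>_. borel)) (\<lambda>\<omega>. restrict \<omega> {0..<0}))"
    unfolding distr_L by (rule prob_space_C0)
qed

sublocale L: prob_space L by (rule prob_space_L)

lemma integral_L_restrict:
  fixes F :: "(nat \<Rightarrow> 's \<times> 'a) \<Rightarrow> real"
  assumes "F \<in> borel_measurable (PiM {0..<n} (\<lambda>_. borel))"
  shows "(LINT \<omega>|L. F (restrict \<omega> {0..<n})) = (LINT \<omega>|IT.C 0 n (\<lambda>_. undefined). F \<omega>)"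
  unfolding distr_L[symmetric] by (rule integral_distr[OF restrict_L assms, symmetric])

text \<open>Conditioning on the first \<open>n\<close> steps: the law of \<open>n + 1\<close> steps
  is that of \<open>n\<close> steps followed by \<open>eP n\<close>, and \<open>eP n\<close> merely
  appends a sample of the step kernel as coordinate \<open>n\<close>, leaving the earlier
  coordinates alone.\<close>

lemma expectation_step:
  fixes f :: "(nat \<Rightarrow> 's \<times> 'a) \<Rightarrow> 's \<times> 'a \<Rightarrow> real"
  assumes f: "(\<lambda>(\<omega>, x). f \<omega> x) \<in> borel_measurable (PiM {0..<n} (\<lambda>_. borel) \<Otimes>\<^sub>M borel)"
    and C: "\<And>\<omega> x. \<bar>f \<omega> x\<bar> \<le> C"
  shows "(LINT \<omega>|L. f (restrict \<omega> {0..<n}) (\<omega> n)) =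
    (LINT \<omega>|L. LINT x|step_kernel M \<pi> s n (restrict \<omega> {0..<n}). f (restrict \<omega> {0..<n}) x)"
proof -
  define F where "F \<omega> = f (restrict \<omega> {0..<n}) (\<omega> n)" for \<omega>
  define G where "G \<omega> = (LINT x|step_kernel M \<pi> s n \<omega>. f \<omega> x)" for \<omega>
  have F: "F \<in> borel_measurable (PiM {0..<Suc n} (\<lambda>_. borel))"
  proof -
    have "(\<lambda>\<omega>. (restrict \<omega> {0..<n}, \<omega> n)) \<in>
        PiM {0..<Suc n} (\<lambda>_. borel) \<rightarrow>\<^sub>M PiM {0..<n} (\<lambda>_. borel) \<Otimes>\<^sub>M borel"
      by (intro measurable_Pair measurable_restrict_subset measurable_component_singleton) auto
    from measurable_compose[OF this f] show ?thesis by (simp add: F_def[abs_def])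
  qed
  have G: "G \<in> borel_measurable (PiM {0..<n} (\<lambda>_. borel))"
    unfolding G_def[abs_def] by (rule measurable_kernel_integral[OF step_kernel_measurable f])
  let ?C = "IT.C 0 n (\<lambda>_. undefined)"
  have sets_C: "sets ?C = sets (PiM {0..<n} (\<lambda>_. borel))" using IT.sets_C[of "\<lambda>_. undefined" 0 n] by simp
  have "(LINT \<omega>|L. F \<omega>) = (LINT \<omega>|L. F (restrict \<omega> {0..<Suc n}))"
  proof -
    have "restrict (restrict \<omega> {0..<Suc n}) {0..<n} = restrict \<omega> {0..<n}" for \<omega> :: "nat \<Rightarrow> 's \<times> 'a"
      by (auto simp: restrict_def)
    then show ?thesis by (simp add: F_def)
  qed
  also have "\<dots> = (LINT \<omega>|(?C \<bind> IT.eP n). F \<omega>)"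
    using integral_L_restrict[OF F] by simp
  also have "\<dots> = (LINT \<omega>|?C. LINT \<omega>'|IT.eP n \<omega>. F \<omega>')"
  proof (rule integral_bind_prob[OF prob_space_C0 _ F])
    have "IT.eP n \<in> PiM {0..<n} (\<lambda>_. borel) \<rightarrow>\<^sub>M prob_algebra (PiM {0..<Suc n} (\<lambda>_. borel))"
      by (rule measurable_prob_algebraI[OF IT.prob_space_eP]) auto
    then show "IT.eP n \<in> ?C \<rightarrow>\<^sub>M prob_algebra (PiM {0..<Suc n} (\<lambda>_. borel))"
      by (simp add: measurable_cong_sets[OF sets_C refl])
    show "\<bar>F \<omega>\<bar> \<le> C" for \<omega> by (simp add: F_def C)
  qed
  also have "\<dots> = (LINT \<omega>|?C. G \<omega>)"
  proof (rule Bochner_Integration.integral_cong[OF refl])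
    fix \<omega> assume "\<omega> \<in> space ?C"
    then have \<omega>: "\<omega> \<in> space (PiM {0..<n} (\<lambda>_. borel))" using sets_eq_imp_space_eq[OF sets_C] by simp
    have "fun_upd \<omega> n \<in> step_kernel M \<pi> s n \<omega> \<rightarrow>\<^sub>M PiM {0..<Suc n} (\<lambda>_. borel)"
      using \<omega> IT.sets_P[OF \<omega>]
      by (intro measurable_fun_upd[where J = "{0..<n}"]) (auto cong: measurable_cong_sets)
    then have "(LINT \<omega>'|IT.eP n \<omega>. F \<omega>') = (LINT x|step_kernel M \<pi> s n \<omega>. F (fun_upd \<omega> n x))"
      unfolding IT.eP_def using F by (intro integral_distr) auto
    moreover have "restrict (fun_upd \<omega> n x) {0..<n} = \<omega>" for x
      using \<omega> by (auto simp: space_PiM restrict_def PiE_def extensional_def fun_eq_iff)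
    ultimately show "(LINT \<omega>'|IT.eP n \<omega>. F \<omega>') = G \<omega>" by (simp add: F_def G_def)
  qed
  also have "\<dots> = (LINT \<omega>|L. G (restrict \<omega> {0..<n}))"
    by (rule integral_L_restrict[OF G, symmetric])
  finally show ?thesis by (simp add: F_def G_def)
qed

lemma restrict_space: "restrict \<omega> {0..<n} \<in> space (PiM {0..<n} (\<lambda>_. borel))" for \<omega> :: "nat \<Rightarrow> 's \<times> 'a"
  by (simp add: space_PiM)

lemma action_kernel_slice_measurable:
  "\<omega> \<in> space (PiM {0..<n} (\<lambda>_. borel)) \<Longrightarrow> action_kernel n \<omega> \<in> borel \<rightarrow>\<^sub>M prob_algebra borel"
  using measurable_compose[OF measurable_Pair1' action_kernel_measurable] by simp

lemma policy_slice_measurable: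
  "\<omega> \<in> space (PiM {0..<n} (\<lambda>_. borel)) \<Longrightarrow> (\<lambda>s'. \<pi> n (\<omega>, s')) \<in> borel \<rightarrow>\<^sub>M prob_algebra borel"
  using measurable_compose[OF measurable_Pair1' policy_measurable] by simp

lemma integral_step_kernel:
  fixes f :: "'s \<times> 'a \<Rightarrow> real"
  assumes f: "f \<in> Bb" and \<omega>: "\<omega> \<in> space (PiM {0..<n} (\<lambda>_. borel))"
  shows "(LINT x|step_kernel M \<pi> s n \<omega>. f x) = (LINT s'|state_kernel n \<omega>. LINT a|\<pi> n (\<omega>, s'). f (s', a))"
proof -
  obtain C where C: "f \<in> borel_measurable borel" "\<And>x. \<bar>f x\<bar> \<le> C" "0 \<le> C" by (rule BbE[OF f]) blast
  note state = measurable_to_prob_algebraD[OF state_kernel_measurable \<omega>]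
  have "(LINT x|step_kernel M \<pi> s n \<omega>. f x) = (LINT s'|state_kernel n \<omega>. LINT x|action_kernel n \<omega> s'. f x)"
    unfolding step_kernel_eq
    using action_kernel_slice_measurable[OF \<omega>] C
    by (intro integral_bind_prob[OF state(1)]) (auto simp: measurable_cong_sets[OF state(2) refl])
  moreover have "(LINT x|action_kernel n \<omega> s'. f x) = (LINT a|\<pi> n (\<omega>, s'). f (s', a))" for s'
  proof -
    note pol = measurable_to_prob_algebraD[OF policy_slice_measurable[OF \<omega>], of s', simplified]
    have "(LINT x|action_kernel n \<omega> s'. f x) = (LINT a|\<pi> n (\<omega>, s'). LINT x|return borel (s', a). f x)"
      unfolding action_kernel_def using return_pair_measurable C
      by (intro integral_bind_prob[OF pol(1)]) (auto simp: measurable_cong_sets[OF pol(2) refl])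
    then show ?thesis using C by (simp add: integral_return)
  qed
  ultimately show ?thesis by simp
qed

lemma component_measurable: "(\<lambda>\<omega>. \<omega> n) \<in> L \<rightarrow>\<^sub>M borel"
  by (auto intro!: measurable_component_singleton simp: measurable_cong_sets[OF sets_L refl])

lemma expectation_marginal:
  fixes f :: "'s \<times> 'a \<Rightarrow> real"
  assumes f: "f \<in> Bb"
  shows "(LINT \<omega>|L. f (\<omega> n)) =
    (LINT \<omega>|L. LINT s'|state_kernel n (restrict \<omega> {0..<n}). LINT a|\<pi> n (restrict \<omega> {0..<n}, s'). f (s', a))"
proof -
  obtain C where C: "f \<in> borel_measurable borel" "\<And>x. \<bar>f x\<bar> \<le> C" "0 \<le> C" by (rule BbE[OF f]) blast
  have "(LINT \<omega>|L. f (\<omega> n)) = (LINT \<omega>|L. LINT x|step_kernel M \<pi> s n (restrict \<omega> {0..<n}). f x)"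
    by (rule expectation_step[of "\<lambda>_. f"]) (use C in auto)
  then show ?thesis using integral_step_kernel[OF f restrict_space] by simp
qed

lemma policy_mean_bound:
  fixes f :: "'s \<times> 'a \<Rightarrow> real"
  assumes f: "f \<in> Bb" and C: "\<And>x. \<bar>f x\<bar> \<le> C" and \<omega>: "\<omega> \<in> space (PiM {0..<n} (\<lambda>_. borel))"
  shows "\<bar>LINT a|\<pi> n (\<omega>, s'). f (s', a)\<bar> \<le> C"
proof -
  note pol = measurable_to_prob_algebraD[OF policy_slice_measurable[OF \<omega>], of s', simplified]
  interpret prob_space "\<pi> n (\<omega>, s')" by (rule pol)
  show ?thesis
    using Bb_measurable[OF Bb_slice[OF f]] C
    by (intro integral_bounds) (auto simp: measurable_cong_sets[OF pol(2) refl])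
qed

lemma policy_mean_measurable:
  fixes f :: "'s \<times> 'a \<Rightarrow> real"
  assumes f: "f \<in> Bb"
  shows "(\<lambda>(\<omega>, s'). LINT a|\<pi> n (\<omega>, s'). f (s', a)) \<in> borel_measurable (PiM {0..<n} (\<lambda>_. borel) \<Otimes>\<^sub>M borel)"
proof -
  have "(\<lambda>y. (snd (fst y), snd y)) \<in> (PiM {0..<n} (\<lambda>_. borel :: ('s \<times> 'a) measure) \<Otimes>\<^sub>M borel) \<Otimes>\<^sub>M borel \<rightarrow>\<^sub>M (borel :: ('s \<times> 'a) measure)"
    unfolding borel_prod[symmetric] by measurable
  from measurable_compose[OF this Bb_measurable[OF f]]
  have "(\<lambda>(x, a). f (snd x, a)) \<in> borel_measurable ((PiM {0..<n} (\<lambda>_. borel :: ('s \<times> 'a) measure) \<Otimes>\<^sub>M borel) \<Otimes>\<^sub>M borel)"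
    by (simp add: case_prod_beta)
  from measurable_kernel_integral[OF policy_measurable this]
  show ?thesis by (simp add: case_prod_unfold)
qed

lemma hist_measurable: "(\<lambda>\<omega>. hist \<omega> n) \<in> L \<rightarrow>\<^sub>M PiM {0..<n} (\<lambda>_. borel) \<Otimes>\<^sub>M borel"
  by (intro measurable_Pair restrict_L measurable_compose[OF component_measurable measurable_fst_borel])

text \<open>Replaces \<open>f\<close> by its conditional mean given history and current state. Both
  sides are reduced to the same integral over \<open>state_kernel\<close>: on the right the
  integrand no longer depends on the action, so averaging it over the action changes
  nothing.\<close>

lemma expectation_action:
  fixes f :: "'s \<times> 'a \<Rightarrow> real"
  assumes f: "f \<in> Bb"
  shows "(LINT \<omega>|L. f (\<omega> n)) = (LINT \<omega>|L. LINT a|\<pi> n (hist \<omega> n). f (fst (\<omega> n), a))"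
proof -
  obtain C where C: "f \<in> borel_measurable borel" "\<And>x. \<bar>f x\<bar> \<le> C" "0 \<le> C" by (rule BbE[OF f]) blast
  define h where "h \<omega> s' = (LINT a|\<pi> n (\<omega>, s'). f (s', a))" for \<omega> s'
  note h_bound = policy_mean_bound[OF f C(2), where n = n, folded h_def]
  note h_meas = policy_mean_measurable[OF f, of n, folded h_def]
  define h' where "h' \<omega> x = h (restrict \<omega> {0..<n}) (fst x)" for \<omega> and x :: "'s \<times> 'a"
  have "(LINT \<omega>|L. h' (restrict \<omega> {0..<n}) (\<omega> n)) =
    (LINT \<omega>|L. LINT x|step_kernel M \<pi> s n (restrict \<omega> {0..<n}). h' (restrict \<omega> {0..<n}) x)"
  proof (rule expectation_step)
    have "(\<lambda>y. (restrict (fst y) {0..<n}, fst (snd y))) \<in> PiM {0..<n} (\<lambda>_. borel :: ('s \<times> 'a) measure) \<Otimes>\<^sub>M (borel :: ('s \<times> 'a) measure)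
        \<rightarrow>\<^sub>M PiM {0..<n} (\<lambda>_. borel) \<Otimes>\<^sub>M borel"
      by (intro measurable_Pair measurable_compose[OF measurable_fst measurable_restrict_subset]
        measurable_compose[OF measurable_snd measurable_fst_borel]) auto
    from measurable_compose[OF this h_meas]
    show "(\<lambda>(\<omega>, x). h' \<omega> x) \<in> borel_measurable (PiM {0..<n} (\<lambda>_. borel) \<Otimes>\<^sub>M borel)"
      by (simp add: h'_def case_prod_beta)
    show "\<bar>h' \<omega> x\<bar> \<le> C" for \<omega> x unfolding h'_def by (rule h_bound[OF restrict_space])
  qed
  also have "\<dots> = (LINT \<omega>|L. LINT s'|state_kernel n (restrict \<omega> {0..<n}). h (restrict \<omega> {0..<n}) s')"
  proof (rule Bochner_Integration.integral_cong[OF refl])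
    fix \<omega> :: "nat \<Rightarrow> 's \<times> 'a"
    let ?\<omega> = "restrict \<omega> {0..<n}"
    have "(\<lambda>s'. h ?\<omega> s') \<in> Bb"
      using measurable_compose[OF measurable_Pair1'[OF restrict_space[of \<omega> n]] h_meas] h_bound[OF restrict_space]
      by (intro BbI[of _ C]) auto
    then have "h' ?\<omega> \<in> Bb" unfolding h'_def by (simp add: Bb_fst)
    from integral_step_kernel[OF this restrict_space[of \<omega> n]]
    have "(LINT x|step_kernel M \<pi> s n ?\<omega>. h' ?\<omega> x)
        = (LINT s'|state_kernel n ?\<omega>. LINT a|\<pi> n (?\<omega>, s'). h ?\<omega> s')"
      by (simp add: h'_def)
    moreover have "(LINT a|\<pi> n (?\<omega>, s'). h ?\<omega> s') = h ?\<omega> s'" for s'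
      using measurable_to_prob_algebraD(1)[OF policy_slice_measurable[OF restrict_space[of \<omega> n]], of s']
      by (simp add: prob_space.prob_space)
    ultimately show "(LINT x|step_kernel M \<pi> s n ?\<omega>. h' ?\<omega> x) = (LINT s'|state_kernel n ?\<omega>. h ?\<omega> s')"
      by (simp only:)
  qed
  also have "\<dots> = (LINT \<omega>|L. f (\<omega> n))"
    unfolding h_def by (rule expectation_marginal[OF f, symmetric])
  finally show ?thesis by (simp add: h'_def h_def)
qed

lemma expectation_state:
  assumes f: "f \<in> Bb"
  shows "(LINT \<omega>|L. f (fst (\<omega> n))) = (LINT \<omega>|L. LINT s'|state_kernel n (restrict \<omega> {0..<n}). f s')"
proof -
  have "(LINT \<omega>|L. f (fst (\<omega> n))) = (LINT \<omega>|L. LINT s'|state_kernel n (restrict \<omega> {0..<n}).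
      LINT a|\<pi> n (restrict \<omega> {0..<n}, s'). f s')"
    using expectation_marginal[OF Bb_fst[OF f], of n] by simp
  moreover have "(LINT a|\<pi> n (restrict \<omega> {0..<n}, s'). f s') = f s'" for \<omega> s'
    using measurable_to_prob_algebraD(1)[OF policy_slice_measurable[OF restrict_space[of \<omega> n]], of s']
    by (simp add: prob_space.prob_space)
  ultimately show ?thesis by (simp only:)
qed

lemma expectation_initial: "f \<in> Bb \<Longrightarrow> (LINT \<omega>|L. f (fst (\<omega> 0))) = f s"
  by (subst expectation_state) (auto simp: state_kernel_def integral_return Bb_measurable L.prob_space[simplified])

lemma expectation_next: "f \<in> Bb \<Longrightarrow> (LINT \<omega>|L. f (fst (\<omega> (Suc n)))) = (LINT \<omega>|L. next_mean f (\<omega> n))"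
  by (subst expectation_state) (auto simp: state_kernel_def next_mean_def)

text \<open>With \<open>e n\<close> the mean of \<open>h\<close> at time \<open>n\<close>, the
  discounted means of \<open>g\<close> are
  \<open>\<gamma> ^ n * e n - \<gamma> ^ Suc n * e (Suc n)\<close>; boundedness kills the remainder
  and only \<open>e 0 = h s\<close> is left. It serves twice: for the exact value of a Gibbs policy
  and for the lower bound valid for every policy.\<close>

lemma expectation_telescope:
  fixes g :: "nat \<Rightarrow> (nat \<Rightarrow> 's \<times> 'a) \<Rightarrow> real"
  assumes g: "\<And>n. g n \<in> borel_measurable L" "\<And>n \<omega>. \<bar>g n \<omega>\<bar> \<le> C" and h: "h \<in> Bb"
    and step: "\<And>n. (LINT \<omega>|L. g n \<omega>) = (LINT \<omega>|L. h (fst (\<omega> n))) - \<gamma> * (LINT \<omega>|L. h (fst (\<omega> (Suc n))))"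
  shows "integrable L (\<lambda>\<omega>. \<Sum>n. \<gamma> ^ n * g n \<omega>)" "(LINT \<omega>|L. (\<Sum>n. \<gamma> ^ n * g n \<omega>)) = h s"
proof -
  have int: "integrable L (\<lambda>\<omega>. \<gamma> ^ n * g n \<omega>)" for n
    using g by (intro integrable_mult_right L.integrable_bounded[of _ C]) auto
  have summ: "summable (\<lambda>n. \<gamma> ^ n * C)"
    using \<gamma> by (intro summable_mult2 summable_geometric) auto
  have le: "norm (\<gamma> ^ n * g n \<omega>) \<le> \<gamma> ^ n * C" for n \<omega>
    using g(2)[of n \<omega>] \<gamma> by (simp add: abs_mult mult_left_mono)
  have AE: "AE \<omega> in L. summable (\<lambda>n. norm (\<gamma> ^ n * g n \<omega>))"
    by (intro AE_I2 summable_comparison_test'[OF summ, of 0]) (use le in auto)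
  have summ': "summable (\<lambda>n. LINT \<omega>|L. norm (\<gamma> ^ n * g n \<omega>))"
  proof (rule summable_comparison_test'[OF summ, of 0])
    fix n
    have "(LINT \<omega>|L. norm (\<gamma> ^ n * g n \<omega>)) \<le> \<gamma> ^ n * C"
      using int le by (intro L.integral_le_const) auto
    then show "norm (LINT \<omega>|L. norm (\<gamma> ^ n * g n \<omega>)) \<le> \<gamma> ^ n * C" by simp
  qed
  show "integrable L (\<lambda>\<omega>. \<Sum>n. \<gamma> ^ n * g n \<omega>)"
    by (rule integrable_suminf[OF int AE summ'])
  define e where "e n = (LINT \<omega>|L. h (fst (\<omega> n)))" for n
  obtain B where B: "h \<in> borel_measurable borel" "\<And>x. \<bar>h x\<bar> \<le> B" "0 \<le> B" by (rule BbE[OF h]) blast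
  have e_bound: "\<bar>e n\<bar> \<le> B" for n
    unfolding e_def
    using B measurable_compose[OF measurable_compose[OF component_measurable measurable_fst_borel] B(1)]
    by (intro L.integral_bounds) auto
  have "(\<lambda>n. \<gamma> ^ n * e n - \<gamma> ^ Suc n * e (Suc n)) sums (\<gamma> ^ 0 * e 0 - 0)"
  proof (rule telescope_sums')
    show "(\<lambda>n. \<gamma> ^ n * e n) \<longlonglongrightarrow> 0"
    proof (rule Lim_null_comparison)
      show "(\<lambda>n. \<gamma> ^ n * B) \<longlonglongrightarrow> 0"
        using \<gamma> by (intro tendsto_mult_left_zero LIMSEQ_power_zero) auto
      show "\<forall>\<^sub>F n in sequentially. norm (\<gamma> ^ n * e n) \<le> \<gamma> ^ n * B"
        using e_bound \<gamma> by (intro always_eventually) (simp add: abs_mult mult_left_mono)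
    qed
  qed
  moreover have "\<gamma> ^ n * e n - \<gamma> ^ Suc n * e (Suc n) = \<gamma> ^ n * (LINT \<omega>|L. g n \<omega>)" for n
    unfolding step e_def by (simp add: algebra_simps)
  ultimately have "(\<lambda>n. \<gamma> ^ n * (LINT \<omega>|L. g n \<omega>)) sums e 0" by simp
  then have "(\<Sum>n. \<gamma> ^ n * (LINT \<omega>|L. g n \<omega>)) = e 0"
    by (simp add: sums_iff)
  moreover have "(LINT \<omega>|L. (\<Sum>n. \<gamma> ^ n * g n \<omega>)) = (\<Sum>n. LINT \<omega>|L. \<gamma> ^ n * g n \<omega>)"
    by (rule integral_suminf[OF int AE summ'])
  ultimately show "(LINT \<omega>|L. (\<Sum>n. \<gamma> ^ n * g n \<omega>)) = h s"
    using expectation_initial[OF h] by (simp add: e_def)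
qed

end

section \<open>Policies given by normalised log-densities\<close>

lemma Bb_exp: "f \<in> Bb \<Longrightarrow> (\<lambda>x. exp (f x)) \<in> Bb"
proof -
  assume "f \<in> Bb"
  then obtain C where C: "f \<in> borel_measurable borel" "\<And>x. \<bar>f x\<bar> \<le> C" "0 \<le> C" by (rule BbE) blast
  have "exp (f x) \<le> exp C" for x using C(2)[of x] by simp
  then show ?thesis using C(1) by (intro BbI[of _ "exp C"]) auto
qed

text \<open>The factor is a sum of exponentials because for two normalised log-densities it
  integrates to 2, so that the resulting Lipschitz constants do not depend on the size of the
  densities.\<close>

lemma abs_exp_diff_le: "\<bar>exp x - exp y\<bar> \<le> (exp x + exp y) * \<bar>x - y\<bar>" for x y :: real
proof -
  have *: "exp x - exp y \<le> exp x * (x - y)" for x y :: real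
    using mult_left_mono[OF exp_ge_add_one_self[of "y - x"], of "exp x"]
    by (simp add: exp_diff algebra_simps)
  have **: "exp x - exp y \<le> (exp x + exp y) * \<bar>x - y\<bar>" for x y :: real
  proof -
    have "exp x * (x - y) \<le> exp x * \<bar>x - y\<bar>" by (rule mult_left_mono) auto
    also have "\<dots> \<le> (exp x + exp y) * \<bar>x - y\<bar>" by (rule mult_right_mono) auto
    finally show ?thesis using *[of x y] by linarith
  qed
  from **[of x y] **[of y x] show ?thesis by (simp add: abs_le_iff abs_minus_commute add.commute)
qed

context entropy_mdp
begin

sublocale \<mu>: prob_space \<mu> by (rule prob_space_\<mu>)

definition lpol :: "('s \<times> 'a \<Rightarrow> real) \<Rightarrow> 's \<Rightarrow> 'a measure" where
  "lpol l s = density \<mu> (\<lambda>a. ennreal (exp (l (s, a))))"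

definition normalised :: "('s \<times> 'a \<Rightarrow> real) set" where
  "normalised = {l \<in> Bb. \<forall>s. (LINT a|\<mu>. exp (l (s, a))) = 1}"

text \<open>The log-partition function of the Gibbs policy of \<open>Z\<close>.\<close>

definition lse :: "('s \<times> 'a \<Rightarrow> real) \<Rightarrow> 's \<Rightarrow> real" where
  "lse Z s = ln (LINT a|\<mu>. exp (Z (s, a)))"

definition nrm :: "('s \<times> 'a \<Rightarrow> real) \<Rightarrow> 's \<times> 'a \<Rightarrow> real" where
  "nrm Z x = Z x - lse Z (fst x)"

definition avg :: "('s \<times> 'a \<Rightarrow> real) \<Rightarrow> ('s \<times> 'a \<Rightarrow> real) \<Rightarrow> 's \<Rightarrow> real" where
  "avg l h s = (LINT a|lpol l s. h (s, a))"

lemma normalised_Bb: "l \<in> normalised \<Longrightarrow> l \<in> Bb"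
  by (simp add: normalised_def)

lemma slice_measurable: "f \<in> Bb \<Longrightarrow> (\<lambda>a. f (s, a)) \<in> borel_measurable \<mu>" for f :: "'s \<times> 'a \<Rightarrow> real"
  using Bb_measurable[OF Bb_slice[of f s]] by (simp cong: measurable_cong_sets)

lemma slice_integrable: "f \<in> Bb \<Longrightarrow> integrable \<mu> (\<lambda>a. f (s, a))" for f :: "'s \<times> 'a \<Rightarrow> real"
proof -
  assume f: "f \<in> Bb"
  obtain C where C: "f \<in> borel_measurable borel" "\<And>x. \<bar>f x\<bar> \<le> C" "0 \<le> C" by (rule BbE[OF f]) blast
  then show ?thesis using slice_measurable[OF f] by (intro \<mu>.integrable_bounded[of _ C])
qed

lemma integral_\<mu>_Bb:
  fixes f :: "'s \<times> 'a \<Rightarrow> real"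
  assumes f: "f \<in> Bb" shows "(\<lambda>s. LINT a|\<mu>. f (s, a)) \<in> Bb"
proof -
  obtain C where C: "f \<in> borel_measurable borel" "\<And>x. \<bar>f x\<bar> \<le> C" "0 \<le> C" by (rule BbE[OF f]) blast
  show ?thesis
  proof (rule BbI)
    have "(\<lambda>_. \<mu>) \<in> (borel :: 's measure) \<rightarrow>\<^sub>M prob_algebra borel"
      using prob_space_\<mu> by (intro measurable_const) (simp add: space_prob_algebra)
    moreover have "(\<lambda>(s, a). f (s, a)) \<in> borel_measurable (borel \<Otimes>\<^sub>M borel)"
      using C(1) unfolding borel_prod by simp
    ultimately show "(\<lambda>s. LINT a|\<mu>. f (s, a)) \<in> borel_measurable borel"
      by (rule measurable_kernel_integral)
    show "\<bar>LINT a|\<mu>. f (s, a)\<bar> \<le> C" for s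
      using slice_measurable[OF f] C by (intro \<mu>.integral_bounds) auto
  qed
qed

lemma integral_exp_bounds:
  fixes Z :: "'s \<times> 'a \<Rightarrow> real"
  assumes Z: "Z \<in> Bb" and C: "\<And>x. \<bar>Z x\<bar> \<le> C"
  shows "exp (- C) \<le> (LINT a|\<mu>. exp (Z (s, a)))" "(LINT a|\<mu>. exp (Z (s, a))) \<le> exp C"
proof -
  have Z: "- C \<le> Z x" "Z x \<le> C" for x using C[of x] by (auto simp: abs_le_iff)
  note int = slice_integrable[OF Bb_exp[OF assms(1)]]
  show "exp (- C) \<le> (LINT a|\<mu>. exp (Z (s, a)))"
    using Z by (intro \<mu>.integral_ge_const int) auto
  show "(LINT a|\<mu>. exp (Z (s, a))) \<le> exp C"
    using Z by (intro \<mu>.integral_le_const int) auto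
qed

lemma integral_exp_pos: "Z \<in> Bb \<Longrightarrow> 0 < (LINT a|\<mu>. exp (Z (s, a)))" for Z :: "'s \<times> 'a \<Rightarrow> real"
  by (metis BbE integral_exp_bounds(1) exp_gt_zero less_le_trans)

lemma exp_lse: "Z \<in> Bb \<Longrightarrow> exp (lse Z s) = (LINT a|\<mu>. exp (Z (s, a)))"
  by (simp add: lse_def integral_exp_pos)

lemma lse_bound: "Z \<in> Bb \<Longrightarrow> (\<And>x. \<bar>Z x\<bar> \<le> C) \<Longrightarrow> \<bar>lse Z s\<bar> \<le> C"
  using integral_exp_bounds[of Z C s] integral_exp_pos[of Z s]
  unfolding lse_def abs_le_iff by (metis exp_le_cancel_iff exp_ln minus_le_iff)

lemma lse_Bb: assumes "Z \<in> Bb" shows "lse Z \<in> Bb"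
proof -
  obtain C where C: "Z \<in> borel_measurable borel" "\<And>x. \<bar>Z x\<bar> \<le> C" "0 \<le> C" by (rule BbE[OF assms]) blast
  have "(\<lambda>s. ln (LINT a|\<mu>. exp (Z (s, a)))) \<in> borel_measurable borel"
    using Bb_measurable[OF integral_\<mu>_Bb[OF Bb_exp[OF assms]]] by (rule borel_measurable_ln)
  then show ?thesis
    using lse_bound[OF assms C(2)] by (intro BbI[of _ C]) (auto simp: lse_def[abs_def])
qed

lemma nrm_normalised: assumes "Z \<in> Bb" shows "nrm Z \<in> normalised"
proof -
  have "(\<lambda>x. Z x - lse Z (fst x)) \<in> Bb"
    by (intro Bb_diff Bb_fst lse_Bb assms)
  moreover have "(LINT a|\<mu>. exp (nrm Z (s, a))) = 1" for s
    using integral_exp_pos[OF assms, of s] exp_lse[OF assms, of s] by (simp add: nrm_def exp_diff)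
  ultimately show ?thesis by (simp add: normalised_def nrm_def[abs_def])
qed

lemma gibbs_eq_lpol: assumes "Z \<in> Bb" shows "gibbs M Z = lpol (nrm Z)"
proof
  fix s
  show "gibbs M Z s = lpol (nrm Z) s"
    using exp_lse[OF assms, of s] by (simp add: gibbs_def lpol_def nrm_def exp_diff)
qed

lemma lse_normalised: "l \<in> normalised \<Longrightarrow> lse l s = 0"
  by (simp add: normalised_def lse_def)

lemma nrm_id: "l \<in> normalised \<Longrightarrow> nrm l = l"
  by (simp add: nrm_def[abs_def] lse_normalised)

lemma gibbs_normalised: "l \<in> normalised \<Longrightarrow> gibbs M l = lpol l"
  by (simp add: gibbs_eq_lpol normalised_Bb nrm_id)

lemma gibbs_policies_eq: "gibbs_policies M = lpol ` normalised"
proof -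
  have "gibbs M Z \<in> lpol ` normalised" if "Z \<in> Bb" for Z
    using that by (simp add: gibbs_eq_lpol nrm_normalised)
  moreover have "lpol l \<in> gibbs M ` Bb" if "l \<in> normalised" for l
    using that by (simp add: gibbs_normalised[symmetric] normalised_Bb)
  ultimately show ?thesis by (auto simp: gibbs_policies_def)
qed

lemma sets_lpol [simp, measurable_cong]: "sets (lpol l s) = sets borel"
  by (simp add: lpol_def)

lemma space_lpol [simp]: "space (lpol l s) = UNIV"
  by (simp add: lpol_def)

lemma prob_space_lpol: assumes l: "l \<in> normalised" shows "prob_space (lpol l s)"
proof (rule prob_spaceI)
  have "emeasure (lpol l s) (space (lpol l s)) = (\<integral>\<^sup>+a. ennreal (exp (l (s, a))) \<partial>\<mu>)"
    using slice_measurable[OF normalised_Bb[OF l], of s]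
    by (simp add: lpol_def emeasure_density)
  also have "\<dots> = ennreal (LINT a|\<mu>. exp (l (s, a)))"
    using slice_integrable[OF Bb_exp[OF normalised_Bb[OF l]]] by (intro nn_integral_eq_integral) auto
  finally show "emeasure (lpol l s) (space (lpol l s)) = 1"
    using l by (simp add: normalised_def)
qed

lemma lpol_measurable [measurable]:
  assumes l: "l \<in> normalised" shows "lpol l \<in> borel \<rightarrow>\<^sub>M prob_algebra borel"
proof (rule measurable_prob_algebraI[OF prob_space_lpol[OF l] measurable_subprob_algebra])
  show "subprob_space (lpol l s)" for s
    using prob_space_lpol[OF l] by (rule prob_space_imp_subprob_space)
  show "sets (lpol l s) = sets borel" for s by simp
  fix B :: "'a set" assume B: "B \<in> sets borel"
  have l': "l \<in> borel_measurable (borel \<Otimes>\<^sub>M \<mu>)"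
    using Bb_measurable[OF normalised_Bb[OF l]]
    by (simp add: measurable_cong_sets[OF sets_pair_measure_cong[OF refl sets_\<mu>] refl] borel_prod)
  have "(\<lambda>(s, a). ennreal (exp (l (s, a))) * indicator B a) \<in> borel_measurable (borel \<Otimes>\<^sub>M \<mu>)"
    using l' B by (simp add: case_prod_unfold)
  then have "(\<lambda>s. \<integral>\<^sup>+a. ennreal (exp (l (s, a))) * indicator B a \<partial>\<mu>) \<in> borel_measurable borel"
    by (rule \<mu>.borel_measurable_nn_integral)
  moreover have "emeasure (lpol l s) B = (\<integral>\<^sup>+a. ennreal (exp (l (s, a))) * indicator B a \<partial>\<mu>)" for s
    using slice_measurable[OF normalised_Bb[OF l], of s] B by (simp add: lpol_def emeasure_density)
  ultimately show "(\<lambda>s. emeasure (lpol l s) B) \<in> borel_measurable borel" by simp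
qed

lemma integral_lpol:
  fixes h :: "'a \<Rightarrow> real"
  assumes "l \<in> Bb" "h \<in> borel_measurable borel"
  shows "(LINT a|lpol l s. h a) = (LINT a|\<mu>. exp (l (s, a)) * h a)"
  using assms slice_measurable[of l s] unfolding lpol_def
  by (subst integral_density) auto

lemma avg_eq: "l \<in> Bb \<Longrightarrow> h \<in> Bb \<Longrightarrow> avg l h s = (LINT a|\<mu>. exp (l (s, a)) * h (s, a))"
  unfolding avg_def using Bb_slice[of h s] by (intro integral_lpol) (auto simp: Bb_measurable)

lemma avg_Bb: "l \<in> normalised \<Longrightarrow> h \<in> Bb \<Longrightarrow> avg l h \<in> Bb"
  using integral_\<mu>_Bb[of "\<lambda>x. exp (l x) * h x"] ext[of "avg l h", OF avg_eq[of l h]]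
  by (simp add: Bb_mult Bb_exp normalised_Bb)

lemma lpol_integrable: "l \<in> normalised \<Longrightarrow> h \<in> Bb \<Longrightarrow> integrable (lpol l s) (\<lambda>a. h (s, a))"
proof -
  assume l: "l \<in> normalised" and h: "h \<in> Bb"
  interpret prob_space "lpol l s" using l by (rule prob_space_lpol)
  obtain C where C: "h \<in> borel_measurable borel" "\<And>x. \<bar>h x\<bar> \<le> C" "0 \<le> C" by (rule BbE[OF h]) blast
  then show ?thesis using slice_measurable[OF h, of s]
    by (intro integrable_bounded[of _ C]) (auto simp: lpol_def)
qed

lemma avg_add: "l \<in> normalised \<Longrightarrow> h \<in> Bb \<Longrightarrow> k \<in> Bb \<Longrightarrow> avg l (\<lambda>x. h x + k x) s = avg l h s + avg l k s"
  unfolding avg_def by (intro Bochner_Integration.integral_add lpol_integrable)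

lemma avg_diff: "l \<in> normalised \<Longrightarrow> h \<in> Bb \<Longrightarrow> k \<in> Bb \<Longrightarrow> avg l (\<lambda>x. h x - k x) s = avg l h s - avg l k s"
  unfolding avg_def by (intro Bochner_Integration.integral_diff lpol_integrable)

lemma avg_cmult: "avg l (\<lambda>x. r * h x) s = r * avg l h s"
  unfolding avg_def by simp

lemma avg_state: "l \<in> normalised \<Longrightarrow> avg l (\<lambda>x. f (fst x)) s = f s"
  unfolding avg_def using prob_space.prob_space[OF prob_space_lpol[of l s]] by simp

lemma avg_const: "l \<in> normalised \<Longrightarrow> avg l (\<lambda>x. r) s = r"
  using avg_state[of l "\<lambda>_. r"] by simp

lemma avg_mono: "l \<in> normalised \<Longrightarrow> h \<in> Bb \<Longrightarrow> k \<in> Bb \<Longrightarrow> (\<And>x. h x \<le> k x) \<Longrightarrow> avg l h s \<le> avg l k s"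
  unfolding avg_def by (intro integral_mono lpol_integrable)

lemma avg_bound:
  assumes "l \<in> normalised" "h \<in> Bb" "\<And>x. \<bar>h x\<bar> \<le> C" shows "\<bar>avg l h s\<bar> \<le> C"
proof -
  have h: "- C \<le> h x" "h x \<le> C" for x using assms(3)[of x] by (auto simp: abs_le_iff)
  have "avg l h s \<le> C" using avg_mono[OF assms(1,2) Bb_const h(2), of s] avg_const[OF assms(1), of C s] by simp
  moreover have "- C \<le> avg l h s" using avg_mono[OF assms(1) Bb_const assms(2) h(1), of s] avg_const[OF assms(1), of "- C" s] by simp
  ultimately show ?thesis by (simp add: abs_le_iff)
qed

text \<open>The distance of two policies at \<open>s\<close> in the norm \<open>|m|(A)\<close>,
  without a factor 1/2; \<open>tv_norm_lpol\<close> makes the identification.\<close>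

definition l1_dist :: "('s \<times> 'a \<Rightarrow> real) \<Rightarrow> ('s \<times> 'a \<Rightarrow> real) \<Rightarrow> 's \<Rightarrow> real" where
  "l1_dist l k s = (LINT a|\<mu>. \<bar>exp (l (s, a)) - exp (k (s, a))\<bar>)"

lemma l1_dist_Bb: "l \<in> Bb \<Longrightarrow> k \<in> Bb \<Longrightarrow> l1_dist l k \<in> Bb"
  unfolding l1_dist_def[abs_def] by (intro integral_\<mu>_Bb Bb_abs Bb_diff Bb_exp)

lemma l1_dist_nonneg: "0 \<le> l1_dist l k s"
  by (simp add: l1_dist_def integral_nonneg_AE)

lemma l1_dist_commute: "l1_dist l k s = l1_dist k l s"
  by (simp add: l1_dist_def abs_minus_commute)

lemma abs_slice_integrable: "f \<in> Bb \<Longrightarrow> integrable \<mu> (\<lambda>a. \<bar>f (s, a)\<bar>)" for f :: "'s \<times> 'a \<Rightarrow> real"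
  by (intro integrable_abs slice_integrable)

lemma avg_density_diff:
  assumes l: "l \<in> Bb" and k: "k \<in> Bb" and h: "h \<in> Bb"
  shows "avg l h s - avg k h s = (LINT a|\<mu>. (exp (l (s, a)) - exp (k (s, a))) * h (s, a))"
proof -
  have "integrable \<mu> (\<lambda>a. exp (l (s, a)) * h (s, a))" "integrable \<mu> (\<lambda>a. exp (k (s, a)) * h (s, a))"
    using slice_integrable[of "\<lambda>x. exp (l x) * h x" s] slice_integrable[of "\<lambda>x. exp (k x) * h x" s] assms
    by (simp_all add: Bb_mult Bb_exp)
  then show ?thesis using assms by (simp add: avg_eq left_diff_distrib)
qed

lemma avg_diff_le_l1_dist:
  assumes l: "l \<in> Bb" and k: "k \<in> Bb" and h: "h \<in> Bb" and C: "\<And>x. \<bar>h x\<bar> \<le> C"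
  shows "\<bar>avg l h s - avg k h s\<bar> \<le> C * l1_dist l k s"
proof -
  let ?D = "\<lambda>x. exp (l x) - exp (k x)"
  have D: "?D \<in> Bb" by (intro Bb_diff Bb_exp l k)
  have "\<bar>avg l h s - avg k h s\<bar> \<le> (LINT a|\<mu>. \<bar>?D (s, a) * h (s, a)\<bar>)"
    unfolding avg_density_diff[OF l k h] by (rule integral_abs_bound)
  also have "\<dots> \<le> (LINT a|\<mu>. C * \<bar>?D (s, a)\<bar>)"
    using abs_slice_integrable[OF Bb_mult[OF D h]] abs_slice_integrable[OF D] C
    by (intro integral_mono integrable_mult_right) (auto simp: abs_mult mult.commute intro!: mult_right_mono)
  finally show ?thesis by (simp add: l1_dist_def)
qed

lemma l1_dist_le_sup:
  assumes l: "l \<in> normalised" and k: "k \<in> normalised" and C: "\<And>x. \<bar>l x - k x\<bar> \<le> C"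
  shows "l1_dist l k s \<le> 2 * C"
proof -
  note Bb = normalised_Bb[OF l] normalised_Bb[OF k]
  have int: "integrable \<mu> (\<lambda>a. exp (l (s, a)))" "integrable \<mu> (\<lambda>a. exp (k (s, a)))"
    using Bb slice_integrable[OF Bb_exp] by auto
  have "l1_dist l k s \<le> (LINT a|\<mu>. (exp (l (s, a)) + exp (k (s, a))) * C)"
    unfolding l1_dist_def
  proof (rule integral_mono)
    show "integrable \<mu> (\<lambda>a. \<bar>exp (l (s, a)) - exp (k (s, a))\<bar>)" using int by auto
    show "integrable \<mu> (\<lambda>a. (exp (l (s, a)) + exp (k (s, a))) * C)" using int by auto
    fix a
    have "\<bar>exp (l (s, a)) - exp (k (s, a))\<bar> \<le> (exp (l (s, a)) + exp (k (s, a))) * \<bar>l (s, a) - k (s, a)\<bar>"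
      by (rule abs_exp_diff_le)
    also have "\<dots> \<le> (exp (l (s, a)) + exp (k (s, a))) * C"
      using C by (intro mult_left_mono) (auto intro: add_nonneg_nonneg)
    finally show "\<bar>exp (l (s, a)) - exp (k (s, a))\<bar> \<le> (exp (l (s, a)) + exp (k (s, a))) * C" .
  qed
  also have "\<dots> = 2 * C" using int l k by (simp add: normalised_def)
  finally show ?thesis .
qed

text \<open>Since \<open>lpol l s\<close> has density \<open>exp (l - k)\<close> with respect to
  \<open>lpol k s\<close>, the divergence is a mean of \<open>l - k\<close> and hence affine in
  \<open>k\<close>. The differential equation for the mean divergence rests on this.\<close>

lemma KL_lpol:
  assumes l: "l \<in> normalised" and k: "k \<in> normalised"
  shows "KL (lpol l s) (lpol k s) = ereal (avg l (\<lambda>x. l x - k x) s)"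
proof -
  note Bb = normalised_Bb[OF l] normalised_Bb[OF k]
  have Bb': "(\<lambda>x. l x - k x) \<in> Bb" by (intro Bb_diff Bb)
  obtain C where C: "(\<lambda>x. l x - k x) \<in> borel_measurable borel" "\<And>x. \<bar>l x - k x\<bar> \<le> C" "0 \<le> C"
    by (rule BbE[OF Bb']) blast
  have eq: "density (lpol k s) (\<lambda>a. ennreal (exp (l (s, a) - k (s, a)))) = lpol l s"
    unfolding lpol_def using slice_measurable[OF Bb(1)] slice_measurable[OF Bb(2)]
    by (subst density_density_eq) (auto simp: ennreal_mult[symmetric] exp_add[symmetric])
  have "KL (density (lpol k s) (\<lambda>a. ennreal (exp (l (s, a) - k (s, a))))) (lpol k s)
      = ereal (LINT a|density (lpol k s) (\<lambda>a. ennreal (exp (l (s, a) - k (s, a)))). l (s, a) - k (s, a))"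
  proof (rule KL_density_exp[OF prob_space_lpol[OF k]])
    show "prob_space (density (lpol k s) (\<lambda>a. ennreal (exp (l (s, a) - k (s, a)))))"
      unfolding eq by (rule prob_space_lpol[OF l])
    show "(\<lambda>a. l (s, a) - k (s, a)) \<in> borel_measurable (lpol k s)"
      using slice_measurable[OF Bb', of s] by (simp add: lpol_def)
  qed (rule C(2))
  then show ?thesis unfolding eq avg_def .
qed

lemma KL_lpol_ref:
  assumes l: "l \<in> normalised"
  shows "KL (lpol l s) \<mu> = ereal (avg l l s)"
proof -
  obtain C where C: "l \<in> borel_measurable borel" "\<And>x. \<bar>l x\<bar> \<le> C" "0 \<le> C"
    by (rule BbE[OF normalised_Bb[OF l]]) blast
  show ?thesis
    unfolding lpol_def avg_def using C slice_measurable[OF normalised_Bb[OF l]] prob_space_lpol[OF l]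
    by (intro KL_density_exp[of _ _ C]) (auto simp: lpol_def prob_space_\<mu>)
qed

lemma kl_nonneg:
  assumes l: "l \<in> normalised" and k: "k \<in> normalised"
  shows "0 \<le> avg l (\<lambda>x. l x - k x) s"
  using KL_nonneg[OF prob_space_lpol[OF l, of s] prob_space_lpol[OF k, of s]] KL_lpol[OF assms]
  by (simp add: zero_ereal_def)

text \<open>The sign of the difference of the densities is a test function bounded by 1 on which the
  two means differ by exactly the total variation distance.\<close>

lemma l1_dist_pinsker:
  assumes l: "l \<in> normalised" and k: "k \<in> normalised"
  shows "(l1_dist l k s)\<^sup>2 \<le> 2 * avg l (\<lambda>x. l x - k x) s"
proof -
  note Bb = normalised_Bb[OF l] normalised_Bb[OF k]
  define f where "f x = sgn (exp (l x) - exp (k x))" for x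
  have "(\<lambda>x. exp (l x) - exp (k x)) \<in> borel_measurable borel"
    using Bb by (intro Bb_measurable Bb_diff Bb_exp)
  then have f: "f \<in> Bb"
    unfolding f_def[abs_def] by (intro BbI[of _ 1] measurable_compose[OF _ borel_measurable_sgn]) (auto simp: sgn_real_def)
  have "avg l f s - avg k f s = l1_dist l k s"
    unfolding avg_density_diff[OF Bb f] l1_dist_def f_def by (simp add: abs_sgn)
  moreover have "((LINT a|lpol l s. f (s, a)) - (LINT a|lpol k s. f (s, a)))\<^sup>2 \<le> 2 * avg l (\<lambda>x. l x - k x) s"
  proof (rule pinsker_test_function[OF prob_space_lpol[OF k] prob_space_lpol[OF l] _ _ _ KL_lpol[OF l k]])
    show "(\<lambda>a. f (s, a)) \<in> borel_measurable (lpol k s)"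
      using slice_measurable[OF f] by (simp add: lpol_def)
    show "\<bar>f (s, a)\<bar> \<le> 1" for a by (simp add: f_def sgn_real_def)
  qed simp
  ultimately show ?thesis by (simp add: avg_def)
qed

lemma measure_lpol:
  assumes l: "l \<in> normalised" and B: "B \<in> sets borel"
  shows "measure (lpol l s) B = (LINT a:B|\<mu>. exp (l (s, a)))"
proof -
  have "measure (lpol l s) B = (LINT a|lpol l s. indicator B a)"
    using B by simp
  also have "\<dots> = (LINT a|\<mu>. exp (l (s, a)) * indicator B a)"
    using B by (intro integral_lpol normalised_Bb[OF l]) auto
  finally show ?thesis by (simp add: set_lebesgue_integral_def mult.commute)
qed

lemma tv_norm_lpol:
  assumes l: "l \<in> normalised" and k: "k \<in> normalised"
  shows "tv_norm (\<lambda>B. measure (lpol l s) B - measure (lpol k s) B) = ereal (l1_dist l k s)"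
  unfolding l1_dist_def
proof (rule tv_norm_density)
  have int: "integrable \<mu> (\<lambda>a. exp (l (s, a)))" "integrable \<mu> (\<lambda>a. exp (k (s, a)))"
    using slice_integrable[OF Bb_exp[OF normalised_Bb[OF l]]] slice_integrable[OF Bb_exp[OF normalised_Bb[OF k]]] by auto
  then show "integrable \<mu> (\<lambda>a. exp (l (s, a)) - exp (k (s, a)))" by auto
  fix B :: "'a set" assume B: "B \<in> sets borel"
  have "set_integrable \<mu> B (\<lambda>a. exp (l (s, a)))" "set_integrable \<mu> B (\<lambda>a. exp (k (s, a)))"
    unfolding set_integrable_def by (intro integrable_mult_indicator int; simp add: B)+
  then show "measure (lpol l s) B - measure (lpol k s) B = (LINT a:B|\<mu>. exp (l (s, a)) - exp (k (s, a)))"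
    by (simp add: measure_lpol[OF l B] measure_lpol[OF k B] set_integral_diff)
qed simp

end

section \<open>Value functions and the optimal policy\<close>

text \<open>The terms \<open>f n\<close> may be infinite and have no fixed sign, so convergence of
  their series is not automatic. Subtracting the real summable minorant leaves nonnegative terms,
  whose series always converges.\<close>

lemma ereal_suminf_ge:
  fixes f :: "nat \<Rightarrow> ereal"
  assumes le: "\<And>n. ereal (g n) \<le> f n" and g: "summable g"
  shows "ereal (suminf g) \<le> suminf f"
proof -
  define d where "d n = f n - ereal (g n)" for n
  have d: "0 \<le> d n" "f n = d n + ereal (g n)" for n
    using le[of n] by (cases "f n"; simp add: d_def)+
  have "(\<lambda>n. \<Sum>i<n. d i) \<longlonglongrightarrow> suminf d"
    using d(1) by (intro summable_LIMSEQ summable_ereal_pos)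
  moreover have "(\<lambda>n. ereal (\<Sum>i<n. g i)) \<longlonglongrightarrow> ereal (suminf g)"
    using summable_LIMSEQ[OF g] by simp
  ultimately have "(\<lambda>n. (\<Sum>i<n. d i) + ereal (\<Sum>i<n. g i)) \<longlonglongrightarrow> suminf d + ereal (suminf g)"
    by (intro tendsto_add_ereal_general1) auto
  moreover have "(\<Sum>i<n. f i) = (\<Sum>i<n. d i) + ereal (\<Sum>i<n. g i)" for n
    unfolding d(2) by (simp add: sum.distrib)
  ultimately have "f sums (suminf d + ereal (suminf g))" by (simp add: sums_def)
  then have "suminf f = suminf d + ereal (suminf g)" by (simp add: sums_iff)
  moreover have "0 \<le> suminf d" using d(1) by (intro suminf_0_le summable_ereal_pos)
  ultimately show ?thesis using add_mono[of 0 "suminf d" "ereal (suminf g)" "ereal (suminf g)"] by simp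
qed

context mdp_trajectory
begin

lemma component_integrable:
  assumes h: "h \<in> Bb" shows "integrable L (\<lambda>\<omega>. h (\<omega> n))"
proof -
  obtain C where C: "h \<in> borel_measurable borel" "\<And>x. \<bar>h x\<bar> \<le> C" "0 \<le> C" by (rule BbE[OF h]) blast
  show ?thesis
    by (rule L.integrable_bounded[OF measurable_compose[OF component_measurable C(1)] C(2)])
qed

text \<open>The Gibbs variational inequality replaces the possibly infinite, possibly non-measurable
  relative entropies of an arbitrary policy by a bounded measurable lower bound that telescopes.\<close>

lemma value_fun_ge:
  assumes v: "v \<in> Bb" and soft: "\<And>s. v s = - \<tau> * ln (LINT a|\<mu>. exp (- (c (s, a) + \<gamma> * next_mean v (s, a)) / \<tau>))"
  shows "ereal (v s) \<le> value_fun M \<pi> s"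
proof -
  define q where "q x = c x + \<gamma> * next_mean v x" for x
  have q: "q \<in> Bb" unfolding q_def[abs_def] by (intro Bb_add Bb_cmult c_Bb next_mean_Bb v)
  obtain Cq where Cq: "q \<in> borel_measurable borel" "\<And>x. \<bar>q x\<bar> \<le> Cq" "0 \<le> Cq" by (rule BbE[OF q]) blast
  obtain Cv where Cv: "v \<in> borel_measurable borel" "\<And>x. \<bar>v x\<bar> \<le> Cv" "0 \<le> Cv" by (rule BbE[OF v]) blast
  obtain Cc where Cc: "c \<in> borel_measurable borel" "\<And>x. \<bar>c x\<bar> \<le> Cc" "0 \<le> Cc" by (rule BbE[OF c_Bb]) blast
  define m where "m n \<omega> = (LINT a|\<pi> n (hist \<omega> n). q (fst (\<omega> n), a))" for n \<omega>
  \<comment> \<open>\<open>v - m\<close> will bound the entropy cost from below. The means of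
    \<open>g\<close> telescope, because the mean of \<open>m\<close> equals that of
    \<open>q\<close>, which is the cost plus the discounted mean of \<open>v\<close> at the next
    state.\<close>
  define g where "g n \<omega> = c (\<omega> n) + v (fst (\<omega> n)) - m n \<omega>" for n \<omega>
  note fst_meas = measurable_compose[OF component_measurable measurable_fst_borel]
  have m_meas: "m n \<in> borel_measurable L" for n
    unfolding m_def[abs_def] using measurable_compose[OF hist_measurable policy_mean_measurable[OF q]] by simp
  have m_bound: "\<bar>m n \<omega>\<bar> \<le> Cq" for n \<omega>
    unfolding m_def by (rule policy_mean_bound[OF q Cq(2) restrict_space])
  have c_meas: "(\<lambda>\<omega>. c (\<omega> n)) \<in> borel_measurable L" for n by (rule measurable_compose[OF component_measurable Cc(1)])
  have v_meas: "(\<lambda>\<omega>. v (fst (\<omega> n))) \<in> borel_measurable L" for n by (rule measurable_compose[OF fst_meas Cv(1)])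
  have g_meas: "g n \<in> borel_measurable L" for n
    unfolding g_def[abs_def] using c_meas v_meas m_meas by measurable
  have g_bound: "\<bar>g n \<omega>\<bar> \<le> Cc + Cv + Cq" for n \<omega>
    using Cc(2)[of "\<omega> n"] Cv(2)[of "fst (\<omega> n)"] m_bound[of n \<omega>] unfolding g_def by linarith
  have step: "(LINT \<omega>|L. g n \<omega>) = (LINT \<omega>|L. v (fst (\<omega> n))) - \<gamma> * (LINT \<omega>|L. v (fst (\<omega> (Suc n))))" for n
  proof -
    have int: "integrable L (\<lambda>\<omega>. c (\<omega> n))" "integrable L (\<lambda>\<omega>. v (fst (\<omega> n)))" "integrable L (m n)"
      "integrable L (\<lambda>\<omega>. next_mean v (\<omega> n))"
      by (rule component_integrable c_Bb next_mean_Bb v L.integrable_bounded[OF m_meas m_bound]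
        component_integrable[OF Bb_fst[OF v]])+
    have "(LINT \<omega>|L. m n \<omega>) = (LINT \<omega>|L. q (\<omega> n))"
      unfolding m_def by (rule expectation_action[OF q, symmetric])
    also have "\<dots> = (LINT \<omega>|L. c (\<omega> n)) + \<gamma> * (LINT \<omega>|L. next_mean v (\<omega> n))"
      unfolding q_def using int by simp
    finally show ?thesis
      unfolding g_def expectation_next[OF v] using int by simp
  qed
  note tel = expectation_telescope[OF g_meas g_bound v step]
  have summ: "summable (\<lambda>n. \<gamma> ^ n * g n \<omega>)" for \<omega>
  proof (rule summable_comparison_test'[of "\<lambda>n. \<gamma> ^ n * (Cc + Cv + Cq)" 0])
    show "summable (\<lambda>n. \<gamma> ^ n * (Cc + Cv + Cq))"
      using \<gamma> by (intro summable_mult2 summable_geometric) auto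
    show "norm (\<gamma> ^ n * g n \<omega>) \<le> \<gamma> ^ n * (Cc + Cv + Cq)" for n
      using g_bound[of n \<omega>] \<gamma> by (simp add: abs_mult mult_left_mono)
  qed
  have le_term: "ereal (\<gamma> ^ n * g n \<omega>) \<le> ereal (\<gamma> ^ n) * (ereal (c (\<omega> n)) + ereal \<tau> * KL (\<pi> n (hist \<omega> n)) \<mu>)" for n \<omega>
  proof -
    let ?s = "fst (\<omega> n)"
    note pol = measurable_to_prob_algebraD[OF policy_slice_measurable[OF restrict_space[of \<omega> n]], of ?s, simplified]
    \<comment> \<open>With the test function \<open>- q / \<tau>\<close> the log-moment is
      \<open>- v / \<tau>\<close> by the soft equation, so multiplying by \<open>\<tau>\<close>
      gives exactly \<open>v - m\<close>.\<close>
    have "ereal ((LINT a|\<pi> n (hist \<omega> n). - q (?s, a) / \<tau>) - ln (LINT a|\<mu>. exp (- q (?s, a) / \<tau>))) \<le> KL (\<pi> n (hist \<omega> n)) \<mu>"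
    proof (rule KL_variational[OF pol(1) prob_space_\<mu>])
      show "sets (\<pi> n (hist \<omega> n)) = sets \<mu>" using pol(2) by simp
      show "(\<lambda>a. - q (?s, a) / \<tau>) \<in> borel_measurable \<mu>"
        using Bb_measurable[OF Bb_slice[OF q, of ?s]] by (simp cong: measurable_cong_sets)
      show "\<bar>- q (?s, a) / \<tau>\<bar> \<le> Cq / \<tau>" for a
        using Cq(2) \<tau> by (simp add: divide_right_mono)
    qed
    then have "ereal \<tau> * ereal ((LINT a|\<pi> n (hist \<omega> n). - q (?s, a) / \<tau>) - ln (LINT a|\<mu>. exp (- q (?s, a) / \<tau>)))
        \<le> ereal \<tau> * KL (\<pi> n (hist \<omega> n)) \<mu>"
      using \<tau> by (intro ereal_mult_left_mono) auto
    moreover have "\<tau> * ((LINT a|\<pi> n (hist \<omega> n). - q (?s, a) / \<tau>) - ln (LINT a|\<mu>. exp (- q (?s, a) / \<tau>)))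
        = v ?s - m n \<omega>"
      using \<tau> soft[of ?s] by (simp add: m_def q_def[symmetric] right_diff_distrib)
    ultimately have "ereal (v ?s - m n \<omega>) \<le> ereal \<tau> * KL (\<pi> n (hist \<omega> n)) \<mu>" by simp
    then have "ereal (c (\<omega> n)) + ereal (v ?s - m n \<omega>) \<le> ereal (c (\<omega> n)) + ereal \<tau> * KL (\<pi> n (hist \<omega> n)) \<mu>"
      by (rule add_left_mono)
    then have "ereal (\<gamma> ^ n) * ereal (g n \<omega>) \<le> ereal (\<gamma> ^ n) * (ereal (c (\<omega> n)) + ereal \<tau> * KL (\<pi> n (hist \<omega> n)) \<mu>)"
      using \<gamma> by (intro ereal_mult_left_mono) (auto simp: g_def add_diff_eq)
    then show ?thesis by simp
  qed
  have "ereal (v s) = ext_integral L (\<lambda>\<omega>. ereal (\<Sum>n. \<gamma> ^ n * g n \<omega>))"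
    using ext_integral_ereal[OF tel(1)] tel(2) by simp
  also have "\<dots> \<le> value_fun M \<pi> s"
    unfolding value_fun_def
    by (intro ext_integral_mono_AE AE_I2 ereal_suminf_ge summ) (use le_term in simp)
  finally show ?thesis .
qed

end

section \<open>Bellman equations and the values of Gibbs policies\<close>

context entropy_mdp
begin

lemma next_state_integrable:
  assumes f: "f \<in> Bb" shows "integrable (P x) f"
proof -
  interpret prob_space "P x" by (rule prob_space_P)
  obtain C where C: "f \<in> borel_measurable borel" "\<And>x. \<bar>f x\<bar> \<le> C" "0 \<le> C" by (rule BbE[OF f]) blast
  show ?thesis
    by (rule integrable_bounded[OF _ C(2)]) (simp add: measurable_cong_sets[OF sets_P refl] C(1))
qed

lemma next_mean_diff: "h \<in> Bb \<Longrightarrow> k \<in> Bb \<Longrightarrow> next_mean (\<lambda>s. h s - k s) x = next_mean h x - next_mean k x"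
  unfolding next_mean_def by (intro Bochner_Integration.integral_diff next_state_integrable)

lemma next_mean_bound:
  assumes h: "h \<in> Bb" and C: "\<And>x. \<bar>h x\<bar> \<le> C" shows "\<bar>next_mean h x\<bar> \<le> C"
proof -
  interpret prob_space "P x" by (rule prob_space_P)
  show ?thesis unfolding next_mean_def using Bb_measurable[OF h] C
    by (intro integral_bounds) (auto simp: measurable_cong_sets[OF sets_P refl])
qed

lemma next_mean_mono:
  assumes "h \<in> Bb" "k \<in> Bb" "\<And>s. h s \<le> k s" shows "next_mean h x \<le> next_mean k x"
  unfolding next_mean_def using assms by (intro integral_mono next_state_integrable)

lemma next_mean_const: "next_mean (\<lambda>_. r) x = r"
  using prob_space.prob_space[OF prob_space_P[of x]] by (simp add: next_mean_def)

lemma contraction_fixpoint: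
  fixes T :: "('s \<Rightarrow> real) \<Rightarrow> 's \<Rightarrow> real"
  assumes T: "\<And>v. v \<in> Bb \<Longrightarrow> T v \<in> Bb"
    and contr: "\<And>v w C s. v \<in> Bb \<Longrightarrow> w \<in> Bb \<Longrightarrow> (\<And>s. \<bar>v s - w s\<bar> \<le> C) \<Longrightarrow> \<bar>T v s - T w s\<bar> \<le> \<gamma> * C"
  shows "\<exists>v\<in>Bb. \<forall>s. v s = T v s"
proof -
  have bm_T: "bm (Bm (T (bm v))) = T (bm v)" for v using T[OF bm] by (simp add: Bm_inverse)
  have "dist (Bm (T (bm v))) (Bm (T (bm w))) \<le> \<gamma> * dist v w" for v w
    unfolding dist_norm
  proof (rule norm_bm_leI)
    show "\<bar>bm (Bm (T (bm v)) - Bm (T (bm w))) s\<bar> \<le> \<gamma> * norm (v - w)" for s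
      unfolding bm_simps bm_T using abs_bm_le_norm[of "v - w"] by (intro contr bm) simp
  qed
  then have "\<exists>!v. Bm (T (bm v)) = v"
    using \<gamma> by (intro banach_fix_type) auto
  then obtain v where "Bm (T (bm v)) = v" by blast
  then have "bm v = T (bm v)" using bm_T[of v] by simp
  then show ?thesis using bm[of v] by metis
qed

definition bellman :: "('s \<times> 'a \<Rightarrow> real) \<Rightarrow> ('s \<Rightarrow> real) \<Rightarrow> 's \<Rightarrow> real" where
  "bellman l w = avg l (\<lambda>x. c x + \<tau> * l x + \<gamma> * next_mean w x)"

text \<open>The value is handled through its fixed point equation, which needs no trajectories;
  \<open>V_pol_lpol\<close> identifies the fixed point with the trajectory value.\<close>

definition val :: "('s \<times> 'a \<Rightarrow> real) \<Rightarrow> 's \<Rightarrow> real" where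
  "val l = (SOME w. w \<in> Bb \<and> (\<forall>s. w s = bellman l w s))"

lemma bellman_arg_Bb: "l \<in> Bb \<Longrightarrow> w \<in> Bb \<Longrightarrow> (\<lambda>x. c x + \<tau> * l x + \<gamma> * next_mean w x) \<in> Bb"
  by (intro Bb_add Bb_cmult c_Bb next_mean_Bb)

lemma val_fixpoint:
  assumes l: "l \<in> normalised"
  shows val_Bb: "val l \<in> Bb" and val_eq: "val l s = bellman l (val l) s"
proof -
  have "\<exists>w\<in>Bb. \<forall>s. w s = bellman l w s"
  proof (rule contraction_fixpoint)
    show "bellman l w \<in> Bb" if "w \<in> Bb" for w
      unfolding bellman_def using that by (intro avg_Bb l bellman_arg_Bb normalised_Bb)
    fix v w :: "'s \<Rightarrow> real" and C s assume v: "v \<in> Bb" and w: "w \<in> Bb" and C: "\<And>s. \<bar>v s - w s\<bar> \<le> C"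
    note Bb = bellman_arg_Bb[OF normalised_Bb[OF l]]
    have "bellman l v s - bellman l w s = avg l (\<lambda>x. \<gamma> * next_mean (\<lambda>s. v s - w s) x) s"
      unfolding bellman_def avg_diff[OF l Bb[OF v] Bb[OF w], symmetric]
      by (simp add: next_mean_diff[OF v w] right_diff_distrib)
    also have "\<bar>\<dots>\<bar> \<le> \<gamma> * C"
      using next_mean_bound[OF Bb_diff[OF v w] C] \<gamma>
      by (intro avg_bound l Bb_cmult next_mean_Bb Bb_diff v w) (simp add: abs_mult mult_left_mono)
    finally show "\<bar>bellman l v s - bellman l w s\<bar> \<le> \<gamma> * C" .
  qed
  then have "\<exists>w. w \<in> Bb \<and> (\<forall>s. w s = bellman l w s)" by blast
  from someI_ex[OF this] show "val l \<in> Bb" "val l s = bellman l (val l) s"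
    unfolding val_def[symmetric] by auto
qed

lemma stationary_policy: "l \<in> normalised \<Longrightarrow> stationary (lpol l) \<in> policies"
  unfolding policies_def stationary_def
  by (auto simp: case_prod_unfold intro!: measurable_compose[OF measurable_snd lpol_measurable])

text \<open>The fixed point equation says that the expected stage cost at a state is
  \<open>val l\<close> minus the discounted mean of \<open>val l\<close> at the next state, so the
  discounted sum telescopes.\<close>

lemma V_pol_lpol:
  assumes l: "l \<in> normalised"
  shows "V_pol M (lpol l) s = ereal (val l s)"
proof -
  interpret mdp_trajectory M "stationary (lpol l)" s
    by unfold_locales (rule stationary_policy[OF l])
  have kl: "avg l l \<in> Bb" by (intro avg_Bb l normalised_Bb)
  \<comment> \<open>The trajectory pays the relative entropy, a function of the state, whereas
    \<open>bellman\<close> averages \<open>\<tau> * l\<close> over the action; the two have the same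
    mean under the policy.\<close>
  define f where "f x = c x + \<tau> * avg l l (fst x)" for x
  have f: "f \<in> Bb" unfolding f_def[abs_def] by (intro Bb_add Bb_cmult c_Bb Bb_fst kl)
  obtain C where C: "f \<in> borel_measurable borel" "\<And>x. \<bar>f x\<bar> \<le> C" "0 \<le> C" by (rule BbE[OF f]) blast
  have nV: "next_mean (val l) \<in> Bb" by (intro next_mean_Bb val_Bb l)
  have mean: "val l s' - avg l (\<lambda>x. \<gamma> * next_mean (val l) x) s' = avg l f s'" for s'
  proof -
    have "avg l f s' = avg l c s' + \<tau> * avg l l s'"
      unfolding f_def using l kl
      by (subst avg_add) (auto simp: avg_cmult avg_state c_Bb intro!: Bb_cmult Bb_fst)
    moreover have "val l s' = avg l c s' + \<tau> * avg l l s' + avg l (\<lambda>x. \<gamma> * next_mean (val l) x) s'"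
      unfolding val_eq[OF l, of s'] bellman_def using l nV
      by (simp add: avg_add avg_cmult c_Bb Bb_add Bb_cmult normalised_Bb)
    ultimately show ?thesis by simp
  qed
  have meas: "(\<lambda>\<omega>. h (\<omega> n)) \<in> borel_measurable L" if "h \<in> Bb" for h :: "'s \<times> 'a \<Rightarrow> real" and n
    by (rule measurable_compose[OF component_measurable Bb_measurable[OF that]])
  have action: "(LINT \<omega>|L. h (\<omega> n)) = (LINT \<omega>|L. avg l h (fst (\<omega> n)))" if "h \<in> Bb" for h n
    using expectation_action[OF that, of n] by (simp add: avg_def stationary_def)
  have step: "(LINT \<omega>|L. f (\<omega> n)) = (LINT \<omega>|L. val l (fst (\<omega> n))) - \<gamma> * (LINT \<omega>|L. val l (fst (\<omega> (Suc n))))" for n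
  proof -
    have "(LINT \<omega>|L. f (\<omega> n)) = (LINT \<omega>|L. val l (fst (\<omega> n)) - avg l (\<lambda>x. \<gamma> * next_mean (val l) x) (fst (\<omega> n)))"
      unfolding action[OF f] mean ..
    also have "\<dots> = (LINT \<omega>|L. val l (fst (\<omega> n))) - (LINT \<omega>|L. avg l (\<lambda>x. \<gamma> * next_mean (val l) x) (fst (\<omega> n)))"
      by (intro Bochner_Integration.integral_diff component_integrable[OF Bb_fst] avg_Bb val_Bb Bb_cmult nV l)
    also have "(LINT \<omega>|L. avg l (\<lambda>x. \<gamma> * next_mean (val l) x) (fst (\<omega> n))) = \<gamma> * (LINT \<omega>|L. val l (fst (\<omega> (Suc n))))"
      unfolding action[OF Bb_cmult[OF nV], symmetric] expectation_next[OF val_Bb[OF l]] by simp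
    finally show ?thesis .
  qed
  note tel = expectation_telescope[OF meas[OF f] C(2) val_Bb[OF l] step]
  have "(\<Sum>n. ereal (\<gamma> ^ n) * (ereal (c (\<omega> n)) + ereal \<tau> * KL (stationary (lpol l) n (hist \<omega> n)) \<mu>))
      = ereal (\<Sum>n. \<gamma> ^ n * f (\<omega> n))" for \<omega>
  proof -
    have "summable (\<lambda>n. \<gamma> ^ n * f (\<omega> n))"
    proof (rule summable_comparison_test'[of "\<lambda>n. \<gamma> ^ n * C" 0])
      show "summable (\<lambda>n. \<gamma> ^ n * C)"
        using \<gamma> by (intro summable_mult2 summable_geometric) auto
      show "norm (\<gamma> ^ n * f (\<omega> n)) \<le> \<gamma> ^ n * C" for n
        using C(2)[of "\<omega> n"] \<gamma> by (simp add: abs_mult mult_left_mono)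
    qed
    then have "(\<lambda>n. ereal (\<gamma> ^ n * f (\<omega> n))) sums ereal (\<Sum>n. \<gamma> ^ n * f (\<omega> n))"
      by (simp add: sums_ereal summable_sums)
    moreover have "ereal (\<gamma> ^ n) * (ereal (c (\<omega> n)) + ereal \<tau> * KL (stationary (lpol l) n (hist \<omega> n)) \<mu>)
        = ereal (\<gamma> ^ n * f (\<omega> n))" for n
      by (simp add: stationary_def KL_lpol_ref[OF l] f_def)
    ultimately show ?thesis by (simp add: sums_iff)
  qed
  then show ?thesis
    unfolding V_pol_def value_fun_def using ext_integral_ereal[OF tel(1)] tel(2) by simp
qed

lemma Q_pol_lpol: "l \<in> normalised \<Longrightarrow> Q_pol M (lpol l) x = c x + \<gamma> * next_mean (val l) x"
  by (simp add: Q_pol_def q_fun_def V_pol_lpol next_mean_def)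

definition adv :: "('s \<times> 'a \<Rightarrow> real) \<Rightarrow> 's \<times> 'a \<Rightarrow> real" where
  "adv l x = c x + \<gamma> * next_mean (val l) x + \<tau> * l x - val l (fst x)"

lemma adv_Bb: "l \<in> normalised \<Longrightarrow> adv l \<in> Bb"
  unfolding adv_def[abs_def]
  by (intro Bb_add Bb_diff Bb_cmult c_Bb next_mean_Bb val_Bb Bb_fst normalised_Bb)

text \<open>A restatement of the Bellman equation. It is used to turn a mean of \<open>adv k\<close>
  under another policy into a difference of means, small when the policies are close.\<close>

lemma avg_adv: "l \<in> normalised \<Longrightarrow> avg l (adv l) s = 0"
proof -
  assume l: "l \<in> normalised"
  have "avg l (adv l) s = avg l (\<lambda>x. (c x + \<tau> * l x + \<gamma> * next_mean (val l) x) - val l (fst x)) s"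
    by (simp add: adv_def[abs_def] algebra_simps)
  also have "\<dots> = bellman l (val l) s - avg l (\<lambda>x. val l (fst x)) s"
    unfolding bellman_def using l
    by (intro avg_diff bellman_arg_Bb normalised_Bb val_Bb Bb_fst)
  also have "\<dots> = bellman l (val l) s - val l s" by (simp only: avg_state[OF l])
  finally show ?thesis using val_eq[OF l, of s] by simp
qed

text \<open>Subtract \<open>val k\<close> inside the Bellman equation of \<open>l\<close>: the
  integrand \<open>c + \<tau> * l + \<gamma> * next_mean (val l) - val k\<close> is
  \<open>adv k + \<tau> * (l - k)\<close> plus the discounted next mean of
  \<open>val l - val k\<close>. The formula stays in one-step form, to be iterated by a comparison
  argument or by an occupancy measure.\<close>

lemma performance_difference:
  assumes l: "l \<in> normalised" and k: "k \<in> normalised"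
  shows "val l s - val k s = avg l (adv k) s + \<tau> * avg l (\<lambda>x. l x - k x) s
    + \<gamma> * avg l (next_mean (\<lambda>s. val l s - val k s)) s"
proof -
  note Bb = normalised_Bb[OF l] normalised_Bb[OF k] val_Bb[OF l] val_Bb[OF k]
  have "val l s - val k s = avg l (\<lambda>x. c x + \<tau> * l x + \<gamma> * next_mean (val l) x) s - avg l (\<lambda>x. val k (fst x)) s"
    using val_eq[OF l, of s] avg_state[OF l, of "val k" s] by (simp add: bellman_def)
  also have "\<dots> = avg l (\<lambda>x. c x + \<tau> * l x + \<gamma> * next_mean (val l) x - val k (fst x)) s"
    by (intro avg_diff[symmetric] l bellman_arg_Bb Bb Bb_fst)
  also have "\<dots> = avg l (\<lambda>x. (adv k x + \<tau> * (l x - k x)) + \<gamma> * next_mean (\<lambda>s. val l s - val k s) x) s"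
    by (simp add: adv_def next_mean_diff Bb algebra_simps)
  also have "\<dots> = avg l (adv k) s + \<tau> * avg l (\<lambda>x. l x - k x) s
    + \<gamma> * avg l (next_mean (\<lambda>s. val l s - val k s)) s"
    using l k by (simp add: avg_add avg_cmult Bb Bb_add Bb_cmult Bb_diff adv_Bb next_mean_Bb)
  finally show ?thesis .
qed

text \<open>A minimum principle: averaging preserves the lower bound given by the infimum
  \<open>m\<close> of \<open>h\<close>, so that \<open>m \<ge> g + \<gamma> * m\<close>.\<close>

lemma comparison_ge:
  assumes l: "l \<in> normalised" and h: "h \<in> Bb"
    and ge: "\<And>s. g + \<gamma> * avg l (next_mean h) s \<le> h s"
  shows "g / (1 - \<gamma>) \<le> h s"
proof -
  obtain C where C: "h \<in> borel_measurable borel" "\<And>x. \<bar>h x\<bar> \<le> C" "0 \<le> C" by (rule BbE[OF h]) blast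
  have "- C \<le> h s" for s using C(2)[of s] by (simp add: abs_le_iff)
  then have bdd: "bdd_below (range h)" by (auto intro!: bdd_belowI)
  define m where "m = (INF s. h s)"
  have m: "m \<le> h s" for s unfolding m_def using bdd by (auto intro: cINF_lower)
  have "g + \<gamma> * m \<le> h s" for s
  proof -
    have "m \<le> avg l (next_mean h) s"
      using avg_mono[OF l Bb_const next_mean_Bb[OF h], of m s]
        next_mean_mono[OF Bb_const h m] avg_const[OF l, of m s] by (simp add: next_mean_const)
    then have "\<gamma> * m \<le> \<gamma> * avg l (next_mean h) s" using \<gamma> by (intro mult_left_mono)
    then show ?thesis using ge[of s] by linarith
  qed
  \<comment> \<open>The infimum need not be attained, but every value of \<open>h\<close> exceeds
    \<open>g + \<gamma> * m\<close>, hence so does the infimum.\<close>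
  then have "g + \<gamma> * m \<le> m" unfolding m_def by (intro cINF_greatest) auto
  then have "g / (1 - \<gamma>) \<le> m" using \<gamma> by (simp add: pos_divide_le_eq algebra_simps)
  then show ?thesis using m[of s] by linarith
qed

lemma comparison_abs:
  assumes l: "l \<in> normalised" and h: "h \<in> Bb"
    and le: "\<And>s. \<bar>h s - \<gamma> * avg l (next_mean h) s\<bar> \<le> g"
  shows "\<bar>h s\<bar> \<le> g / (1 - \<gamma>)"
proof -
  have "- g / (1 - \<gamma>) \<le> h s"
  proof (rule comparison_ge[OF l h])
    show "- g + \<gamma> * avg l (next_mean h) s \<le> h s" for s using le[of s] by (simp add: abs_le_iff)
  qed
  moreover have "- g / (1 - \<gamma>) \<le> - h s"
  proof (rule comparison_ge[OF l Bb_uminus[OF h]])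
    fix s
    have "next_mean (\<lambda>s. - h s) x = - next_mean h x" for x by (simp add: next_mean_def)
    then have "avg l (next_mean (\<lambda>s. - h s)) s = - avg l (next_mean h) s" by (simp add: avg_def)
    then show "- g + \<gamma> * avg l (next_mean (\<lambda>s. - h s)) s \<le> - h s" using le[of s] by (simp add: abs_le_iff)
  qed
  ultimately show ?thesis by (simp add: abs_le_iff)
qed

section \<open>The soft optimality equation and the optimal value\<close>

lemma lse_diff_le:
  fixes Z Y :: "'s \<times> 'a \<Rightarrow> real"
  assumes Z: "Z \<in> Bb" and Y: "Y \<in> Bb" and C: "\<And>a. \<bar>Z (s, a) - Y (s, a)\<bar> \<le> C"
  shows "\<bar>lse Z s - lse Y s\<bar> \<le> C"
proof -
  have *: "lse Z s \<le> lse Y s + C" if Z: "Z \<in> Bb" and Y: "Y \<in> Bb" and C: "\<And>a. Z (s, a) \<le> Y (s, a) + C"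
    for Z Y :: "'s \<times> 'a \<Rightarrow> real"
  proof -
    have "(LINT a|\<mu>. exp (Z (s, a))) \<le> (LINT a|\<mu>. exp C * exp (Y (s, a)))"
      using C by (intro integral_mono integrable_mult_right slice_integrable[OF Bb_exp[OF Z]] slice_integrable[OF Bb_exp[OF Y]])
        (simp add: exp_add[symmetric] add.commute)
    then have "exp (lse Z s) \<le> exp (lse Y s + C)"
      by (simp add: exp_lse Z Y exp_add mult.commute)
    then show ?thesis by simp
  qed
  have "Z (s, a) \<le> Y (s, a) + C" "Y (s, a) \<le> Z (s, a) + C" for a using C[of a] by (auto simp: abs_le_iff)
  from *[OF Z Y this(1)] *[OF Y Z this(2)] show ?thesis by (simp add: abs_le_iff)
qed

text \<open>Fixed point of the soft optimality operator, in which the minimum over actions is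
  replaced by a log-partition function at temperature \<open>\<tau>\<close>; \<open>V_opt_eq\<close>
  shows that it is the optimal value.\<close>

definition vopt :: "'s \<Rightarrow> real" where
  "vopt = (SOME v. v \<in> Bb \<and> (\<forall>s. v s = - \<tau> * lse (\<lambda>x. - (c x + \<gamma> * next_mean v x) / \<tau>) s))"

lemma soft_arg_Bb: "v \<in> Bb \<Longrightarrow> (\<lambda>x. - (c x + \<gamma> * next_mean v x) / \<tau>) \<in> Bb"
  unfolding divide_inverse by (intro Bb_mult Bb_uminus Bb_add Bb_cmult Bb_const c_Bb next_mean_Bb)

lemma vopt_fixpoint:
  shows vopt_Bb: "vopt \<in> Bb" and vopt_eq: "vopt s = - \<tau> * lse (\<lambda>x. - (c x + \<gamma> * next_mean vopt x) / \<tau>) s"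
proof -
  have "\<exists>v\<in>Bb. \<forall>s. v s = - \<tau> * lse (\<lambda>x. - (c x + \<gamma> * next_mean v x) / \<tau>) s"
  proof (rule contraction_fixpoint)
    show "(\<lambda>s. - \<tau> * lse (\<lambda>x. - (c x + \<gamma> * next_mean v x) / \<tau>) s) \<in> Bb" if "v \<in> Bb" for v
      using that by (intro Bb_cmult lse_Bb soft_arg_Bb)
    fix v w :: "'s \<Rightarrow> real" and C s assume v: "v \<in> Bb" and w: "w \<in> Bb" and C: "\<And>s. \<bar>v s - w s\<bar> \<le> C"
    have "\<bar>lse (\<lambda>x. - (c x + \<gamma> * next_mean v x) / \<tau>) s - lse (\<lambda>x. - (c x + \<gamma> * next_mean w x) / \<tau>) s\<bar> \<le> \<gamma> * C / \<tau>"
    proof (rule lse_diff_le[OF soft_arg_Bb[OF v] soft_arg_Bb[OF w]])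
      fix a
      have "- (c (s, a) + \<gamma> * next_mean v (s, a)) / \<tau> - - (c (s, a) + \<gamma> * next_mean w (s, a)) / \<tau>
          = - (\<gamma> * next_mean (\<lambda>s. v s - w s) (s, a)) / \<tau>"
        by (simp add: next_mean_diff[OF v w] diff_divide_distrib[symmetric] algebra_simps)
      then show "\<bar>- (c (s, a) + \<gamma> * next_mean v (s, a)) / \<tau> - - (c (s, a) + \<gamma> * next_mean w (s, a)) / \<tau>\<bar> \<le> \<gamma> * C / \<tau>"
        using next_mean_bound[OF Bb_diff[OF v w] C, of "(s, a)"] \<gamma> \<tau>
        by (simp add: abs_mult divide_right_mono mult_left_mono)
    qed
    then have "\<tau> * \<bar>lse (\<lambda>x. - (c x + \<gamma> * next_mean v x) / \<tau>) s - lse (\<lambda>x. - (c x + \<gamma> * next_mean w x) / \<tau>) s\<bar> \<le> \<gamma> * C"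
      using \<tau> by (simp add: pos_le_divide_eq mult.commute)
    then show "\<bar>- \<tau> * lse (\<lambda>x. - (c x + \<gamma> * next_mean v x) / \<tau>) s - - \<tau> * lse (\<lambda>x. - (c x + \<gamma> * next_mean w x) / \<tau>) s\<bar> \<le> \<gamma> * C"
      using \<tau> by (simp add: right_diff_distrib[symmetric] abs_mult abs_minus_commute del: right_diff_distrib)
  qed
  then have "\<exists>v. v \<in> Bb \<and> (\<forall>s. v s = - \<tau> * lse (\<lambda>x. - (c x + \<gamma> * next_mean v x) / \<tau>) s)" by blast
  from someI_ex[OF this] show "vopt \<in> Bb" "vopt s = - \<tau> * lse (\<lambda>x. - (c x + \<gamma> * next_mean vopt x) / \<tau>) s"
    unfolding vopt_def[symmetric] by auto
qed

definition lopt :: "'s \<times> 'a \<Rightarrow> real" where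
  "lopt = nrm (\<lambda>x. - (c x + \<gamma> * next_mean vopt x) / \<tau>)"

lemma lopt_normalised: "lopt \<in> normalised"
  unfolding lopt_def by (intro nrm_normalised soft_arg_Bb vopt_Bb)

text \<open>The optimality equation makes \<open>- vopt / \<tau>\<close> the log-partition function,
  so normalising subtracts precisely that. In other words the optimal policy has zero
  advantage.\<close>

lemma lopt_eq: "\<tau> * lopt x = vopt (fst x) - (c x + \<gamma> * next_mean vopt x)"
proof -
  define Z where "Z = (\<lambda>x. - (c x + \<gamma> * next_mean vopt x) / \<tau>)"
  have "vopt (fst x) = - \<tau> * lse Z (fst x)" unfolding Z_def by (rule vopt_eq)
  moreover have "\<tau> * Z x = - (c x + \<gamma> * next_mean vopt x)" using \<tau> by (simp add: Z_def)
  moreover have "lopt x = Z x - lse Z (fst x)" unfolding lopt_def nrm_def Z_def ..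
  ultimately show ?thesis by (simp add: right_diff_distrib)
qed

lemma val_unique:
  assumes l: "l \<in> normalised" and w: "w \<in> Bb" "\<And>s. w s = bellman l w s"
  shows "val l s = w s"
proof -
  note Bb = bellman_arg_Bb[OF normalised_Bb[OF l]]
  have "\<bar>val l s - w s\<bar> \<le> 0 / (1 - \<gamma>)"
  proof (rule comparison_abs[OF l Bb_diff[OF val_Bb[OF l] w(1)]])
    fix s
    have "val l s - w s = bellman l (val l) s - bellman l w s"
      using val_eq[OF l, of s] w(2)[of s] by simp
    also have "\<dots> = avg l (\<lambda>x. \<gamma> * next_mean (\<lambda>s. val l s - w s) x) s"
      unfolding bellman_def avg_diff[OF l Bb[OF val_Bb[OF l]] Bb[OF w(1)], symmetric]
      by (simp add: next_mean_diff[OF val_Bb[OF l] w(1)] right_diff_distrib)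
    finally show "\<bar>val l s - w s - \<gamma> * avg l (next_mean (\<lambda>s. val l s - w s)) s\<bar> \<le> 0"
      by (simp add: avg_cmult)
  qed
  then show ?thesis by simp
qed

text \<open>By \<open>lopt_eq\<close> the integrand of the Bellman operator of \<open>lopt\<close>
  at \<open>vopt\<close> reduces to \<open>vopt\<close>, so \<open>vopt\<close> is its fixed
  point.\<close>

lemma val_lopt: "val lopt = vopt"
proof
  fix s
  show "val lopt s = vopt s"
  proof (rule val_unique[OF lopt_normalised vopt_Bb])
    fix s
    have "bellman lopt vopt s = avg lopt (\<lambda>x. vopt (fst x)) s"
      unfolding bellman_def by (simp add: lopt_eq)
    then show "vopt s = bellman lopt vopt s" by (simp add: avg_state lopt_normalised)
  qed
qed

text \<open>The stationary policy of \<open>lopt\<close> attains \<open>vopt\<close>, and the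
  telescoping lower bound \<open>value_fun_ge\<close> covers every history-dependent policy.\<close>

lemma V_opt_eq: "V_opt M s = ereal (vopt s)"
proof (rule antisym)
  show "V_opt M s \<le> ereal (vopt s)"
    using V_pol_lpol[OF lopt_normalised, of s] stationary_policy[OF lopt_normalised]
    unfolding V_opt_def V_pol_def val_lopt by (metis INF_lower)
  show "ereal (vopt s) \<le> V_opt M s"
    unfolding V_opt_def
  proof (rule INF_greatest)
    fix \<pi> :: "('s, 'a) policy" assume "\<pi> \<in> policies"
    then interpret mdp_trajectory M \<pi> s by unfold_locales
    show "ereal (vopt s) \<le> value_fun M \<pi> s"
      by (rule value_fun_ge[OF vopt_Bb vopt_eq[unfolded lse_def]])
  qed
qed

lemma optimal_policy_eq: "optimal_policy M = lpol lopt"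
proof
  fix s
  have "lopt (s, a) = - (1 / \<tau>) * (c (s, a) + \<gamma> * next_mean vopt (s, a) - vopt s)" for a
    using lopt_eq[of "(s, a)"] \<tau> by (simp add: field_simps)
  then show "optimal_policy M s = lpol lopt s"
    by (simp add: optimal_policy_def lpol_def Q_opt_def q_fun_def V_opt_eq next_mean_def)
qed

lemma vopt_le: "l \<in> normalised \<Longrightarrow> vopt s \<le> val l s"
proof -
  assume l: "l \<in> normalised"
  have "V_opt M s \<le> V_pol M (lpol l) s"
    unfolding V_opt_def V_pol_def by (rule INF_lower[OF stationary_policy[OF l]])
  then show ?thesis by (simp add: V_opt_eq V_pol_lpol[OF l])
qed

section \<open>Occupancy measures\<close>

lemma policy_kernel_measurable:
  assumes l: "l \<in> normalised"
  shows "policy_kernel M (lpol l) \<in> borel \<rightarrow>\<^sub>M prob_algebra borel"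
  unfolding policy_kernel_def[abs_def]
proof (rule measurable_bind_prob_space2[OF lpol_measurable[OF l]])
  show "(\<lambda>(s, a). P (s, a)) \<in> borel \<Otimes>\<^sub>M borel \<rightarrow>\<^sub>M prob_algebra borel"
    unfolding borel_prod by simp
qed

lemma integral_policy_kernel:
  assumes l: "l \<in> normalised" and h: "h \<in> Bb"
  shows "(LINT s'|policy_kernel M (lpol l) s. h s') = avg l (next_mean h) s"
proof -
  obtain C where C: "h \<in> borel_measurable borel" "\<And>x. \<bar>h x\<bar> \<le> C" "0 \<le> C" by (rule BbE[OF h]) blast
  have "Pair s \<in> borel \<rightarrow>\<^sub>M (borel :: ('s \<times> 'a) measure)" by (simp add: borel_prod[symmetric])
  from measurable_compose[OF this P_measurable]
  have "(\<lambda>a. P (s, a)) \<in> lpol l s \<rightarrow>\<^sub>M prob_algebra borel"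
    by (simp add: measurable_cong_sets[OF sets_lpol refl])
  from integral_bind_prob[OF prob_space_lpol[OF l] this C(1,2)] show ?thesis
    by (simp add: policy_kernel_def avg_def next_mean_def)
qed

lemma policy_kernel_iter_measurable:
  assumes l: "l \<in> normalised"
  shows "policy_kernel_iter M (lpol l) n \<in> borel \<rightarrow>\<^sub>M prob_algebra borel"
proof (induction n)
  case 0
  have "policy_kernel_iter M (lpol l) 0 = return borel" by (rule ext) simp
  then show ?case by simp
next
  case (Suc n)
  have "policy_kernel_iter M (lpol l) (Suc n) = (\<lambda>s. policy_kernel_iter M (lpol l) n s \<bind> policy_kernel M (lpol l))"
    by (rule ext) simp
  then show ?case using measurable_bind_prob_space[OF Suc policy_kernel_measurable[OF l]] by simp
qed

text \<open>The weights \<open>(1 - \<gamma>) * \<gamma> ^ n\<close> are those of a geometric law,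
  so the occupancy measure is the law of the state at an independent geometric time. Being a
  \<open>bind\<close>, it inherits total mass and measurability from its parts.\<close>

lemma occupancy_eq_bind:
  assumes l: "l \<in> normalised"
  shows "occupancy M (lpol l) s = measure_pmf (geometric_pmf (1 - \<gamma>)) \<bind> (\<lambda>n. policy_kernel_iter M (lpol l) n s)"
    (is "_ = ?N")
proof -
  let ?K = "\<lambda>n. policy_kernel_iter M (lpol l) n s"
  have K: "?K \<in> measure_pmf (geometric_pmf (1 - \<gamma>)) \<rightarrow>\<^sub>M subprob_algebra borel"
    using measurable_space[OF measurable_prob_algebraD[OF policy_kernel_iter_measurable[OF l]]] by simp
  have sets_N: "sets ?N = sets borel"
    using measurable_to_prob_algebraD(2)[OF policy_kernel_iter_measurable[OF l]] by (intro sets_bind) auto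
  then have space_N: "space ?N = UNIV" using sets_eq_imp_space_eq[OF sets_N] by simp
  have eq: "emeasure ?N B = ennreal (1 - \<gamma>) * (\<Sum>n. ennreal (\<gamma> ^ n) * emeasure (?K n) B)"
    if B: "B \<in> sets borel" for B
  proof -
    have "emeasure ?N B = (\<integral>\<^sup>+n. emeasure (?K n) B \<partial>measure_pmf (geometric_pmf (1 - \<gamma>)))"
      by (rule emeasure_bind[OF _ K B]) simp
    also have "\<dots> = (\<Sum>n. ennreal (pmf (geometric_pmf (1 - \<gamma>)) n) * emeasure (?K n) B)"
      by (simp add: nn_integral_measure_pmf nn_integral_count_space_nat)
    also have "\<dots> = (\<Sum>n. ennreal (1 - \<gamma>) * (ennreal (\<gamma> ^ n) * emeasure (?K n) B))"
      using \<gamma> by (simp add: pmf_geometric ennreal_mult' mult_ac)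
    finally show ?thesis by (simp add: ennreal_suminf_cmult)
  qed
  have "occupancy M (lpol l) s = measure_of UNIV (sets borel) (emeasure ?N)"
    unfolding occupancy_def
  proof (rule measure_of_eq)
    fix B :: "'s set" assume "B \<in> sigma_sets UNIV (sets borel)"
    then have "B \<in> sets borel" using sets.sigma_sets_eq[of "borel :: 's measure"] by simp
    then show "ennreal (1 - \<gamma>) * (\<Sum>n. ennreal (\<gamma> ^ n) * emeasure (?K n) B) = emeasure ?N B"
      by (simp add: eq)
  qed simp
  also have "\<dots> = ?N"
    using measure_of_of_measure[of ?N] by (simp add: sets_N space_N)
  finally show ?thesis .
qed

lemma occupancy_measurable:
  assumes l: "l \<in> normalised"
  shows "occupancy M (lpol l) \<in> borel \<rightarrow>\<^sub>M prob_algebra borel"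
proof -
  have "(\<lambda>s. measure_pmf (geometric_pmf (1 - \<gamma>)) \<bind> (\<lambda>n. policy_kernel_iter M (lpol l) n s)) \<in> borel \<rightarrow>\<^sub>M prob_algebra borel"
  proof (rule measurable_bind_prob_space2[where N = "count_space UNIV"])
    show "(\<lambda>s. measure_pmf (geometric_pmf (1 - \<gamma>))) \<in> borel \<rightarrow>\<^sub>M prob_algebra (count_space UNIV)"
      by (intro measurable_const) (simp add: space_prob_algebra measure_pmf.prob_space_axioms)
    show "(\<lambda>(s, n). policy_kernel_iter M (lpol l) n s) \<in> borel \<Otimes>\<^sub>M count_space UNIV \<rightarrow>\<^sub>M prob_algebra borel"
      using policy_kernel_iter_measurable[OF l]
      unfolding case_prod_unfold
      by (intro measurable_compose_countable'[where g = snd and I = UNIV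
          and f = "\<lambda>n x. policy_kernel_iter M (lpol l) n (fst x)"]
        measurable_compose[OF measurable_fst policy_kernel_iter_measurable[OF l]]) auto
  qed
  then show ?thesis by (simp add: occupancy_eq_bind[OF l, abs_def])
qed

text \<open>Splitting off \<open>n = 0\<close>: what remains is \<open>\<gamma>\<close> times the
  same law, shifted by one.\<close>

lemma integral_geometric_pmf:
  assumes f: "\<And>n. \<bar>f n\<bar> \<le> (C :: real)"
  shows "(LINT n|measure_pmf (geometric_pmf (1 - \<gamma>)). f n)
    = (1 - \<gamma>) * f 0 + \<gamma> * (LINT n|measure_pmf (geometric_pmf (1 - \<gamma>)). f (Suc n))"
proof -
  let ?G = "geometric_pmf (1 - \<gamma>)"
  have sums: "(\<lambda>n. \<gamma> ^ n * (1 - \<gamma>) * f n) sums (LINT n|measure_pmf ?G. f n)" if f: "\<And>n. \<bar>f n\<bar> \<le> C" for f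
  proof -
    have "integrable (measure_pmf ?G) f"
      by (rule measure_pmf.integrable_const_bound[of _ C]) (use f in auto)
    then have "integrable (count_space UNIV) (\<lambda>n. pmf ?G n *\<^sub>R f n)"
      unfolding measure_pmf_eq_density by (subst (asm) integrable_density) auto
    from sums_integral_count_space_nat[OF this]
    have "(\<lambda>n. pmf ?G n *\<^sub>R f n) sums (LINT n|count_space UNIV. pmf ?G n *\<^sub>R f n)" .
    moreover have "(LINT n|measure_pmf ?G. f n) = (LINT n|count_space UNIV. pmf ?G n *\<^sub>R f n)"
      unfolding measure_pmf_eq_density[of ?G] by (rule integral_density) auto
    ultimately show ?thesis using \<gamma> by (simp add: pmf_geometric)
  qed
  have "(\<lambda>n. \<gamma> ^ Suc n * (1 - \<gamma>) * f (Suc n)) sums (\<gamma> * (LINT n|measure_pmf ?G. f (Suc n)))"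
    using sums_mult[OF sums[of "\<lambda>n. f (Suc n)"], of \<gamma>] f by (simp add: mult.assoc)
  then have "(\<lambda>n. \<gamma> ^ n * (1 - \<gamma>) * f n) sums (\<gamma> * (LINT n|measure_pmf ?G. f (Suc n)) + \<gamma> ^ 0 * (1 - \<gamma>) * f 0)"
    by (rule sums_Suc)
  with sums[OF f] show ?thesis by (simp add: sums_iff)
qed

text \<open>The geometric time is either 0 or one more than a fresh geometric time; in the latter
  case the last transition is integrated out and becomes \<open>avg l (next_mean h)\<close>.\<close>

lemma integral_occupancy_step:
  assumes l: "l \<in> normalised" and h: "h \<in> Bb"
  shows "(LINT s'|occupancy M (lpol l) s. h s')
    = (1 - \<gamma>) * h s + \<gamma> * (LINT s'|occupancy M (lpol l) s. avg l (next_mean h) s')"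
proof -
  let ?G = "measure_pmf (geometric_pmf (1 - \<gamma>))" and ?K = "\<lambda>n. policy_kernel_iter M (lpol l) n"
  have G: "(\<lambda>n. ?K n s) \<in> ?G \<rightarrow>\<^sub>M prob_algebra borel"
    using measurable_space[OF policy_kernel_iter_measurable[OF l]] by simp
  have occ: "(LINT s'|occupancy M (lpol l) s. f s') = (LINT n|?G. LINT s'|?K n s. f s')" if f: "f \<in> Bb" for f
  proof -
    obtain C where C: "f \<in> borel_measurable borel" "\<And>x. \<bar>f x\<bar> \<le> C" "0 \<le> C" by (rule BbE[OF f]) blast
    show ?thesis unfolding occupancy_eq_bind[OF l]
      by (rule integral_bind_prob[OF measure_pmf.prob_space_axioms G C(1,2)])
  qed
  have iter: "(LINT s'|?K (Suc n) s. h s') = (LINT s'|?K n s. avg l (next_mean h) s')" for n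
  proof -
    obtain C where C: "h \<in> borel_measurable borel" "\<And>x. \<bar>h x\<bar> \<le> C" "0 \<le> C" by (rule BbE[OF h]) blast
    note K = measurable_to_prob_algebraD[OF policy_kernel_iter_measurable[OF l, of n], of s, simplified]
    have "policy_kernel M (lpol l) \<in> ?K n s \<rightarrow>\<^sub>M prob_algebra borel"
      using policy_kernel_measurable[OF l] by (simp add: measurable_cong_sets[OF K(2) refl])
    from integral_bind_prob[OF K(1) this C(1,2)] show ?thesis
      by (simp add: integral_policy_kernel[OF l h])
  qed
  obtain C where C: "h \<in> borel_measurable borel" "\<And>x. \<bar>h x\<bar> \<le> C" "0 \<le> C" by (rule BbE[OF h]) blast
  have bound: "\<bar>LINT s'|?K n s. h s'\<bar> \<le> C" for n
  proof -
    note K = measurable_to_prob_algebraD[OF policy_kernel_iter_measurable[OF l, of n], of s, simplified]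
    interpret prob_space "?K n s" by (rule K)
    show ?thesis using C by (intro integral_bounds) (auto simp: measurable_cong_sets[OF K(2) refl])
  qed
  have "(LINT s'|?K 0 s. h s') = h s" using C by (simp add: integral_return)
  then show ?thesis
    using integral_geometric_pmf[OF bound] iter
    by (simp only: occ[OF h] occ[OF avg_Bb[OF l next_mean_Bb[OF h]]])
qed

lemma occupancy_from_prob:
  assumes l: "l \<in> normalised" and \<rho>: "\<rho> \<in> space (prob_algebra borel)"
  shows "prob_space (occupancy_from M (lpol l) \<rho>)" "sets (occupancy_from M (lpol l) \<rho>) = sets borel"
  using prob_space_bind'[OF \<rho> occupancy_measurable[OF l]] sets_bind'[OF \<rho> occupancy_measurable[OF l]]
  by (auto simp: occupancy_from_def)

text \<open>A solution of \<open>h = g + \<gamma> * avg l (next_mean h)\<close> is the discounted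
  sum of the means of \<open>g\<close> along the chain. This turns the one-step performance
  difference into an integral against the occupancy measure.\<close>

lemma integral_occupancy_from:
  assumes l: "l \<in> normalised" and \<rho>: "\<rho> \<in> space (prob_algebra borel)"
    and h: "h \<in> Bb" and g: "g \<in> Bb" and eq: "\<And>s. h s = g s + \<gamma> * avg l (next_mean h) s"
  shows "(LINT s|occupancy_from M (lpol l) \<rho>. g s) = (1 - \<gamma>) * (LINT s|\<rho>. h s)"
proof -
  have \<rho>': "prob_space \<rho>" "sets \<rho> = sets borel" using \<rho> by (auto simp: space_prob_algebra)
  obtain C where C: "g \<in> borel_measurable borel" "\<And>x. \<bar>g x\<bar> \<le> C" "0 \<le> C" by (rule BbE[OF g]) blast
  have occ: "occupancy M (lpol l) \<in> \<rho> \<rightarrow>\<^sub>M prob_algebra borel"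
    using occupancy_measurable[OF l] by (simp add: measurable_cong_sets[OF \<rho>'(2) refl])
  have "(LINT s'|occupancy M (lpol l) s. g s') = (1 - \<gamma>) * h s" for s
  proof -
    note O = measurable_to_prob_algebraD[OF occupancy_measurable[OF l], of s, simplified]
    interpret prob_space "occupancy M (lpol l) s" by (rule O)
    have int: "integrable (occupancy M (lpol l) s) f" if f: "f \<in> Bb" for f
    proof -
      obtain C where C: "f \<in> borel_measurable borel" "\<And>x. \<bar>f x\<bar> \<le> C" "0 \<le> C" by (rule BbE[OF f]) blast
      show ?thesis by (rule integrable_bounded[OF _ C(2)]) (simp add: measurable_cong_sets[OF O(2) refl] C(1))
    qed
    have "(LINT s'|occupancy M (lpol l) s. g s')
        = (LINT s'|occupancy M (lpol l) s. h s' - \<gamma> * avg l (next_mean h) s')"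
      by (simp add: eq)
    also have "\<dots> = (LINT s'|occupancy M (lpol l) s. h s') - \<gamma> * (LINT s'|occupancy M (lpol l) s. avg l (next_mean h) s')"
      using int[OF h] int[OF avg_Bb[OF l next_mean_Bb[OF h]]] by simp
    finally show ?thesis using integral_occupancy_step[OF l h, of s] by simp
  qed
  then show ?thesis
    unfolding occupancy_from_def integral_bind_prob[OF \<rho>'(1) occ C(1,2)] by simp
qed

section \<open>Convergence of the flow of log-densities\<close>

text \<open>The bounds are linear in \<open>R\<close>, which yields the linear growth of the vector
  field and hence global existence.\<close>

lemma adv_bound:
  assumes l: "l \<in> normalised" and l_bound: "\<And>x. \<bar>l x\<bar> \<le> R" and c_bound: "\<And>x. \<bar>c x\<bar> \<le> C"
  shows "\<bar>val l s\<bar> \<le> (C + \<tau> * R) / (1 - \<gamma>)" "\<bar>adv l x\<bar> \<le> 2 * (C + \<tau> * R) / (1 - \<gamma>)"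
proof -
  have cl: "\<bar>c x + \<tau> * l x\<bar> \<le> C + \<tau> * R" for x
  proof -
    have "\<bar>\<tau> * l x\<bar> \<le> \<tau> * R" using l_bound[of x] \<tau> by (simp add: abs_mult)
    then show ?thesis using c_bound[of x] by linarith
  qed
  have cl_Bb: "(\<lambda>x. c x + \<tau> * l x) \<in> Bb" by (intro Bb_add Bb_cmult c_Bb normalised_Bb l)
  note V = val_Bb[OF l]
  have "val l s - \<gamma> * avg l (next_mean (val l)) s = avg l (\<lambda>x. c x + \<tau> * l x) s" for s
    using val_eq[OF l, of s] unfolding bellman_def
    by (simp add: avg_add[OF l cl_Bb Bb_cmult[OF next_mean_Bb[OF V]]] avg_cmult)
  then have "\<bar>val l s - \<gamma> * avg l (next_mean (val l)) s\<bar> \<le> C + \<tau> * R" for s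
    using avg_bound[OF l cl_Bb cl] by simp
  note V_bound = comparison_abs[OF l V this]
  show "\<bar>val l s\<bar> \<le> (C + \<tau> * R) / (1 - \<gamma>)" by (rule V_bound)
  define B where "B = (C + \<tau> * R) / (1 - \<gamma>)"
  have "\<bar>\<gamma> * next_mean (val l) x\<bar> \<le> \<gamma> * B"
    using mult_left_mono[OF next_mean_bound[OF V V_bound, folded B_def] \<gamma>(1), of x] \<gamma> by (simp add: abs_mult)
  moreover have "\<bar>val l (fst x)\<bar> \<le> B" unfolding B_def by (rule V_bound)
  ultimately have "\<bar>adv l x\<bar> \<le> C + \<tau> * R + \<gamma> * B + B"
    using cl[of x] unfolding adv_def by linarith
  also have "C + \<tau> * R = B * (1 - \<gamma>)" using \<gamma> by (simp add: B_def)
  also have "B * (1 - \<gamma>) + \<gamma> * B + B = 2 * B" by (simp add: algebra_simps)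
  finally show "\<bar>adv l x\<bar> \<le> 2 * (C + \<tau> * R) / (1 - \<gamma>)" by (simp add: B_def)
qed

text \<open>Of the two sources in the performance difference, \<open>adv k\<close> has mean zero
  under \<open>k\<close> and so contributes at most \<open>a\<close> times the distance of the
  policies, itself at most \<open>2 * d\<close>; the relative entropy contributes at most
  \<open>\<tau> * d\<close>.\<close>

lemma val_lipschitz:
  assumes l: "l \<in> normalised" and k: "k \<in> normalised"
    and d: "\<And>x. \<bar>l x - k x\<bar> \<le> d" and a: "\<And>x. \<bar>adv k x\<bar> \<le> a"
  shows "\<bar>val l s - val k s\<bar> \<le> (2 * a + \<tau>) * d / (1 - \<gamma>)"
proof (rule comparison_abs[OF l Bb_diff[OF val_Bb[OF l] val_Bb[OF k]]])
  fix s
  have "0 \<le> a" using a abs_ge_zero order_trans by blast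
  have "\<bar>avg l (adv k) s\<bar> \<le> a * l1_dist l k s"
    using avg_diff_le_l1_dist[OF normalised_Bb[OF l] normalised_Bb[OF k] adv_Bb[OF k] a, of s] avg_adv[OF k, of s] by simp
  also have "\<dots> \<le> a * (2 * d)"
    using l1_dist_le_sup[OF l k d] \<open>0 \<le> a\<close> by (rule mult_left_mono)
  finally have "\<bar>avg l (adv k) s\<bar> \<le> 2 * a * d" by simp
  moreover have "\<bar>\<tau> * avg l (\<lambda>x. l x - k x) s\<bar> \<le> \<tau> * d"
    using avg_bound[OF l Bb_diff[OF normalised_Bb[OF l] normalised_Bb[OF k]] d, of s] \<tau>
    by (simp add: abs_mult mult_left_mono)
  ultimately show "\<bar>val l s - val k s - \<gamma> * avg l (next_mean (\<lambda>s. val l s - val k s)) s\<bar> \<le> (2 * a + \<tau>) * d"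
    unfolding performance_difference[OF l k, of s] by (simp add: distrib_right abs_le_iff)
qed

lemma adv_lipschitz:
  assumes l: "l \<in> normalised" and k: "k \<in> normalised"
    and d: "\<And>x. \<bar>l x - k x\<bar> \<le> d" and a: "\<And>x. \<bar>adv k x\<bar> \<le> a"
  shows "\<bar>adv l x - adv k x\<bar> \<le> (2 * (2 * a + \<tau>) / (1 - \<gamma>) + \<tau>) * d"
proof -
  define V where "V = (2 * a + \<tau>) * d / (1 - \<gamma>)"
  have val: "\<bar>val l s - val k s\<bar> \<le> V" for s
    unfolding V_def by (rule val_lipschitz[OF l k d a])
  have "\<bar>next_mean (\<lambda>s. val l s - val k s) x\<bar> \<le> V"
    by (intro next_mean_bound Bb_diff val_Bb l k val)
  then have "\<bar>\<gamma> * next_mean (\<lambda>s. val l s - val k s) x\<bar> \<le> 1 * V"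
    unfolding abs_mult using \<gamma> by (intro mult_mono) auto
  then have "\<bar>\<gamma> * next_mean (val l) x - \<gamma> * next_mean (val k) x\<bar> \<le> V"
    by (simp add: next_mean_diff val_Bb l k right_diff_distrib)
  moreover have "\<bar>\<tau> * l x - \<tau> * k x\<bar> \<le> \<tau> * d"
    using mult_left_mono[OF d[of x], of \<tau>] \<tau> by (simp add: right_diff_distrib[symmetric] abs_mult)
  ultimately have "\<bar>adv l x - adv k x\<bar> \<le> V + \<tau> * d + V"
    using val[of "fst x"] unfolding adv_def by linarith
  then show ?thesis by (simp add: V_def algebra_simps add_divide_distrib)
qed

text \<open>Summing the two relative entropies shows that passing from \<open>k\<close> to \<open>l\<close> raises the mean of
  \<open>l - k\<close>, which to first order is a multiple of the advantage of \<open>k\<close>.\<close>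

lemma val_descent:
  assumes l: "l \<in> normalised" and k: "k \<in> normalised" and D: "0 < D" and e: "0 \<le> e" "e \<le> 1"
    and a: "\<And>x. \<bar>adv k x\<bar> \<le> a" and close: "\<And>x. \<bar>(l x - k x) - D * adv k x\<bar> \<le> e * D"
  shows "val k s - val l s \<le> D * (2 * e * (a + 1) / (1 - \<gamma>))"
proof -
  note Bb = normalised_Bb[OF l] normalised_Bb[OF k] adv_Bb[OF k]
  have lk: "(\<lambda>x. l x - k x) \<in> Bb" by (intro Bb_diff Bb)
  have lk_bound: "\<bar>l x - k x\<bar> \<le> D * (a + 1)" for x
  proof -
    have "\<bar>l x - k x\<bar> \<le> e * D + \<bar>D * adv k x\<bar>" using close[of x] by linarith
    also have "\<dots> \<le> 1 * D + D * a"
      using a[of x] e D by (intro add_mono mult_right_mono) (auto simp: abs_mult)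
    finally show ?thesis by (simp add: distrib_left)
  qed
  have "0 \<le> a" using a abs_ge_zero order_trans by blast
  have lower: "- (2 * e * (a + 1) * D) \<le> avg l (adv k) s" for s
  proof -
    define E where "E x = (l x - k x) - D * adv k x" for x
    have E: "E \<in> Bb" unfolding E_def[abs_def] by (intro Bb_diff Bb_cmult Bb)
    have "avg l (\<lambda>x. l x - k x) s - avg k (\<lambda>x. l x - k x) s
        = avg l (\<lambda>x. l x - k x) s + avg k (\<lambda>x. k x - l x) s"
      using k Bb by (simp add: avg_diff)
    then have "0 \<le> avg l (\<lambda>x. l x - k x) s - avg k (\<lambda>x. l x - k x) s"
      using kl_nonneg[OF l k, of s] kl_nonneg[OF k l, of s] by simp
    also have "avg l (\<lambda>x. l x - k x) s = avg l (\<lambda>x. D * adv k x + E x) s" by (simp add: E_def)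
    also have "avg k (\<lambda>x. l x - k x) s = avg k (\<lambda>x. D * adv k x + E x) s" by (simp add: E_def)
    finally have "0 \<le> D * avg l (adv k) s + (avg l E s - avg k E s)"
      using avg_adv[OF k, of s] by (simp add: avg_add[OF l Bb_cmult[OF Bb(3)] E] avg_add[OF k Bb_cmult[OF Bb(3)] E] avg_cmult)
    \<comment> \<open>Both the error \<open>E\<close> and the distance of the policies are of first
      order in \<open>D\<close>; after division by \<open>D\<close> a bound of order
      \<open>e * D\<close> remains.\<close>
    moreover have "avg l E s - avg k E s \<le> e * D * (2 * (D * (a + 1)))"
    proof -
      have "\<bar>avg l E s - avg k E s\<bar> \<le> e * D * l1_dist l k s"
        by (rule avg_diff_le_l1_dist[OF Bb(1,2) E]) (simp add: E_def close)
      also have "\<dots> \<le> e * D * (2 * (D * (a + 1)))"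
        using l1_dist_le_sup[OF l k lk_bound] e D by (intro mult_left_mono) auto
      finally show ?thesis by simp
    qed
    ultimately have "0 \<le> D * (avg l (adv k) s + 2 * e * (a + 1) * D)" by (simp add: algebra_simps)
    then show ?thesis using D by (simp add: zero_le_mult_iff)
  qed
  have "- (2 * e * (a + 1) * D) / (1 - \<gamma>) \<le> val l s - val k s"
  proof (rule comparison_ge[OF l Bb_diff[OF val_Bb[OF l] val_Bb[OF k]]])
    fix s
    \<comment> \<open>The relative entropy in the performance difference has the favourable sign and
      is dropped.\<close>
    have "0 \<le> \<tau> * avg l (\<lambda>x. l x - k x) s" using kl_nonneg[OF l k] \<tau> by simp
    then show "- (2 * e * (a + 1) * D) + \<gamma> * avg l (next_mean (\<lambda>s. val l s - val k s)) s \<le> val l s - val k s"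
      using lower[of s] performance_difference[OF l k, of s] by linarith
  qed
  then show ?thesis by (simp add: mult_ac)
qed

text \<open>The equation is imposed at positive times, as in \<open>log_density_flow\<close>;
  continuity connects it with the initial value.\<close>

definition lflow :: "(real \<Rightarrow> 's \<times> 'a \<Rightarrow> real) \<Rightarrow> bool" where
  "lflow l \<longleftrightarrow> (\<forall>t\<ge>0. l t \<in> normalised) \<and> continuous_on {0..} (\<lambda>t. Bm (l t)) \<and>
     (\<forall>t>0. ((\<lambda>r. Bm (l r)) has_vector_derivative Bm (\<lambda>x. - adv (l t) x)) (at t within {0..}))"

lemma lflow_val_continuous:
  assumes l: "lflow l"
  shows "continuous_on {0..} (\<lambda>t. val (l t) s)"
  unfolding continuous_on_def
proof
  fix t :: real assume t: "t \<in> {0..}"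
  have n: "l r \<in> normalised" if "0 \<le> r" for r using l that by (simp add: lflow_def)
  obtain a where a: "\<And>x. \<bar>adv (l t) x\<bar> \<le> a" by (rule BbE[OF adv_Bb[OF n[of t]]]) (use t in auto)
  have "((\<lambda>r. norm (Bm (l r) - Bm (l t))) \<longlongrightarrow> 0) (at t within {0..})"
    using l t by (auto simp: lflow_def continuous_on_def intro!: tendsto_norm_zero LIM_zero)
  then have lim: "((\<lambda>r. (2 * a + \<tau>) * norm (Bm (l r) - Bm (l t)) / (1 - \<gamma>)) \<longlongrightarrow> (2 * a + \<tau>) * 0 / (1 - \<gamma>)) (at t within {0..})"
    by (intro tendsto_intros) (use \<gamma> in auto)
  have "((\<lambda>r. val (l r) s - val (l t) s) \<longlongrightarrow> 0) (at t within {0..})"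
  proof (rule Lim_null_comparison)
    show "\<forall>\<^sub>F r in at t within {0..}. norm (val (l r) s - val (l t) s) \<le> (2 * a + \<tau>) * norm (Bm (l r) - Bm (l t)) / (1 - \<gamma>)"
    proof (rule eventually_at_within_nonneg)
      fix r :: real assume r: "0 \<le> r"
      have "\<bar>l r x - l t x\<bar> \<le> norm (Bm (l r) - Bm (l t))" for x
        using abs_bm_le_norm[of "Bm (l r) - Bm (l t)" x] n[OF r] n[of t] t by (simp add: Bm_inverse normalised_Bb)
      from val_lipschitz[OF n[OF r] n this a] show "norm (val (l r) s - val (l t) s) \<le> (2 * a + \<tau>) * norm (Bm (l r) - Bm (l t)) / (1 - \<gamma>)"
        using t by simp
    qed
  qed (use lim in simp)
  then show "((\<lambda>t. val (l t) s) \<longlongrightarrow> val (l t) s) (at t within {0..})" by (rule LIM_zero_cancel)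
qed

lemma sup_norm_quotient:
  assumes n: "\<And>r. 0 \<le> r \<Longrightarrow> l r \<in> normalised" and t: "0 \<le> t" and e: "0 < e"
    and deriv: "((\<lambda>r. Bm (l r)) has_vector_derivative Bm (\<lambda>x. - adv (l t) x)) (at t within {0..})"
  shows "\<forall>\<^sub>F r in at t within {0..}. \<forall>x. \<bar>(l r x - l t x) - (t - r) * adv (l t) x\<bar> \<le> e * \<bar>r - t\<bar>"
proof -
  have "((\<lambda>r. (Bm (l r) - Bm (l t)) /\<^sub>R (r - t) - Bm (\<lambda>x. - adv (l t) x)) \<longlongrightarrow> 0) (at t within {0..})"
    using deriv by (simp add: has_vector_derivative_iff_quotient)
  then have "\<forall>\<^sub>F r in at t within {0..}. norm ((Bm (l r) - Bm (l t)) /\<^sub>R (r - t) - Bm (\<lambda>x. - adv (l t) x)) < e"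
    using e by (auto simp: tendsto_iff)
  moreover have "\<forall>\<^sub>F r in at t within {0..}. 0 \<le> r \<and> r \<noteq> t" by (rule eventually_at_within_nonneg) auto
  ultimately show ?thesis
  proof eventually_elim
    case (elim r)
    show ?case
    proof
      fix x
      have "\<bar>bm ((Bm (l r) - Bm (l t)) /\<^sub>R (r - t) - Bm (\<lambda>x. - adv (l t) x)) x\<bar> \<le> e"
        using abs_bm_le_norm elim by (meson less_imp_le order_trans)
      then have "\<bar>(l r x - l t x) / (r - t) + adv (l t) x\<bar> \<le> e"
        using n[of r] n[of t] t elim
        by (simp add: Bm_inverse normalised_Bb Bb_uminus adv_Bb divide_inverse mult.commute)
      then have "\<bar>(l r x - l t x) / (r - t) + adv (l t) x\<bar> * \<bar>r - t\<bar> \<le> e * \<bar>r - t\<bar>"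
        by (rule mult_right_mono) simp
      moreover have "((l r x - l t x) / (r - t) + adv (l t) x) * (r - t) = (l r x - l t x) - (t - r) * adv (l t) x"
        using elim by (simp add: field_simps)
      ultimately show "\<bar>(l r x - l t x) - (t - r) * adv (l t) x\<bar> \<le> e * \<bar>r - t\<bar>"
        by (simp add: abs_mult[symmetric])
    qed
  qed
qed

text \<open>\<open>val_descent\<close> is applied with the later log-density as its base point
  \<open>k\<close>, where the derivative is expanded, and the earlier one as \<open>l\<close>. It
  bounds the left difference quotient by an arbitrarily small number, and the Dini lemma with
  \<open>L = 0\<close> concludes.\<close>

lemma lflow_val_decreasing:
  assumes l: "lflow l" and "0 \<le> r" "r \<le> t"
  shows "val (l t) s \<le> val (l r) s"
proof -
  have n: "l r \<in> normalised" if "0 \<le> r" for r using l that by (simp add: lflow_def)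
  have "val (l t) s - val (l r) s \<le> 0"
  proof (rule dini_gronwall[where g = "\<lambda>t. val (l t) s - val (l r) s" and a = r and T = t and L = 0])
    show "continuous_on {r..t} (\<lambda>t. val (l t) s - val (l r) s)"
      by (intro continuous_intros continuous_on_subset[OF lflow_val_continuous[OF l]]) (use assms in auto)
    fix u \<epsilon> :: real assume u: "r < u" "u \<le> t" and \<epsilon>: "0 < \<epsilon>"
    then have u0: "0 < u" using assms by simp
    obtain a where a: "\<And>x. \<bar>adv (l u) x\<bar> \<le> a" "0 \<le> a" by (rule BbE[OF adv_Bb[OF n[of u]]]) (use u0 in auto)
    \<comment> \<open>Chosen so that the factor \<open>2 * e * (a + 1) / (1 - \<gamma>)\<close> from
      \<open>val_descent\<close> is at most the given error; that lemma also asks for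
      \<open>e \<le> 1\<close>.\<close>
    define e where "e = min 1 (\<epsilon> * (1 - \<gamma>) / (2 * (a + 1)))"
    have e: "0 < e" "e \<le> 1" using \<epsilon> \<gamma> a by (auto simp: e_def)
    have "e \<le> \<epsilon> * (1 - \<gamma>) / (2 * (a + 1))" by (simp add: e_def)
    then have e': "2 * e * (a + 1) / (1 - \<gamma>) \<le> \<epsilon>" using \<gamma> a by (simp add: field_simps)
    have "at_left u \<le> at u within {0..}" using u0 by (intro at_left_le_at_within[of 0]) auto
    moreover have "((\<lambda>r. Bm (l r)) has_vector_derivative Bm (\<lambda>x. - adv (l u) x)) (at u within {0..})"
      using l u0 by (simp add: lflow_def)
    ultimately
    have "\<forall>\<^sub>F q in at_left u. \<forall>x. \<bar>(l q x - l u x) - (u - q) * adv (l u) x\<bar> \<le> e * \<bar>q - u\<bar>"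
      using u0 e(1) n by (intro filter_leD[OF _ sup_norm_quotient]) auto
    moreover have "\<forall>\<^sub>F q in at_left u. 0 < q \<and> q < u"
      using eventually_at_left_real[OF u0] by (rule eventually_mono) auto
    ultimately show "\<forall>\<^sub>F q in at_left u. (val (l u) s - val (l r) s) - (val (l q) s - val (l r) s)
        \<le> (u - q) * (0 * (val (l u) s - val (l r) s) + \<epsilon>)"
    proof eventually_elim
      case (elim q)
      have "val (l u) s - val (l q) s \<le> (u - q) * (2 * e * (a + 1) / (1 - \<gamma>))"
        using elim e a by (intro val_descent n) auto
      also have "\<dots> \<le> (u - q) * \<epsilon>" using e' elim by (intro mult_left_mono) auto
      finally show ?case by simp
    qed
  qed (use assms in auto)
  then show ?thesis by simp
qed

lemma lflow_normalised: "lflow l \<Longrightarrow> 0 \<le> t \<Longrightarrow> l t \<in> normalised"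
  by (simp add: lflow_def)

lemma lflow_convergence:
  assumes l: "lflow l" and \<rho>: "\<rho> \<in> space (prob_algebra borel)" and t: "0 < t"
  defines "N \<equiv> occupancy_from M (lpol lopt) \<rho>"
  shows "(LINT s|\<rho>. val (l t) s) - (LINT s|\<rho>. vopt s)
      \<le> \<tau> / ((1 - \<gamma>) * (exp (\<tau> * t) - 1)) * (LINT s|N. avg lopt (\<lambda>x. lopt x - l 0 x) s)"
    and "(LINT s|N. (l1_dist (l t) lopt s)\<^sup>2)
      \<le> 2 * exp (- \<tau> * t) * (LINT s|N. avg lopt (\<lambda>x. lopt x - l 0 x) s)"
proof -
  note n = lflow_normalised[OF l]
  note lo = lopt_normalised
  interpret N: prob_space N unfolding N_def by (rule occupancy_from_prob[OF lo \<rho>])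
  have sets_N: "sets N = sets borel" unfolding N_def by (rule occupancy_from_prob[OF lo \<rho>])
  have \<rho>': "prob_space \<rho>" "sets \<rho> = sets borel" using \<rho> by (auto simp: space_prob_algebra)
  interpret \<rho>: prob_space \<rho> by (rule \<rho>')
  have int_N: "integrable N f" if f: "f \<in> Bb" for f
  proof -
    obtain C where C: "f \<in> borel_measurable borel" "\<And>x. \<bar>f x\<bar> \<le> C" "0 \<le> C" by (rule BbE[OF f]) blast
    show ?thesis by (rule N.integrable_bounded[OF _ C(2)]) (simp add: measurable_cong_sets[OF sets_N refl] C(1))
  qed
  have int_\<rho>: "integrable \<rho> f" if f: "f \<in> Bb" for f
  proof -
    obtain C where C: "f \<in> borel_measurable borel" "\<And>x. \<bar>f x\<bar> \<le> C" "0 \<le> C" by (rule BbE[OF f]) blast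
    show ?thesis by (rule \<rho>.integrable_bounded[OF _ C(2)]) (simp add: measurable_cong_sets[OF \<rho>'(2) refl] C(1))
  qed
  \<comment> \<open>A bounded linear functional, the double mean under the optimal policy and its
    occupancy measure. The mean divergence \<open>y\<close> is its value at \<open>lopt - l\<close>,
    so it inherits the derivative of the path.\<close>
  define \<Phi> where "\<Phi> f = (LINT s|N. avg lopt (bm f) s)" for f
  have avg_plus: "avg lopt (bm (f + g)) = (\<lambda>s. avg lopt (bm f) s + avg lopt (bm g) s)" for f g
    by (rule ext) (simp add: plus_bmfun.rep_eq[abs_def] avg_add[OF lo bm bm])
  have avg_scale: "avg lopt (bm (r *\<^sub>R f)) = (\<lambda>s. r * avg lopt (bm f) s)" for f r
    by (rule ext) (simp add: scaleR_bmfun.rep_eq[abs_def] avg_cmult)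
  have lin: "bounded_linear \<Phi>"
  proof (rule bounded_linear_intro[where K = 1])
    show "\<Phi> (f + g) = \<Phi> f + \<Phi> g" for f g
      unfolding \<Phi>_def avg_plus by (intro Bochner_Integration.integral_add int_N avg_Bb lo bm)
    show "\<Phi> (r *\<^sub>R f) = r *\<^sub>R \<Phi> f" for r f
      unfolding \<Phi>_def avg_scale by simp
    show "norm (\<Phi> f) \<le> norm f * 1" for f
      unfolding \<Phi>_def using Bb_measurable[OF avg_Bb[OF lo bm[of f]]] avg_bound[OF lo bm abs_bm_le_norm, of f]
      by (simp add: N.integral_bounds measurable_cong_sets[OF sets_N refl])
  qed
  interpret \<Phi>: bounded_linear \<Phi> by (rule lin)
  define y where "y r = \<Phi> (Bm lopt - Bm (l r))" for r
  have y_eq: "y r = (LINT s|N. avg lopt (\<lambda>x. lopt x - l r x) s)" if "0 \<le> r" for r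
    unfolding y_def \<Phi>_def using n[OF that] lo
    by (simp add: minus_bmfun.rep_eq[abs_def] Bm_inverse normalised_Bb)
  have y_nonneg: "0 \<le> y r" if "0 \<le> r" for r
    unfolding y_eq[OF that] by (intro integral_nonneg_AE AE_I2 kl_nonneg lo n that)
  define \<delta> where "\<delta> r = (LINT s|\<rho>. val (l r) s) - (LINT s|\<rho>. vopt s)" for r
  have \<delta>_nonneg: "0 \<le> \<delta> r" if "0 \<le> r" for r
    unfolding \<delta>_def using integral_mono[OF int_\<rho>[OF vopt_Bb] int_\<rho>[OF val_Bb[OF n[OF that]]] vopt_le[OF n[OF that]]] by simp
  have \<delta>_mono: "\<delta> q \<le> \<delta> r" if "0 \<le> r" "r \<le> q" for q r
    unfolding \<delta>_def
    using integral_mono[OF int_\<rho>[OF val_Bb[OF n[of q]]] int_\<rho>[OF val_Bb[OF n[of r]]] lflow_val_decreasing[OF l that]] that by simp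
  \<comment> \<open>The performance difference of the optimal policy against \<open>l r\<close>,
    integrated over the occupancy measure of the optimal policy.\<close>
  have key: "\<Phi> (Bm (adv (l r))) = - (1 - \<gamma>) * \<delta> r - \<tau> * y r" if r: "0 \<le> r" for r
  proof -
    note nr = n[OF r]
    define g where "g s = avg lopt (adv (l r)) s + \<tau> * avg lopt (\<lambda>x. lopt x - l r x) s" for s
    have d: "(\<lambda>x. lopt x - l r x) \<in> Bb" by (intro Bb_diff normalised_Bb nr lo)
    have g: "g \<in> Bb" unfolding g_def[abs_def] by (intro Bb_add Bb_cmult avg_Bb lo adv_Bb nr d)
    have "(LINT s|N. g s) = (1 - \<gamma>) * (LINT s|\<rho>. vopt s - val (l r) s)"
      unfolding N_def
    proof (rule integral_occupancy_from[OF lo \<rho> _ g])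
      show "(\<lambda>s. vopt s - val (l r) s) \<in> Bb" by (intro Bb_diff vopt_Bb val_Bb nr)
      show "vopt s - val (l r) s = g s + \<gamma> * avg lopt (next_mean (\<lambda>s. vopt s - val (l r) s)) s" for s
        using performance_difference[OF lo nr, of s] by (simp add: g_def val_lopt)
    qed
    moreover have "(LINT s|N. g s) = (LINT s|N. avg lopt (adv (l r)) s) + \<tau> * y r"
      unfolding g_def y_eq[OF r] using int_N[OF avg_Bb[OF lo adv_Bb[OF nr]]] int_N[OF avg_Bb[OF lo d]] by simp
    moreover have "(LINT s|\<rho>. vopt s - val (l r) s) = - \<delta> r"
      unfolding \<delta>_def using int_\<rho>[OF vopt_Bb] int_\<rho>[OF val_Bb[OF nr]] by simp
    ultimately have "(LINT s|N. avg lopt (adv (l r)) s) = (1 - \<gamma>) * (- \<delta> r) - \<tau> * y r" by simp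
    then show ?thesis by (simp add: \<Phi>_def Bm_inverse adv_Bb[OF nr] algebra_simps)
  qed
  have y_deriv: "(y has_real_derivative - (1 - \<gamma>) * \<delta> r - \<tau> * y r) (at r)" if r: "0 < r" for r
  proof -
    have "((\<lambda>r. Bm lopt - Bm (l r)) has_vector_derivative 0 - Bm (\<lambda>x. - adv (l r) x)) (at r within {0..})"
      using l r by (intro has_vector_derivative_diff has_vector_derivative_const) (simp add: lflow_def)
    from \<Phi>.has_vector_derivative[OF this]
    have "(y has_vector_derivative \<Phi> (0 - Bm (\<lambda>x. - adv (l r) x))) (at r within {0..})"
      unfolding y_def[abs_def] .
    moreover have "0 - Bm (\<lambda>x. - adv (l r) x) = Bm (adv (l r))"
      using adv_Bb[OF n[of r]] r by (intro bm_inject_ext) (simp add: Bm_inverse Bb_uminus)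
    moreover have "at r within {0..} = at r" using r by (intro at_within_interior) simp
    ultimately show ?thesis
      using key[of r] r by (simp add: has_real_derivative_iff_has_vector_derivative)
  qed
  have y_cont: "continuous_on {0..t} y"
  proof -
    have "continuous_on {0..} (\<lambda>r. Bm (l r))" using l by (simp add: lflow_def)
    then have "continuous_on {0..t} (\<lambda>r. Bm (l r))" by (rule continuous_on_subset) auto
    from \<Phi>.continuous_on[OF continuous_on_diff[OF continuous_on_const this]]
    show ?thesis unfolding y_def[abs_def] .
  qed
  note g = \<gamma> \<tau>
  \<comment> \<open>The integrating factor \<open>exp (\<tau> * r)\<close>, with
    \<open>\<delta>\<close> replaced by a constant lower bound. The choice
    \<open>d = \<delta> t\<close> together with \<open>y t \<ge> 0\<close> gives the bound on
    values, the choice \<open>d = 0\<close> the exponential decay of \<open>y\<close>.\<close>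
  have u: "exp (\<tau> * t) * y t + (1 - \<gamma>) * d * (exp (\<tau> * t) - 1) / \<tau> \<le> y 0"
    if d: "\<And>r. 0 < r \<Longrightarrow> r < t \<Longrightarrow> d \<le> \<delta> r" for d
  proof -
    define u where "u r = exp (\<tau> * r) * y r + (1 - \<gamma>) * d * (exp (\<tau> * r) - 1) / \<tau>" for r
    have "u t \<le> u 0"
    proof (rule DERIV_nonpos_imp_decreasing_open[where f = u and a = 0 and b = t])
      show "0 \<le> t" using t by simp
      show "continuous_on {0..t} u" unfolding u_def[abs_def] using g by (intro continuous_intros y_cont) auto
      fix r assume r: "0 < r" "r < t"
      have "(u has_real_derivative (1 - \<gamma>) * exp (\<tau> * r) * (d - \<delta> r)) (at r)"
        unfolding u_def[abs_def] using g
        by (auto intro!: derivative_eq_intros y_deriv[OF r(1)] simp: field_simps)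
      moreover have "(1 - \<gamma>) * exp (\<tau> * r) * (d - \<delta> r) \<le> 0"
        using g d[OF r] by (intro mult_nonneg_nonpos) auto
      ultimately show "\<exists>D. DERIV u r :> D \<and> D \<le> 0" by blast
    qed
    then show ?thesis by (simp add: u_def)
  qed
  have pos: "0 < exp (\<tau> * t) - 1" using g t by simp
  have "(1 - \<gamma>) * \<delta> t * (exp (\<tau> * t) - 1) / \<tau> \<le> y 0"
  proof -
    have "exp (\<tau> * t) * y t + (1 - \<gamma>) * \<delta> t * (exp (\<tau> * t) - 1) / \<tau> \<le> y 0"
      by (rule u) (simp add: \<delta>_mono)
    moreover have "0 \<le> exp (\<tau> * t) * y t" using y_nonneg[of t] t by simp
    ultimately show ?thesis by linarith
  qed
  then have "\<delta> t * ((1 - \<gamma>) * (exp (\<tau> * t) - 1)) \<le> \<tau> * y 0"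
    using g by (simp add: pos_divide_le_eq mult_ac)
  then have "\<delta> t \<le> \<tau> * y 0 / ((1 - \<gamma>) * (exp (\<tau> * t) - 1))"
    using pos g by (simp add: pos_le_divide_eq)
  then show "(LINT s|\<rho>. val (l t) s) - (LINT s|\<rho>. vopt s)
      \<le> \<tau> / ((1 - \<gamma>) * (exp (\<tau> * t) - 1)) * (LINT s|N. avg lopt (\<lambda>x. lopt x - l 0 x) s)"
    by (simp add: \<delta>_def y_eq)
  have "exp (\<tau> * t) * y t \<le> y 0" using u[of 0] \<delta>_nonneg by simp
  then have yt: "y t \<le> exp (- \<tau> * t) * y 0"
    by (simp add: exp_minus field_simps)
  have nt: "l t \<in> normalised" using n t by simp
  have d: "(\<lambda>x. lopt x - l t x) \<in> Bb" by (intro Bb_diff normalised_Bb nt lo)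
  have l1: "l1_dist (l t) lopt \<in> Bb" by (intro l1_dist_Bb normalised_Bb nt lo)
  \<comment> \<open>Pinsker is used for the divergence of the optimal policy from the current one,
    which is what \<open>y\<close> averages; the distance itself is symmetric.\<close>
  have "(LINT s|N. (l1_dist (l t) lopt s)\<^sup>2) \<le> (LINT s|N. 2 * avg lopt (\<lambda>x. lopt x - l t x) s)"
  proof (rule integral_mono)
    show "integrable N (\<lambda>s. (l1_dist (l t) lopt s)\<^sup>2)"
      unfolding power2_eq_square by (intro int_N Bb_mult l1)
    show "integrable N (\<lambda>s. 2 * avg lopt (\<lambda>x. lopt x - l t x) s)"
      by (intro integrable_mult_right int_N avg_Bb lo d)
    show "(l1_dist (l t) lopt s)\<^sup>2 \<le> 2 * avg lopt (\<lambda>x. lopt x - l t x) s" for s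
      using l1_dist_pinsker[OF lo nt, of s] by (simp add: l1_dist_commute)
  qed
  also have "\<dots> = 2 * y t" using y_eq[of t] t by simp
  also have "\<dots> \<le> 2 * exp (- \<tau> * t) * y 0" using yt by simp
  finally show "(LINT s|N. (l1_dist (l t) lopt s)\<^sup>2)
      \<le> 2 * exp (- \<tau> * t) * (LINT s|N. avg lopt (\<lambda>x. lopt x - l 0 x) s)"
    by (simp add: y_eq)
qed

section \<open>Existence of the flow of log-densities\<close>

definition nrm_bm :: "('s \<times> 'a) bmfun \<Rightarrow> ('s \<times> 'a) bmfun" where
  "nrm_bm f = Bm (nrm (bm f))"

text \<open>The differential of normalisation: the log-partition function has as derivative the mean
  under the Gibbs policy.\<close>

definition centre_bm :: "('s \<times> 'a \<Rightarrow> real) \<Rightarrow> ('s \<times> 'a) bmfun \<Rightarrow> ('s \<times> 'a) bmfun" where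
  "centre_bm l f = Bm (\<lambda>x. bm f x - avg l (bm f) (fst x))"

lemma bm_nrm_bm: "bm (nrm_bm f) = nrm (bm f)"
  unfolding nrm_bm_def by (rule Bm_inverse[OF normalised_Bb[OF nrm_normalised[OF bm]]])

lemma bm_centre_bm: "l \<in> normalised \<Longrightarrow> bm (centre_bm l f) x = bm f x - avg l (bm f) (fst x)"
  unfolding centre_bm_def by (subst Bm_inverse) (auto intro!: Bb_diff bm Bb_fst avg_Bb)

lemma nrm_lipschitz: "\<bar>nrm (bm f) x - nrm (bm g) x\<bar> \<le> 2 * norm (f - g)"
proof -
  have d: "\<bar>bm f x - bm g x\<bar> \<le> norm (f - g)" for x using abs_bm_le_norm[of "f - g" x] by simp
  from lse_diff_le[OF bm bm d, of "fst x"] d[of x] show ?thesis by (simp add: nrm_def)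
qed

lemma bounded_linear_centre_bm: assumes l: "l \<in> normalised" shows "bounded_linear (centre_bm l)"
proof (rule bounded_linear_intro[where K = 2])
  show "centre_bm l (f + g) = centre_bm l f + centre_bm l g" for f g
    by (rule bm_inject_ext)
      (simp add: bm_centre_bm[OF l] plus_bmfun.rep_eq[abs_def] avg_add[OF l bm bm])
  show "centre_bm l (r *\<^sub>R f) = r *\<^sub>R centre_bm l f" for r f
    by (rule bm_inject_ext)
      (simp add: bm_centre_bm[OF l] scaleR_bmfun.rep_eq[abs_def] avg_cmult right_diff_distrib)
  show "norm (centre_bm l f) \<le> norm f * 2" for f
  proof (rule norm_bm_leI)
    fix x
    show "\<bar>bm (centre_bm l f) x\<bar> \<le> norm f * 2"
      using abs_bm_le_norm[of f x] avg_bound[OF l bm abs_bm_le_norm, of f "fst x"]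
      unfolding bm_centre_bm[OF l] by linarith
  qed
qed

text \<open>Convexity of the log-sum-exp, in the form of nonnegativity of both relative entropies between
  the two Gibbs policies, bounds the linearisation error quadratically.\<close>

lemma nrm_bm_has_derivative: "(nrm_bm has_derivative centre_bm (nrm (bm f))) (at f within S)"
proof (rule has_derivativeI_sandwich[where e = 1])
  have l: "nrm (bm f) \<in> normalised" for f by (rule nrm_normalised[OF bm])
  show "bounded_linear (centre_bm (nrm (bm f)))" by (rule bounded_linear_centre_bm[OF l])
  show "((\<lambda>g. 4 * norm (g - f)) \<longlongrightarrow> 0) (at f within S)"
    using tendsto_mult_right_zero[OF tendsto_norm_zero[OF LIM_zero[OF tendsto_ident_at]]] .
  fix g assume "g \<noteq> f"
  have "norm (nrm_bm g - nrm_bm f - centre_bm (nrm (bm f)) (g - f)) \<le> 4 * norm (g - f) * norm (g - f)"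
  proof (rule norm_bm_leI)
    fix x :: "'s \<times> 'a"
    define s where "s = fst x"
    define d where "d x = bm g x - bm f x" for x
    have d: "d \<in> Bb" unfolding d_def[abs_def] by (intro Bb_diff bm)
    have d_bound: "\<bar>d x\<bar> \<le> norm (g - f)" for x using abs_bm_le_norm[of "g - f" x] by (simp add: d_def)
    define A where "A = lse (bm g) s - lse (bm f) s"
    \<comment> \<open>\<open>A\<close> is caught between the means of \<open>d\<close> under the two
      Gibbs policies, and these differ by a term quadratic in \<open>norm (g - f)\<close>.\<close>
    have lower: "avg (nrm (bm f)) d s \<le> A"
    proof -
      have "avg (nrm (bm f)) (\<lambda>x. nrm (bm f) x - nrm (bm g) x) s
          = avg (nrm (bm f)) (\<lambda>x. (lse (bm g) (fst x) - lse (bm f) (fst x)) - d x) s"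
        by (simp add: nrm_def d_def algebra_simps)
      also have "\<dots> = avg (nrm (bm f)) (\<lambda>x. lse (bm g) (fst x) - lse (bm f) (fst x)) s - avg (nrm (bm f)) d s"
        by (intro avg_diff l d Bb_diff Bb_fst lse_Bb bm)
      also have "\<dots> = A - avg (nrm (bm f)) d s"
        using avg_state[OF l, of f "\<lambda>s. lse (bm g) s - lse (bm f) s" s] by (simp add: A_def)
      finally show ?thesis using kl_nonneg[OF l l, of f g s] by simp
    qed
    have upper: "A \<le> avg (nrm (bm g)) d s"
    proof -
      have "avg (nrm (bm g)) (\<lambda>x. nrm (bm g) x - nrm (bm f) x) s
          = avg (nrm (bm g)) (\<lambda>x. d x - (lse (bm g) (fst x) - lse (bm f) (fst x))) s"
        by (simp add: nrm_def d_def algebra_simps)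
      also have "\<dots> = avg (nrm (bm g)) d s - avg (nrm (bm g)) (\<lambda>x. lse (bm g) (fst x) - lse (bm f) (fst x)) s"
        by (intro avg_diff l d Bb_diff Bb_fst lse_Bb bm)
      also have "\<dots> = avg (nrm (bm g)) d s - A"
        using avg_state[OF l, of g "\<lambda>s. lse (bm g) s - lse (bm f) s" s] by (simp add: A_def)
      finally show ?thesis using kl_nonneg[OF l l, of g f s] by simp
    qed
    have "\<bar>avg (nrm (bm g)) d s - avg (nrm (bm f)) d s\<bar> \<le> norm (g - f) * l1_dist (nrm (bm g)) (nrm (bm f)) s"
      by (intro avg_diff_le_l1_dist normalised_Bb l d d_bound)
    also have "\<dots> \<le> norm (g - f) * (2 * (2 * norm (g - f)))"
      by (intro mult_left_mono l1_dist_le_sup l nrm_lipschitz) simp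
    finally have "\<bar>A - avg (nrm (bm f)) d s\<bar> \<le> 4 * norm (g - f) * norm (g - f)"
      using lower upper by (simp add: abs_le_iff)
    moreover have "bm (nrm_bm g - nrm_bm f - centre_bm (nrm (bm f)) (g - f)) x = - (A - avg (nrm (bm f)) d s)"
      by (simp add: bm_nrm_bm bm_centre_bm[OF l] nrm_def A_def s_def d_def[abs_def] minus_bmfun.rep_eq[abs_def])
    ultimately show "\<bar>bm (nrm_bm g - nrm_bm f - centre_bm (nrm (bm f)) (g - f)) x\<bar> \<le> 4 * norm (g - f) * norm (g - f)"
      by simp
  qed
  then show "norm ((nrm_bm g - nrm_bm f) - centre_bm (nrm (bm f)) (g - f)) / norm (g - f) \<le> 4 * norm (g - f)"
    using \<open>g \<noteq> f\<close> by (simp add: pos_divide_le_eq)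
qed simp

text \<open>The right-hand side for \<open>Z\<close>, split into the advantage of its policy and a
  term depending on the state alone. The second moves the normalising constant but not the
  policy.\<close>

definition zfield :: "('s \<times> 'a \<Rightarrow> real) \<Rightarrow> 's \<times> 'a \<Rightarrow> real" where
  "zfield Z x = - (adv (nrm Z) x + \<tau> * lse Z (fst x))"

lemma zfield_eq:
  assumes Z: "Z \<in> Bb"
  shows "(\<lambda>(s, a). - (Q_pol M (gibbs M Z) (s, a) + \<tau> * Z (s, a) - real_of_ereal (V_pol M (gibbs M Z) s))) = zfield Z"
proof
  fix x
  show "(\<lambda>(s, a). - (Q_pol M (gibbs M Z) (s, a) + \<tau> * Z (s, a) - real_of_ereal (V_pol M (gibbs M Z) s))) x = zfield Z x"
    using nrm_normalised[OF Z]
    by (cases x) (simp add: gibbs_eq_lpol[OF Z] Q_pol_lpol V_pol_lpol zfield_def adv_def nrm_def[of Z] algebra_simps)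
qed

lemma zfield_Bb: "Z \<in> Bb \<Longrightarrow> zfield Z \<in> Bb"
  unfolding zfield_def[abs_def]
  by (intro Bb_uminus Bb_add Bb_cmult adv_Bb nrm_normalised Bb_fst lse_Bb)

lemma C1_path_continuous:
  assumes "C1_path Bb sup_norm z"
  shows "continuous_on {0..} (\<lambda>t. Bm (z t))"
  unfolding continuous_on_eq_continuous_within
proof
  fix t :: real assume t: "t \<in> {0..}"
  obtain z' where "has_path_derivative Bb sup_norm z (z' t) t" "\<And>r. 0 \<le> r \<Longrightarrow> z r \<in> Bb"
    using assms t unfolding C1_path_def by auto
  then have "((\<lambda>r. Bm (z r)) has_vector_derivative Bm (z' t)) (at t within {0..})"
    using sup_norm_path_derivative_iff[of z t "z' t"] t by simp
  then show "continuous (at t within {0..}) (\<lambda>t. Bm (z t))"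
    by (rule has_vector_derivative_continuous)
qed

text \<open>Chain rule: the differential of normalisation subtracts the mean under the policy, which
  removes the state term of \<open>zfield\<close> and leaves the advantage, whose mean is
  zero.\<close>

lemma nrm_path_derivative:
  assumes Bb: "\<And>t. 0 \<le> t \<Longrightarrow> Z t \<in> Bb" and t: "0 \<le> t"
    and deriv: "has_path_derivative Bb sup_norm Z (zfield (Z t)) t"
  shows "((\<lambda>r. Bm (nrm (Z r))) has_vector_derivative Bm (\<lambda>x. - adv (nrm (Z t)) x)) (at t within {0..})"
proof -
  have bm_Z: "bm (Bm (Z t)) = Z t" if "0 \<le> t" for t by (rule Bm_inverse[OF Bb[OF that]])
  let ?l = "nrm (Z t)"
  have l: "?l \<in> normalised" by (rule nrm_normalised[OF Bb[OF t]])
  have "((\<lambda>r. Bm (Z r)) has_vector_derivative Bm (zfield (Z t))) (at t within {0..})"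
    using sup_norm_path_derivative_iff[OF Bb t, where z' = "zfield (Z t)"] deriv by simp
  from vector_derivative_diff_chain_within[OF this nrm_bm_has_derivative]
  have "((\<lambda>r. nrm_bm (Bm (Z r))) has_vector_derivative centre_bm ?l (Bm (zfield (Z t)))) (at t within {0..})"
    by (simp add: o_def bm_Z[OF t])
  moreover have "centre_bm ?l (Bm (zfield (Z t))) = Bm (\<lambda>x. - adv ?l x)"
  proof (rule bm_inject_ext)
    fix x
    have Bb': "(\<lambda>x. - adv ?l x) \<in> Bb" "(\<lambda>x :: 's \<times> 'a. \<tau> * lse (Z t) (fst x)) \<in> Bb"
      by (intro Bb_uminus adv_Bb l Bb_cmult Bb_fst lse_Bb Bb[OF t])+
    have "zfield (Z t) = (\<lambda>x. - adv ?l x - \<tau> * lse (Z t) (fst x))"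
      by (rule ext) (simp add: zfield_def)
    then have "avg ?l (zfield (Z t)) s = avg ?l (\<lambda>x. - adv ?l x) s - avg ?l (\<lambda>x. \<tau> * lse (Z t) (fst x)) s" for s
      using avg_diff[OF l Bb'] by simp
    moreover have "avg ?l (\<lambda>x. - adv ?l x) s = 0" for s
      using avg_cmult[of ?l "- 1" "adv ?l" s] avg_adv[OF l, of s] by simp
    moreover have "avg ?l (\<lambda>x. \<tau> * lse (Z t) (fst x)) s = \<tau> * lse (Z t) s" for s
      using avg_state[OF l, of "\<lambda>s. \<tau> * lse (Z t) s"] by simp
    ultimately show "bm (centre_bm ?l (Bm (zfield (Z t)))) x = bm (Bm (\<lambda>x. - adv ?l x)) x"
      unfolding bm_centre_bm[OF l] by (simp add: Bm_inverse zfield_Bb Bb[OF t] Bb'(1)) (simp add: zfield_def)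
  qed
  ultimately have "((\<lambda>r. nrm_bm (Bm (Z r))) has_vector_derivative Bm (\<lambda>x. - adv ?l x)) (at t within {0..})" by simp
  then show ?thesis
    by (rule has_vector_derivative_transform[rotated 2]) (use t in \<open>auto simp: nrm_bm_def bm_Z\<close>)
qed

lemma log_density_flow_lflow:
  assumes Z: "log_density_flow M Z"
  shows "lflow (\<lambda>t. nrm (Z t))"
proof -
  have Bb: "Z t \<in> Bb" if "0 \<le> t" for t using Z that by (auto simp: log_density_flow_def C1_path_def)
  have cont: "continuous_on {0..} (\<lambda>t. Bm (Z t))"
    using Z by (intro C1_path_continuous) (simp add: log_density_flow_def)
  have "continuous_on UNIV nrm_bm"
    by (rule has_derivative_continuous_on[OF nrm_bm_has_derivative])
  from continuous_on_compose2[OF this cont] have "continuous_on {0..} (\<lambda>t. nrm_bm (Bm (Z t)))" by simp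
  then have "continuous_on {0..} (\<lambda>t. Bm (nrm (Z t)))"
    by (rule continuous_on_eq) (simp add: nrm_bm_def Bm_inverse Bb)
  moreover have "((\<lambda>r. Bm (nrm (Z r))) has_vector_derivative Bm (\<lambda>x. - adv (nrm (Z t)) x)) (at t within {0..})"
    if t: "0 < t" for t
  proof (rule nrm_path_derivative[OF Bb])
    show "has_path_derivative Bb sup_norm Z (zfield (Z t)) t"
      using Z t unfolding log_density_flow_def by (subst zfield_eq[OF Bb, symmetric]) auto
  qed (use t in auto)
  ultimately show ?thesis
    unfolding lflow_def using nrm_normalised[OF Bb] by blast
qed

text \<open>The last conclusion includes time 0; the one-sided derivative there is what makes the
  associated policies a \<open>C1_path\<close> from the start.\<close>

lemma log_density_flow_exists:
  assumes Z0: "Z0 \<in> Bb"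
  obtains Z where "log_density_flow M Z" "Z 0 = Z0"
    "\<And>t. 0 \<le> t \<Longrightarrow> has_path_derivative Bb sup_norm Z (zfield (Z t)) t"
proof -
  obtain C where C: "c \<in> borel_measurable borel" "\<And>x. \<bar>c x\<bar> \<le> C" "0 \<le> C" by (rule BbE[OF c_Bb]) blast
  define F where "F f = Bm (zfield (bm f))" for f
  have bm_F: "bm (F f) = zfield (bm f)" for f
    unfolding F_def by (rule Bm_inverse[OF zfield_Bb[OF bm]])
  have n: "nrm (bm f) \<in> normalised" for f by (rule nrm_normalised[OF bm])
  have lse_norm: "\<bar>lse (bm f) s\<bar> \<le> norm f" for f s by (rule lse_bound[OF bm abs_bm_le_norm])
  have nrm_norm: "\<bar>nrm (bm f) x\<bar> \<le> 2 * norm f" for f x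
    using abs_bm_le_norm[of f x] lse_norm[of f "fst x"] unfolding nrm_def by linarith
  \<comment> \<open>\<open>adv_bound\<close> with radius \<open>2 * norm f\<close> gives the
    numerator \<open>C + 2 * \<tau> * norm f\<close>, which is at most
    \<open>(C + 2 * \<tau>) * (1 + norm f)\<close>.\<close>
  define a0 where "a0 = 2 * (C + \<tau> * 2) / (1 - \<gamma>)"
  have a0: "0 \<le> a0" using C \<tau> \<gamma> by (simp add: a0_def)
  have adv_norm: "\<bar>adv (nrm (bm f)) x\<bar> \<le> a0 * (1 + norm f)" for f x
  proof -
    have "\<bar>adv (nrm (bm f)) x\<bar> \<le> 2 * (C + \<tau> * (2 * norm f)) / (1 - \<gamma>)"
      by (rule adv_bound[OF n nrm_norm C(2)])
    also have "\<dots> \<le> 2 * ((C + \<tau> * 2) * (1 + norm f)) / (1 - \<gamma>)"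
      using \<gamma> \<tau> C by (intro divide_right_mono mult_left_mono) (auto simp: algebra_simps)
    finally show ?thesis by (simp only: a0_def mult.assoc times_divide_eq_left)
  qed
  have growth: "norm (F f) \<le> (a0 + \<tau>) * (1 + norm f)" for f
  proof (rule norm_bm_leI)
    fix x
    have "\<bar>bm (F f) x\<bar> \<le> \<bar>adv (nrm (bm f)) x\<bar> + \<tau> * \<bar>lse (bm f) (fst x)\<bar>"
      unfolding bm_F zfield_def using \<tau> abs_triangle_ineq[of "adv (nrm (bm f)) x" "\<tau> * lse (bm f) (fst x)"]
      by (simp add: abs_mult)
    also have "\<dots> \<le> a0 * (1 + norm f) + \<tau> * (1 + norm f)"
      using adv_norm[of f x] lse_norm[of f "fst x"] \<tau> by (intro add_mono mult_left_mono) auto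
    finally show "\<bar>bm (F f) x\<bar> \<le> (a0 + \<tau>) * (1 + norm f)" by (simp add: distrib_right)
  qed
  \<comment> \<open>Twice the constant of \<open>adv_lipschitz\<close>, since normalisation is
    2-Lipschitz, plus \<open>\<tau>\<close> for the log-partition function.\<close>
  define K where "K = 4 * (2 * a0 + \<tau>) / (1 - \<gamma>) + 3 * \<tau>"
  have lip: "norm (F f - F g) \<le> K * (1 + max (norm f) (norm g)) * norm (f - g)" for f g
  proof (rule norm_bm_leI)
    fix x
    define m where "m = 1 + max (norm f) (norm g)"
    have m: "1 \<le> m" "1 + norm g \<le> m" by (auto simp: m_def le_max_iff_disj)
    define d where "d = norm (f - g)"
    have d: "0 \<le> d" by (simp add: d_def)
    have adv_m: "\<bar>adv (nrm (bm g)) x\<bar> \<le> a0 * m" for x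
      using adv_norm[of g x] mult_left_mono[OF m(2) a0] by linarith
    have adv: "\<bar>adv (nrm (bm f)) x - adv (nrm (bm g)) x\<bar> \<le> (2 * (2 * (a0 * m) + \<tau>) / (1 - \<gamma>) + \<tau>) * (2 * d)"
      unfolding d_def by (rule adv_lipschitz[OF n n nrm_lipschitz adv_m])
    have lse: "\<bar>\<tau> * lse (bm f) (fst x) - \<tau> * lse (bm g) (fst x)\<bar> \<le> \<tau> * d"
    proof -
      have "\<bar>bm f x - bm g x\<bar> \<le> d" for x using abs_bm_le_norm[of "f - g" x] by (simp add: d_def)
      from mult_left_mono[OF lse_diff_le[OF bm bm this, of "fst x"], of \<tau>] \<tau> show ?thesis
        by (simp add: right_diff_distrib[symmetric] abs_mult)
    qed
    have "\<bar>bm (F f - F g) x\<bar> \<le> (2 * (2 * (a0 * m) + \<tau>) / (1 - \<gamma>) + \<tau>) * (2 * d) + \<tau> * d"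
      using adv lse unfolding bm_simps bm_F zfield_def by linarith
    also have "\<dots> = d * (4 * (2 * (a0 * m) + \<tau> * 1) / (1 - \<gamma>) + 3 * \<tau> * 1)"
      by (simp add: algebra_simps)
    also have "\<dots> \<le> d * (4 * (2 * (a0 * m) + \<tau> * m) / (1 - \<gamma>) + 3 * \<tau> * m)"
      using m d \<tau> \<gamma> a0 by (intro mult_left_mono add_mono divide_right_mono) auto
    also have "\<dots> = K * m * d" by (simp add: K_def algebra_simps add_divide_distrib)
    finally show "\<bar>bm (F f - F g) x\<bar> \<le> K * (1 + max (norm f) (norm g)) * norm (f - g)"
      by (simp add: m_def d_def)
  qed
  obtain x where x0: "x 0 = Bm Z0" and x: "\<And>t. 0 \<le> t \<Longrightarrow> (x has_vector_derivative F (x t)) (at t within {0..})"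
    using global_solution[OF growth lip, of "Bm Z0"] by blast
  define Z where "Z t = bm (x t)" for t
  have Bb: "Z t \<in> Bb" for t by (simp add: Z_def bm)
  have deriv: "has_path_derivative Bb sup_norm Z (zfield (Z t)) t" if t: "0 \<le> t" for t
    using sup_norm_path_derivative_iff[of Z t "zfield (Z t)"] Bb t x[OF t] zfield_Bb[OF Bb[of t]]
    by (simp add: Z_def bm_inverse F_def)
  have deriv_cont: "((\<lambda>r. sup_norm (\<lambda>y. zfield (Z r) y - zfield (Z t) y)) \<longlongrightarrow> 0) (at t within {0..})" if t: "0 \<le> t" for t
  proof -
    have x_lim: "(x \<longlongrightarrow> x t) (at t within {0..})"
      using has_vector_derivative_continuous[OF x[OF t]] by (simp add: continuous_within)
    have "((\<lambda>r. K * (1 + max (norm (x r)) (norm (x t))) * norm (x r - x t))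
        \<longlongrightarrow> K * (1 + max (norm (x t)) (norm (x t))) * norm (x t - x t)) (at t within {0..})"
      by (intro tendsto_mult tendsto_const tendsto_add tendsto_max tendsto_norm tendsto_diff x_lim)
    then have lim: "((\<lambda>r. K * (1 + max (norm (x r)) (norm (x t))) * norm (x r - x t)) \<longlongrightarrow> 0) (at t within {0..})"
      by simp
    have "((\<lambda>r. F (x r) - F (x t)) \<longlongrightarrow> 0) (at t within {0..})"
      by (rule Lim_null_comparison[OF always_eventually lim]) (simp add: lip)
    then have "((\<lambda>r. Bm (zfield (Z r))) \<longlongrightarrow> Bm (zfield (Z t))) (at t within {0..})"
      unfolding F_def Z_def by (rule LIM_zero_cancel)
    then show ?thesis using sup_norm_tendsto_iff[of "\<lambda>r. zfield (Z r)" t] zfield_Bb[OF Bb] t by simp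
  qed
  have "C1_path Bb sup_norm Z"
    unfolding C1_path_def
    by (intro conjI allI impI exI[of _ "\<lambda>t. zfield (Z t)"] Bb deriv deriv_cont)
  then have "log_density_flow M Z"
    unfolding log_density_flow_def zfield_eq[OF Bb] using deriv by simp
  moreover have "Z 0 = Z0" by (simp add: Z_def x0 Bm_inverse Z0)
  ultimately show ?thesis using deriv by (rule that)
qed

lemma ext_integral_Bb:
  assumes "prob_space N" "sets N = sets borel" "f \<in> Bb"
  shows "ext_integral N (\<lambda>s. ereal (f s)) = ereal (LINT s|N. f s)"
proof -
  interpret prob_space N by fact
  obtain C where C: "f \<in> borel_measurable borel" "\<And>x. \<bar>f x\<bar> \<le> C" "0 \<le> C" by (rule BbE[OF assms(3)]) blast
  show ?thesis
    by (rule ext_integral_ereal, rule integrable_bounded[OF _ C(2)])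
      (simp add: measurable_cong_sets[OF assms(2) refl] C(1))
qed

lemma log_density_flow_convergence:
  assumes Z: "log_density_flow M Z" and \<rho>: "\<rho> \<in> space (prob_algebra borel)" and t: "0 < t"
  shows "ext_integral \<rho> (V_pol M (gibbs M (Z t))) - ext_integral \<rho> (V_pol M (optimal_policy M))
      \<le> ereal (\<tau> / ((1 - \<gamma>) * (exp (\<tau> * t) - 1))) *
        ext_integral (occupancy_from M (optimal_policy M) \<rho>) (\<lambda>s. KL (optimal_policy M s) (gibbs M (Z 0) s))"
    and "ext_integral (occupancy_from M (optimal_policy M) \<rho>)
        (\<lambda>s. (tv_norm (\<lambda>B. measure (gibbs M (Z t) s) B - measure (optimal_policy M s) B))\<^sup>2)
      \<le> ereal (2 * exp (- \<tau> * t)) *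
        ext_integral (occupancy_from M (optimal_policy M) \<rho>) (\<lambda>s. KL (optimal_policy M s) (gibbs M (Z 0) s))"
proof -
  note l = log_density_flow_lflow[OF Z]
  note lo = lopt_normalised
  have Bb: "Z t \<in> Bb" if "0 \<le> t" for t using Z that by (auto simp: log_density_flow_def C1_path_def)
  have g: "gibbs M (Z t) = lpol (nrm (Z t))" if "0 \<le> t" for t by (rule gibbs_eq_lpol[OF Bb[OF that]])
  have n: "nrm (Z t) \<in> normalised" if "0 \<le> t" for t by (rule nrm_normalised[OF Bb[OF that]])
  have t0: "0 \<le> t" using t by simp
  have \<rho>': "prob_space \<rho>" "sets \<rho> = sets borel" using \<rho> by (auto simp: space_prob_algebra)
  note N = occupancy_from_prob[OF lo \<rho>]
  have kl: "ext_integral (occupancy_from M (optimal_policy M) \<rho>) (\<lambda>s. KL (optimal_policy M s) (gibbs M (Z 0) s))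
      = ereal (LINT s|occupancy_from M (lpol lopt) \<rho>. avg lopt (\<lambda>x. lopt x - nrm (Z 0) x) s)"
    unfolding optimal_policy_eq g[OF order_refl] KL_lpol[OF lo n[OF order_refl]]
    by (intro ext_integral_Bb N avg_Bb lo Bb_diff normalised_Bb n) simp
  have "ext_integral \<rho> (V_pol M (gibbs M (Z t))) = ereal (LINT s|\<rho>. val (nrm (Z t)) s)"
    using ext_integral_Bb[OF \<rho>' val_Bb[OF n[OF t0]]] unfolding g[OF t0] by (simp add: V_pol_lpol[OF n[OF t0], abs_def])
  moreover have "ext_integral \<rho> (V_pol M (optimal_policy M)) = ereal (LINT s|\<rho>. vopt s)"
    using ext_integral_Bb[OF \<rho>' vopt_Bb] unfolding optimal_policy_eq by (simp add: V_pol_lpol[OF lo, abs_def] val_lopt)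
  ultimately show "ext_integral \<rho> (V_pol M (gibbs M (Z t))) - ext_integral \<rho> (V_pol M (optimal_policy M))
      \<le> ereal (\<tau> / ((1 - \<gamma>) * (exp (\<tau> * t) - 1))) *
        ext_integral (occupancy_from M (optimal_policy M) \<rho>) (\<lambda>s. KL (optimal_policy M s) (gibbs M (Z 0) s))"
    unfolding kl using lflow_convergence(1)[OF l \<rho> t] by simp
  have "(tv_norm (\<lambda>B. measure (gibbs M (Z t) s) B - measure (optimal_policy M s) B))\<^sup>2
      = ereal ((l1_dist (nrm (Z t)) lopt s)\<^sup>2)" for s
    unfolding g[OF t0] optimal_policy_eq tv_norm_lpol[OF n[OF t0] lo] by (simp add: power2_eq_square)
  moreover have "(\<lambda>s. (l1_dist (nrm (Z t)) lopt s)\<^sup>2) \<in> Bb"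
    unfolding power2_eq_square by (intro Bb_mult l1_dist_Bb normalised_Bb n lo t0)
  ultimately have "ext_integral (occupancy_from M (optimal_policy M) \<rho>)
        (\<lambda>s. (tv_norm (\<lambda>B. measure (gibbs M (Z t) s) B - measure (optimal_policy M s) B))\<^sup>2)
      = ereal (LINT s|occupancy_from M (lpol lopt) \<rho>. (l1_dist (nrm (Z t)) lopt s)\<^sup>2)"
    using ext_integral_Bb[OF N] by (simp add: optimal_policy_eq)
  then show "ext_integral (occupancy_from M (optimal_policy M) \<rho>)
        (\<lambda>s. (tv_norm (\<lambda>B. measure (gibbs M (Z t) s) B - measure (optimal_policy M s) B))\<^sup>2)
      \<le> ereal (2 * exp (- \<tau> * t)) *
        ext_integral (occupancy_from M (optimal_policy M) \<rho>) (\<lambda>s. KL (optimal_policy M s) (gibbs M (Z 0) s))"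
    unfolding kl using lflow_convergence(2)[OF l \<rho> t] by simp
qed

end

section \<open>The Fisher--Rao flow\<close>

text \<open>Partitions have no empty block, so \<open>tv_norm\<close> does not see the value at the
  empty set.\<close>

lemma tv_norm_cong:
  "(\<And>B. B \<in> sets borel \<Longrightarrow> B \<noteq> {} \<Longrightarrow> m B = m' B) \<Longrightarrow> tv_norm m = tv_norm m'"
  unfolding tv_norm_def
  by (intro SUP_cong refl sum.cong arg_cong[where f = "\<lambda>x. ereal \<bar>x\<bar>"])
     (metis (no_types, lifting) mem_Collect_eq partition_onD3 subsetD)

lemma tv_norm_ge_abs:
  assumes B: "B \<in> sets borel" "B \<noteq> {}"
  shows "ereal \<bar>m B\<bar> \<le> tv_norm m"
proof -
  define \<B> where "\<B> = {B, - B} - {{}}"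
  have "partition_on UNIV \<B>"
    by (auto simp: \<B>_def partition_on_def disjoint_def)
  then have "(\<Sum>B\<in>\<B>. ereal \<bar>m B\<bar>) \<le> tv_norm m"
    unfolding tv_norm_def using B by (intro SUP_upper) (auto simp: \<B>_def)
  moreover have "ereal \<bar>m B\<bar> \<le> (\<Sum>B\<in>\<B>. ereal \<bar>m B\<bar>)"
    using B sum_mono2[of \<B> "{B}" "\<lambda>B. ereal \<bar>m B\<bar>"] by (auto simp: \<B>_def)
  ultimately show ?thesis by (rule order_trans[rotated])
qed

lemma tv_norm_nonneg: "0 \<le> tv_norm m"
  using tv_norm_ge_abs[of UNIV m] by (auto intro: order_trans[rotated])

lemma tv_norm_add_scaled:
  "tv_norm (\<lambda>B. r * a B + b B) \<le> ereal \<bar>r\<bar> * tv_norm a + tv_norm b"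
  unfolding tv_norm_def[of "\<lambda>B. r * a B + b B"]
proof (rule SUP_least)
  fix \<B> :: "'a set set" assume \<B>: "\<B> \<in> {\<B>. finite \<B> \<and> \<B> \<subseteq> sets borel \<and> partition_on UNIV \<B>}"
  have "(\<Sum>B\<in>\<B>. ereal \<bar>r * a B + b B\<bar>) \<le> ereal \<bar>r\<bar> * (\<Sum>B\<in>\<B>. ereal \<bar>a B\<bar>) + (\<Sum>B\<in>\<B>. ereal \<bar>b B\<bar>)"
    by (simp add: sum_distrib_left sum.distrib[symmetric])
      (intro sum_mono, simp add: abs_mult[symmetric] abs_triangle_ineq)
  also have "\<dots> \<le> ereal \<bar>r\<bar> * tv_norm a + tv_norm b"
    unfolding tv_norm_def by (intro add_mono ereal_mult_left_mono SUP_upper \<B>) auto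
  finally show "(\<Sum>B\<in>\<B>. ereal \<bar>r * a B + b B\<bar>) \<le> ereal \<bar>r\<bar> * tv_norm a + tv_norm b" .
qed

lemma tv_norm_le_kernel_norm: "tv_norm (\<lambda>B. k (s, B)) \<le> kernel_norm k"
  unfolding kernel_norm_def by (rule SUP_upper) simp

lemma kernel_norm_tendsto_zeroI:
  assumes "\<And>\<epsilon>. 0 < \<epsilon> \<Longrightarrow> \<forall>\<^sub>F r in F. \<forall>s. tv_norm (\<lambda>B. k r (s, B)) \<le> ereal \<epsilon>"
  shows "((\<lambda>r. kernel_norm (k r)) \<longlongrightarrow> 0) F"
proof (rule order_tendstoI)
  fix a :: ereal assume "a < 0"
  then have "a < kernel_norm (k r)" for r
    using tv_norm_nonneg tv_norm_le_kernel_norm by (metis less_le_trans order_trans)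
  then show "\<forall>\<^sub>F r in F. a < kernel_norm (k r)" by simp
next
  fix a :: ereal assume "0 < a"
  then obtain \<epsilon> where \<epsilon>: "0 < ereal \<epsilon>" "ereal \<epsilon> < a" using ereal_dense2 by blast
  then have "\<forall>\<^sub>F r in F. \<forall>s. tv_norm (\<lambda>B. k r (s, B)) \<le> ereal \<epsilon>" by (intro assms) simp
  then show "\<forall>\<^sub>F r in F. kernel_norm (k r) < a"
  proof eventually_elim
    case (elim r)
    then have "kernel_norm (k r) \<le> ereal \<epsilon>" unfolding kernel_norm_def by (intro SUP_least) auto
    then show ?case using \<epsilon> by simp
  qed
qed

lemma kernel_norm_tendsto_zeroD:
  assumes "((\<lambda>r. kernel_norm (k r)) \<longlongrightarrow> 0) F" "0 < \<epsilon>"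
  shows "\<forall>\<^sub>F r in F. \<forall>s. tv_norm (\<lambda>B. k r (s, B)) \<le> ereal \<epsilon>"
proof -
  have "\<forall>\<^sub>F r in F. kernel_norm (k r) < ereal \<epsilon>"
    using assms by (intro order_tendstoD) auto
  then show ?thesis
  proof eventually_elim
    case (elim r)
    then have "tv_norm (\<lambda>B. k r (s, B)) \<le> ereal \<epsilon>" for s
      by (rule order_trans[OF tv_norm_le_kernel_norm less_imp_le])
    then show ?case ..
  qed
qed

lemma at_within_nonneg_neq_bot: "0 \<le> t \<Longrightarrow> at t within {0..} \<noteq> bot" for t :: real
proof -
  assume "0 \<le> t"
  then have "at t within {t<..} \<le> at t within {0..}" by (intro at_le) auto
  then show ?thesis using trivial_limit_at_right_real[of t] by (metis bot.extremum_uniqueI)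
qed

text \<open>\<open>fisher_rao_flow\<close> asserts a continuous derivative and the equation
  separately; this identifies the two derivatives at positive times.\<close>

lemma kernel_path_derivative_unique:
  assumes k1: "has_path_derivative bounded_signed_kernels kernel_norm z k1 t"
    and k2: "has_path_derivative bounded_signed_kernels kernel_norm z k2 t"
    and t: "0 \<le> t" and B: "B \<in> sets borel" "B \<noteq> {}"
  shows "k1 (s, B) = k2 (s, B)"
proof -
  have "\<bar>k1 (s, B) - k2 (s, B)\<bar> \<le> 0"
  proof (rule field_le_epsilon)
    fix e :: real assume e: "0 < e"
    let ?q = "\<lambda>r x. (z r x - z t x) / (r - t)"
    have "\<forall>\<^sub>F r in at t within {0..}. \<forall>s. tv_norm (\<lambda>B. ?q r (s, B) - k (s, B)) \<le> ereal (e / 2)"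
      if "has_path_derivative bounded_signed_kernels kernel_norm z k t" for k
      using kernel_norm_tendsto_zeroD[of "\<lambda>r x. ?q r x - k x" _ "e / 2"] that e
      by (simp add: has_path_derivative_def)
    from eventually_conj[OF this[OF k1] this[OF k2]] at_within_nonneg_neq_bot[OF t]
    obtain r where r: "tv_norm (\<lambda>B. ?q r (s, B) - k1 (s, B)) \<le> ereal (e / 2)"
      "tv_norm (\<lambda>B. ?q r (s, B) - k2 (s, B)) \<le> ereal (e / 2)"
      using eventually_happens' by blast
    have "\<bar>?q r (s, B) - k1 (s, B)\<bar> \<le> e / 2" "\<bar>?q r (s, B) - k2 (s, B)\<bar> \<le> e / 2"
      using order_trans[OF tv_norm_ge_abs[OF B] r(1)] order_trans[OF tv_norm_ge_abs[OF B] r(2)] by simp_all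
    then show "\<bar>k1 (s, B) - k2 (s, B)\<bar> \<le> 0 + e" by linarith
  qed
  then show ?thesis by simp
qed

section \<open>Kernels with densities and existence of the Fisher-Rao flow\<close>

context entropy_mdp
begin

lemma slice_set_integrable:
  fixes d :: "'s \<times> 'a \<Rightarrow> real"
  assumes "d \<in> Bb" "B \<in> sets borel"
  shows "set_integrable \<mu> B (\<lambda>a. d (s, a))"
  unfolding set_integrable_def using assms by (intro integrable_mult_indicator slice_integrable) auto

lemma tv_norm_kernel:
  fixes d :: "'s \<times> 'a \<Rightarrow> real"
  assumes d: "d \<in> Bb" and k: "\<And>B. B \<in> sets borel \<Longrightarrow> k (s, B) = (LINT a:B|\<mu>. d (s, a))"
  shows "tv_norm (\<lambda>B. k (s, B)) = ereal (LINT a|\<mu>. \<bar>d (s, a)\<bar>)"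
  by (rule tv_norm_density[OF sets_\<mu> slice_integrable[OF d] k])

lemma density_kernel_bounded_signed:
  fixes d :: "'s \<times> 'a \<Rightarrow> real"
  assumes d: "d \<in> Bb" and k: "\<And>s B. B \<in> sets borel \<Longrightarrow> k (s, B) = (LINT a:B|\<mu>. d (s, a))"
  shows "k \<in> bounded_signed_kernels"
proof -
  obtain C where C: "d \<in> borel_measurable borel" "\<And>x. \<bar>d x\<bar> \<le> C" "0 \<le> C" by (rule BbE[OF d]) blast
  have "finite_signed_measure (\<lambda>B. k (s, B))" for s
    unfolding finite_signed_measure_def
  proof (intro allI impI)
    fix F :: "nat \<Rightarrow> 'a set" assume F: "range F \<subseteq> sets borel" "disjoint_family F"
    have FB: "F i \<in> sets borel" for i using F by auto
    let ?g = "\<lambda>i a. indicator (F i) a *\<^sub>R d (s, a)"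
    have int: "integrable \<mu> (?g i)" for i
      using slice_set_integrable[OF d FB[of i]] by (simp add: set_integrable_def)
    have point: "(\<lambda>i. ?g i a) sums (indicator (\<Union>i. F i) a *\<^sub>R d (s, a))" for a
    proof (cases "a \<in> (\<Union>i. F i)")
      case True
      then obtain j where j: "a \<in> F j" by auto
      then have "?g i a = (if i = j then d (s, a) else 0)" for i
        using F(2) by (auto simp: indicator_def disjoint_family_on_def)
      then show ?thesis using True sums_single[of j "\<lambda>_. d (s, a)"] by simp
    qed auto
    have norm_le: "(LINT a|\<mu>. norm (?g i a)) \<le> C * measure \<mu> (F i)" for i
    proof -
      have "(LINT a|\<mu>. norm (?g i a)) \<le> (LINT a|\<mu>. C * indicator (F i) a)"
      proof (rule integral_mono[OF integrable_norm[OF int]])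
        show "integrable \<mu> (\<lambda>a. C * indicator (F i) a)"
          using FB by (intro integrable_mult_right integrable_real_indicator) (auto simp: \<mu>.emeasure_eq_measure)
        show "norm (?g i a) \<le> C * indicator (F i) a" for a
          using C by (auto simp: indicator_def)
      qed
      then show ?thesis using FB by simp
    qed
    have summ: "summable (\<lambda>i. LINT a|\<mu>. norm (?g i a))"
    proof (rule summable_comparison_test'[of _ 0])
      show "summable (\<lambda>i. C * measure \<mu> (F i))"
        using F by (intro summable_mult sums_summable[OF \<mu>.finite_measure_UNION]) auto
      show "norm (LINT a|\<mu>. norm (?g i a)) \<le> C * measure \<mu> (F i)" for i
        using norm_le[of i] by (simp add: integral_nonneg_AE)
    qed
    have "(\<lambda>i. LINT a|\<mu>. ?g i a) sums (LINT a|\<mu>. (\<Sum>i. ?g i a))"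
    proof (rule sums_integral[OF int _ summ])
      have "summable (\<lambda>i. norm (?g i a))" for a
      proof (cases "a \<in> (\<Union>i. F i)")
        case True
        then obtain j where j: "a \<in> F j" by auto
        then have "norm (?g i a) = (if i = j then \<bar>d (s, a)\<bar> else 0)" for i
          using F(2) by (auto simp: indicator_def disjoint_family_on_def)
        then show ?thesis using sums_summable[OF sums_single[of j "\<lambda>_. \<bar>d (s, a)\<bar>"]] by simp
      qed auto
      then show "AE a in \<mu>. summable (\<lambda>i. norm (?g i a))" by simp
    qed
    moreover have "(\<Sum>i. ?g i a) = indicator (\<Union>i. F i) a *\<^sub>R d (s, a)" for a
      using point[of a] by (simp add: sums_iff)
    ultimately show "(\<lambda>i. k (s, F i)) sums k (s, \<Union>i. F i)"
      using k FB F by (simp add: set_lebesgue_integral_def)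
  qed
  moreover have "(\<lambda>s. k (s, B)) \<in> borel_measurable borel" if B: "B \<in> sets borel" for B
  proof -
    have "(\<lambda>x :: 's \<times> 'a. indicator B (snd x) * d x) \<in> Bb"
    proof (rule BbI)
      have "snd \<in> borel_measurable (borel :: ('s \<times> 'a) measure)" unfolding borel_prod[symmetric] by simp
      then have "(\<lambda>x :: 's \<times> 'a. indicator B (snd x) :: real) \<in> borel_measurable borel"
        using B by (intro measurable_compose[OF _ borel_measurable_indicator])
      then show "(\<lambda>x :: 's \<times> 'a. indicator B (snd x) * d x) \<in> borel_measurable borel"
        using C(1) by (rule borel_measurable_times)
      show "\<bar>indicator B (snd x) * d x\<bar> \<le> C" for x
        using C by (auto simp: indicator_def)
    qed
    from Bb_measurable[OF integral_\<mu>_Bb[OF this]] show ?thesis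
      using B by (simp add: k set_lebesgue_integral_def)
  qed
  moreover have "kernel_norm k < \<infinity>"
  proof -
    have "tv_norm (\<lambda>B. k (s, B)) \<le> ereal C" for s
      using \<mu>.integral_bounds[of "\<lambda>a. \<bar>d (s, a)\<bar>" C] slice_measurable[OF Bb_abs[OF d]] C
      by (simp add: tv_norm_kernel[OF d k] abs_le_iff)
    then have "kernel_norm k \<le> ereal C" unfolding kernel_norm_def by (intro SUP_least)
    then show ?thesis by (rule le_less_trans) simp
  qed
  ultimately show ?thesis by (simp add: bounded_signed_kernels_def)
qed

definition fr_rhs :: "('s \<Rightarrow> 'a measure) \<Rightarrow> 's \<times> 'a set \<Rightarrow> real" where
  "fr_rhs \<pi> = (\<lambda>(s, B). - (LINT a:B|\<pi> s. Q_pol M \<pi> (s, a)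
     + \<tau> * ln (enn2real (RN_deriv \<mu> (\<pi> s) a)) - real_of_ereal (V_pol M \<pi> s)))"

text \<open>An everywhere defined density of \<open>fr_rhs\<close> with respect to
  \<open>\<mu>\<close>.\<close>

definition fr_density :: "('s \<times> 'a \<Rightarrow> real) \<Rightarrow> 's \<times> 'a \<Rightarrow> real" where
  "fr_density l x = - (adv l x * exp (l x))"

lemma fr_density_Bb: "l \<in> normalised \<Longrightarrow> fr_density l \<in> Bb"
  unfolding fr_density_def[abs_def] by (intro Bb_uminus Bb_mult adv_Bb Bb_exp normalised_Bb)

text \<open>The Radon-Nikodym derivative agrees with \<open>exp l\<close> only almost everywhere,
  first for \<open>\<mu>\<close> and then for the policy, whose density is positive; the integral
  over \<open>B\<close> does not notice.\<close>

lemma fr_rhs_eq: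
  assumes l: "l \<in> normalised" and B: "B \<in> sets borel"
  shows "fr_rhs (lpol l) (s, B) = (LINT a:B|\<mu>. fr_density l (s, a))"
proof -
  have "AE a in lpol l s. ln (enn2real (RN_deriv \<mu> (lpol l s) a)) = l (s, a)"
    using RN_deriv_exp_density[OF prob_space_\<mu> slice_measurable[OF normalised_Bb[OF l]]]
      AE_density_exp_iff[OF slice_measurable[OF normalised_Bb[OF l]]]
    unfolding lpol_def by blast
  then have "AE a in lpol l s. indicator B a *\<^sub>R (Q_pol M (lpol l) (s, a)
      + \<tau> * ln (enn2real (RN_deriv \<mu> (lpol l s) a)) - real_of_ereal (V_pol M (lpol l) s)) = indicator B a *\<^sub>R adv l (s, a)"
    by (rule eventually_mono) (simp add: Q_pol_lpol[OF l] V_pol_lpol[OF l] adv_def)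
  moreover have adv: "(\<lambda>a. adv l (s, a)) \<in> borel_measurable borel"
    by (rule Bb_measurable[OF Bb_slice[OF adv_Bb[OF l]]])
  moreover have "(\<lambda>a. Q_pol M (lpol l) (s, a)) \<in> borel_measurable borel"
  proof -
    have "(\<lambda>x. c x + \<gamma> * next_mean (val l) x) \<in> Bb" by (intro Bb_add Bb_cmult c_Bb next_mean_Bb val_Bb l)
    from Bb_measurable[OF Bb_slice[OF this]] show ?thesis by (simp add: Q_pol_lpol[OF l])
  qed
  moreover have "RN_deriv \<mu> (lpol l s) \<in> borel_measurable borel"
    using borel_measurable_RN_deriv[of \<mu> "lpol l s"] by (simp add: measurable_cong_sets[OF sets_\<mu> refl])
  ultimately have "(LINT a:B|lpol l s. Q_pol M (lpol l) (s, a)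
      + \<tau> * ln (enn2real (RN_deriv \<mu> (lpol l s) a)) - real_of_ereal (V_pol M (lpol l) s))
      = (LINT a:B|lpol l s. adv l (s, a))"
    unfolding set_lebesgue_integral_def using B
    by (intro integral_cong_AE) (simp_all add: measurable_cong_sets[OF sets_lpol refl])
  also have "\<dots> = (LINT a|\<mu>. exp (l (s, a)) * (indicator B a *\<^sub>R adv l (s, a)))"
    unfolding set_lebesgue_integral_def using adv B by (intro integral_lpol normalised_Bb l) auto
  finally show ?thesis
    by (simp add: fr_rhs_def fr_density_def set_lebesgue_integral_def mult_ac)
qed

lemma kernel_of_lpol:
  "l \<in> normalised \<Longrightarrow> B \<in> sets borel \<Longrightarrow> kernel_of (lpol l) (s, B) = (LINT a:B|\<mu>. exp (l (s, a)))"
  by (simp add: kernel_of_def measure_lpol)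

lemma kernel_quotient:
  assumes l: "l \<in> normalised" and k: "k \<in> normalised" and d: "d \<in> Bb" and B: "B \<in> sets borel"
  shows "(kernel_of (lpol l) (s, B) - kernel_of (lpol k) (s, B)) / h - (LINT a:B|\<mu>. d (s, a))
    = (LINT a:B|\<mu>. (exp (l (s, a)) - exp (k (s, a))) / h - d (s, a))"
proof -
  note Bb = normalised_Bb[OF l] normalised_Bb[OF k]
  have D: "(\<lambda>x. exp (l x) - exp (k x)) \<in> Bb" by (intro Bb_diff Bb_exp Bb)
  then have D': "(\<lambda>x. (exp (l x) - exp (k x)) / h) \<in> Bb"
    unfolding divide_inverse by (intro Bb_mult Bb_const)
  show ?thesis
    using set_integral_diff(2)[OF slice_set_integrable[OF D' B, of s] slice_set_integrable[OF d B, of s]]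
      set_integral_diff(2)[OF slice_set_integrable[OF Bb_exp[OF Bb(1)] B, of s] slice_set_integrable[OF Bb_exp[OF Bb(2)] B, of s]]
    by (simp add: kernel_of_lpol l k B set_integral_divide_zero)
qed

lemma tv_norm_quotient:
  assumes l: "l \<in> normalised" and k: "k \<in> normalised" and d: "d \<in> Bb" and h: "h \<noteq> 0"
    and z: "\<And>B. B \<in> sets borel \<Longrightarrow> z (s, B) = (LINT a:B|\<mu>. d (s, a))"
  shows "tv_norm (\<lambda>B. (kernel_of (lpol l) (s, B) - kernel_of (lpol k) (s, B)) / h - z (s, B))
    = ereal ((LINT a|\<mu>. \<bar>exp (l (s, a)) - exp (k (s, a)) - h * d (s, a)\<bar>) / \<bar>h\<bar>)"
proof -
  have D: "(\<lambda>x. (exp (l x) - exp (k x)) / h - d x) \<in> Bb"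
    unfolding divide_inverse by (intro Bb_diff Bb_mult Bb_exp Bb_const d normalised_Bb l k)
  have "tv_norm (\<lambda>B. (kernel_of (lpol l) (s, B) - kernel_of (lpol k) (s, B)) / h - z (s, B))
      = ereal (LINT a|\<mu>. \<bar>(exp (l (s, a)) - exp (k (s, a))) / h - d (s, a)\<bar>)"
    by (rule tv_norm_density[OF sets_\<mu> slice_integrable[OF D]]) (simp add: z kernel_quotient[OF l k d])
  also have "(\<lambda>a. \<bar>(exp (l (s, a)) - exp (k (s, a))) / h - d (s, a)\<bar>)
      = (\<lambda>a. \<bar>exp (l (s, a)) - exp (k (s, a)) - h * d (s, a)\<bar> / \<bar>h\<bar>)"
    using h by (intro ext) (simp add: abs_divide[symmetric] diff_divide_distrib)
  finally show ?thesis by simp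
qed

text \<open>The total variation norm of the error of the difference quotient is an integral of
  densities, so differentiability in the kernel norm becomes an L1 estimate uniform in the state,
  with the division by \<open>r - t\<close> multiplied out.\<close>

lemma kernel_path_derivative_iff:
  assumes n: "\<And>r. 0 \<le> r \<Longrightarrow> f r \<in> normalised" and \<pi>: "\<And>r. 0 \<le> r \<Longrightarrow> \<pi> r = lpol (f r)"
    and t: "0 \<le> t" and d: "d \<in> Bb" and z: "\<And>s B. B \<in> sets borel \<Longrightarrow> z (s, B) = (LINT a:B|\<mu>. d (s, a))"
  shows "has_path_derivative bounded_signed_kernels kernel_norm (\<lambda>t. kernel_of (\<pi> t)) z t \<longleftrightarrow>
    (\<forall>\<epsilon>>0. \<forall>\<^sub>F r in at t within {0..}. \<forall>s.
      (LINT a|\<mu>. \<bar>exp (f r (s, a)) - exp (f t (s, a)) - (r - t) * d (s, a)\<bar>) \<le> \<epsilon> * \<bar>r - t\<bar>)"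
proof -
  let ?N = "\<lambda>r x. (kernel_of (\<pi> r) x - kernel_of (\<pi> t) x) / (r - t) - z x"
  have tv: "tv_norm (\<lambda>B. ?N r (s, B)) \<le> ereal \<epsilon> \<longleftrightarrow>
      (LINT a|\<mu>. \<bar>exp (f r (s, a)) - exp (f t (s, a)) - (r - t) * d (s, a)\<bar>) \<le> \<epsilon> * \<bar>r - t\<bar>"
    if r: "0 \<le> r" "r \<noteq> t" for r s \<epsilon>
    using tv_norm_quotient[OF n[OF r(1)] n[OF t] d _ z, of "r - t" s] r
    by (simp add: \<pi> t pos_divide_le_eq)
  have ev: "(\<forall>\<^sub>F r in at t within {0..}. \<forall>s. tv_norm (\<lambda>B. ?N r (s, B)) \<le> ereal \<epsilon>) \<longleftrightarrow>
    (\<forall>\<^sub>F r in at t within {0..}. \<forall>s.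
      (LINT a|\<mu>. \<bar>exp (f r (s, a)) - exp (f t (s, a)) - (r - t) * d (s, a)\<bar>) \<le> \<epsilon> * \<bar>r - t\<bar>)" for \<epsilon>
    by (rule eventually_cong[OF eventually_at_within_nonneg[of t "\<lambda>r. 0 \<le> r \<and> r \<noteq> t"]])
      (use tv in auto)
  have "((\<lambda>r. kernel_norm (?N r)) \<longlongrightarrow> 0) (at t within {0..}) \<longleftrightarrow>
      (\<forall>\<epsilon>>0. \<forall>\<^sub>F r in at t within {0..}. \<forall>s. tv_norm (\<lambda>B. ?N r (s, B)) \<le> ereal \<epsilon>)"
    using kernel_norm_tendsto_zeroI[of ?N "at t within {0..}"] kernel_norm_tendsto_zeroD[of ?N "at t within {0..}"] by blast
  then show ?thesis
    unfolding has_path_derivative_def ev using density_kernel_bounded_signed[OF d z] by simp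
qed

text \<open>Differentiability of the log-densities in the supremum norm is stronger than L1
  differentiability of the densities, which follows by expanding the exponential.\<close>

lemma fr_flow_exists:
  assumes n: "\<And>t. 0 \<le> t \<Longrightarrow> l t \<in> normalised"
    and deriv: "\<And>t. 0 \<le> t \<Longrightarrow> ((\<lambda>r. Bm (l r)) has_vector_derivative Bm (\<lambda>x. - adv (l t) x)) (at t within {0..})"
    and \<pi>: "\<And>t. 0 \<le> t \<Longrightarrow> \<pi> t = lpol (l t)"
  shows "fisher_rao_flow M (\<pi> 0) \<pi>"
proof -
  have path: "has_path_derivative bounded_signed_kernels kernel_norm (\<lambda>t. kernel_of (\<pi> t)) (fr_rhs (\<pi> t)) t"
    if t: "0 \<le> t" for t
  proof (subst kernel_path_derivative_iff[OF n \<pi> t fr_density_Bb[OF n[OF t]]])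
    show "fr_rhs (\<pi> t) (s, B) = (LINT a:B|\<mu>. fr_density (l t) (s, a))" if "B \<in> sets borel" for s B
      unfolding \<pi>[OF t] by (rule fr_rhs_eq[OF n[OF t] that])
    obtain a where a: "adv (l t) \<in> borel_measurable borel" "\<And>x. \<bar>adv (l t) x\<bar> \<le> a" "0 \<le> a"
      by (rule BbE[OF adv_Bb[OF n[OF t]]]) blast
    show "\<forall>\<epsilon>>0. \<forall>\<^sub>F r in at t within {0..}. \<forall>s.
      (LINT a|\<mu>. \<bar>exp (l r (s, a)) - exp (l t (s, a)) - (r - t) * fr_density (l t) (s, a)\<bar>) \<le> \<epsilon> * \<bar>r - t\<bar>"
    proof (intro allI impI)
      fix \<epsilon> :: real assume \<epsilon>: "0 < \<epsilon>"
      \<comment> \<open>Half of the allowed error goes to the linearisation of the log-density. The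
        distance restriction below gives the other half to the quadratic remainder
        \<open>2 * (a + 1)\<^sup>2 * h * h\<close>, written with \<open>h\<close> for
        \<open>|r - t|\<close>.\<close>
      define e where "e = min 1 (\<epsilon> / 2)"
      have e: "0 < e" "e \<le> 1" "e \<le> \<epsilon> / 2" using \<epsilon> by (auto simp: e_def)
      have "\<forall>\<^sub>F r in at t within {0..}. dist r t < \<epsilon> / (4 * (a + 1)\<^sup>2)"
        unfolding eventually_at using \<epsilon> a by (intro exI[of _ "\<epsilon> / (4 * (a + 1)\<^sup>2)"]) auto
      moreover have "\<forall>\<^sub>F r in at t within {0..}. 0 \<le> r" by (rule eventually_at_within_nonneg) auto
      moreover have "\<forall>\<^sub>F r in at t within {0..}. \<forall>x. \<bar>(l r x - l t x) - (t - r) * adv (l t) x\<bar> \<le> e * \<bar>r - t\<bar>"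
        using n t e(1) deriv[OF t] by (rule sup_norm_quotient)
      ultimately show "\<forall>\<^sub>F r in at t within {0..}. \<forall>s.
          (LINT a|\<mu>. \<bar>exp (l r (s, a)) - exp (l t (s, a)) - (r - t) * fr_density (l t) (s, a)\<bar>) \<le> \<epsilon> * \<bar>r - t\<bar>"
      proof eventually_elim
        case (elim r)
        show ?case
        proof
          fix s
          define h where "h = \<bar>r - t\<bar>"
          note Bb = normalised_Bb[OF n[OF elim(2)]] normalised_Bb[OF n[OF t]] adv_Bb[OF n[OF t]]
          have quot: "\<bar>(l r x - l t x) - (t - r) * adv (l t) x\<bar> \<le> e * h" for x
            using elim(3)[rule_format, of x] by (simp only: h_def)
          have d: "\<bar>l r x - l t x\<bar> \<le> (a + 1) * h" for x
          proof -
            have "\<bar>(t - r) * adv (l t) x\<bar> \<le> h * a"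
              unfolding abs_mult h_def using a(2) by (simp add: abs_minus_commute mult_left_mono)
            moreover have "e * h \<le> 1 * h" using e by (intro mult_right_mono) (auto simp: h_def)
            moreover have "\<bar>l r x - l t x\<bar> \<le> e * h + \<bar>(t - r) * adv (l t) x\<bar>" using quot[of x] by linarith
            moreover have "(a + 1) * h = h * a + 1 * h" by (simp add: algebra_simps)
            ultimately show ?thesis by linarith
          qed
          have point: "\<bar>exp (l r x) - exp (l t x) - (r - t) * fr_density (l t) x\<bar>
              \<le> (a + 1) * h * \<bar>exp (l r x) - exp (l t x)\<bar> + e * h * exp (l t x)" for x
          proof -
            define y where "y = l r x - l t x"
            define p where "p = exp (l t x)"
            have p: "0 < p" by (simp add: p_def)
            have lr: "exp (l r x) = p * exp y" by (simp add: p_def y_def exp_diff)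
            \<comment> \<open>The Taylor remainder is bounded by \<open>y * (exp y - 1)\<close>
              because, multiplied by \<open>p\<close>, this becomes \<open>y\<close> times the
              difference of the densities, whose integral is controlled by \<open>l1_dist\<close>
              whatever the size of the densities.\<close>
            have "1 + y \<le> exp y" by (rule exp_ge_add_one_self)
            moreover have "exp y * (1 - y) \<le> 1"
              using mult_left_mono[OF exp_ge_add_one_self[of "- y"], of "exp y"] by (simp add: exp_minus)
            ultimately have "0 \<le> exp y - 1 - y" "exp y - 1 - y \<le> y * (exp y - 1)"
              by (simp_all add: algebra_simps)
            then have "p * \<bar>exp y - 1 - y\<bar> \<le> p * (y * (exp y - 1))" using p by (intro mult_left_mono) auto
            also have "\<dots> \<le> \<bar>y\<bar> * \<bar>p * exp y - p\<bar>"
            proof -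
              have "p * (y * (exp y - 1)) = y * (p * exp y - p)" by (simp add: algebra_simps)
              also have "\<dots> \<le> \<bar>y * (p * exp y - p)\<bar>" by (rule abs_ge_self)
              finally show ?thesis by (simp add: abs_mult)
            qed
            also have "p * exp y - p = exp (l r x) - exp (l t x)" by (simp add: lr p_def)
            also have "\<bar>y\<bar> * \<bar>exp (l r x) - exp (l t x)\<bar> \<le> (a + 1) * h * \<bar>exp (l r x) - exp (l t x)\<bar>"
              using d[of x] by (intro mult_right_mono) (auto simp: y_def)
            finally have 1: "p * \<bar>exp y - 1 - y\<bar> \<le> (a + 1) * h * \<bar>exp (l r x) - exp (l t x)\<bar>" .
            have 2: "p * \<bar>y - (t - r) * adv (l t) x\<bar> \<le> e * h * p"
              using mult_left_mono[OF quot[of x], of p] p by (simp add: y_def mult.commute)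
            have "exp (l r x) - exp (l t x) - (r - t) * fr_density (l t) x
                = p * (exp y - 1 - y) + p * (y - (t - r) * adv (l t) x)"
              unfolding lr fr_density_def p_def[symmetric] by (simp add: algebra_simps)
            also have "\<bar>\<dots>\<bar> \<le> p * \<bar>exp y - 1 - y\<bar> + p * \<bar>y - (t - r) * adv (l t) x\<bar>"
              using p by (intro order_trans[OF abs_triangle_ineq]) (simp add: abs_mult)
            finally show ?thesis using 1 2 unfolding p_def by linarith
          qed
          have D: "(\<lambda>x. exp (l r x) - exp (l t x)) \<in> Bb" by (intro Bb_diff Bb_exp Bb)
          have E: "(\<lambda>x. exp (l r x) - exp (l t x) - (r - t) * fr_density (l t) x) \<in> Bb"
            by (intro Bb_diff Bb_exp Bb Bb_cmult fr_density_Bb n t)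
          have "(LINT a|\<mu>. \<bar>exp (l r (s, a)) - exp (l t (s, a)) - (r - t) * fr_density (l t) (s, a)\<bar>)
              \<le> (LINT a'|\<mu>. (a + 1) * h * \<bar>exp (l r (s, a')) - exp (l t (s, a'))\<bar> + e * h * exp (l t (s, a')))"
            using abs_slice_integrable[OF E] abs_slice_integrable[OF D] slice_integrable[OF Bb_exp[OF Bb(2)]]
            by (intro integral_mono Bochner_Integration.integrable_add integrable_mult_right point)
          also have "\<dots> = (a + 1) * h * l1_dist (l r) (l t) s + e * h"
            using abs_slice_integrable[OF D] slice_integrable[OF Bb_exp[OF Bb(2)]] n[OF t]
            by (simp add: l1_dist_def normalised_def)
          also have "\<dots> \<le> (a + 1) * h * (2 * ((a + 1) * h)) + \<epsilon> / 2 * h"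
            using l1_dist_le_sup[OF n[OF elim(2)] n[OF t] d] a e
            by (intro add_mono mult_left_mono mult_right_mono) (auto simp: h_def)
          also have "\<dots> = (2 * (a + 1)\<^sup>2 * h + \<epsilon> / 2) * h" by (simp add: power2_eq_square algebra_simps)
          also have "\<dots> \<le> (\<epsilon> / 2 + \<epsilon> / 2) * h"
          proof (intro mult_right_mono add_right_mono)
            have "h \<le> \<epsilon> / (4 * (a + 1)\<^sup>2)" using elim(1) by (simp add: h_def dist_real_def)
            then have "h * (4 * (a + 1)\<^sup>2) \<le> \<epsilon>" using a by (simp add: pos_le_divide_eq)
            then show "2 * (a + 1)\<^sup>2 * h \<le> \<epsilon> / 2" by (simp add: mult.commute)
          qed (simp add: h_def)
          finally show "(LINT a|\<mu>. \<bar>exp (l r (s, a)) - exp (l t (s, a)) - (r - t) * fr_density (l t) (s, a)\<bar>)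
              \<le> \<epsilon> * \<bar>r - t\<bar>" by (simp add: h_def)
        qed
      qed
    qed
  qed
  have cont: "((\<lambda>r. kernel_norm (\<lambda>x. fr_rhs (\<pi> r) x - fr_rhs (\<pi> t) x)) \<longlongrightarrow> 0) (at t within {0..})"
    if t: "0 \<le> t" for t
  proof (rule kernel_norm_tendsto_zeroI)
    fix \<epsilon> :: real assume \<epsilon>: "0 < \<epsilon>"
    obtain a where a: "adv (l t) \<in> borel_measurable borel" "\<And>x. \<bar>adv (l t) x\<bar> \<le> a" "0 \<le> a"
      by (rule BbE[OF adv_Bb[OF n[OF t]]]) blast
    \<comment> \<open>The Lipschitz constant of the advantage, integrated against a density of mass
      1, plus \<open>a\<close> times the factor 2 from \<open>l1_dist_le_sup\<close>.\<close>
    define K where "K = (2 * (2 * a + \<tau>) / (1 - \<gamma>) + \<tau>) + 2 * a"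
    have K: "0 < K" using a \<gamma> \<tau> by (auto simp: K_def intro!: add_nonneg_pos add_pos_nonneg)
    have "((\<lambda>r. norm (Bm (l r) - Bm (l t))) \<longlongrightarrow> 0) (at t within {0..})"
      using has_vector_derivative_continuous[OF deriv[OF t]]
      by (auto simp: continuous_within intro!: tendsto_norm_zero LIM_zero)
    then have "\<forall>\<^sub>F r in at t within {0..}. norm (Bm (l r) - Bm (l t)) < \<epsilon> / K"
      using \<epsilon> K by (intro order_tendstoD) auto
    moreover have "\<forall>\<^sub>F r in at t within {0..}. 0 \<le> r" by (rule eventually_at_within_nonneg) auto
    ultimately show "\<forall>\<^sub>F r in at t within {0..}. \<forall>s. tv_norm (\<lambda>B. fr_rhs (\<pi> r) (s, B) - fr_rhs (\<pi> t) (s, B)) \<le> ereal \<epsilon>"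
    proof eventually_elim
      case (elim r)
      show ?case
      proof
        fix s
        define d where "d = norm (Bm (l r) - Bm (l t))"
        have d: "\<bar>l r x - l t x\<bar> \<le> d" for x
          using abs_bm_le_norm[of "Bm (l r) - Bm (l t)" x] n[OF elim(2)] n[OF t] by (simp add: Bm_inverse normalised_Bb d_def)
        note nr = n[OF elim(2)] and nt = n[OF t]
        let ?D = "\<lambda>x. fr_density (l r) x - fr_density (l t) x"
        have D: "?D \<in> Bb" by (intro Bb_diff fr_density_Bb nr nt)
        have E: "(\<lambda>x. exp (l r x) - exp (l t x)) \<in> Bb" by (intro Bb_diff Bb_exp normalised_Bb nr nt)
        have tv: "tv_norm (\<lambda>B. fr_rhs (\<pi> r) (s, B) - fr_rhs (\<pi> t) (s, B)) = ereal (LINT a|\<mu>. \<bar>?D (s, a)\<bar>)"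
        proof (rule tv_norm_density[OF sets_\<mu> slice_integrable[OF D]])
          fix B :: "'a set" assume B: "B \<in> sets borel"
          show "fr_rhs (\<pi> r) (s, B) - fr_rhs (\<pi> t) (s, B) = (LINT a:B|\<mu>. ?D (s, a))"
            using slice_set_integrable[OF fr_density_Bb[OF nr] B] slice_set_integrable[OF fr_density_Bb[OF nt] B]
            by (simp add: \<pi> elim(2) t fr_rhs_eq nr nt B set_integral_diff)
        qed
        have "(LINT a|\<mu>. \<bar>?D (s, a)\<bar>)
            \<le> (LINT a'|\<mu>. (2 * (2 * a + \<tau>) / (1 - \<gamma>) + \<tau>) * d * exp (l r (s, a')) + a * \<bar>exp (l r (s, a')) - exp (l t (s, a'))\<bar>)"
        proof (rule integral_mono)
          show "integrable \<mu> (\<lambda>a. \<bar>?D (s, a)\<bar>)" by (rule abs_slice_integrable[OF D])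
          show "integrable \<mu> (\<lambda>a'. (2 * (2 * a + \<tau>) / (1 - \<gamma>) + \<tau>) * d * exp (l r (s, a')) + a * \<bar>exp (l r (s, a')) - exp (l t (s, a'))\<bar>)"
            using abs_slice_integrable[OF E] slice_integrable[OF Bb_exp[OF normalised_Bb[OF nr]]]
            by (intro Bochner_Integration.integrable_add integrable_mult_right)
          fix a' :: 'a
          let ?x = "(s, a')"
          have "?D ?x = - ((adv (l r) ?x - adv (l t) ?x) * exp (l r ?x) + adv (l t) ?x * (exp (l r ?x) - exp (l t ?x)))"
            by (simp add: fr_density_def algebra_simps)
          also have "\<bar>\<dots>\<bar> \<le> \<bar>adv (l r) ?x - adv (l t) ?x\<bar> * exp (l r ?x) + \<bar>adv (l t) ?x\<bar> * \<bar>exp (l r ?x) - exp (l t ?x)\<bar>"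
            unfolding abs_minus_cancel by (rule order_trans[OF abs_triangle_ineq]) (simp add: abs_mult)
          also have "\<dots> \<le> (2 * (2 * a + \<tau>) / (1 - \<gamma>) + \<tau>) * d * exp (l r ?x) + a * \<bar>exp (l r ?x) - exp (l t ?x)\<bar>"
            using adv_lipschitz[OF nr nt d a(2)] a(2) by (intro add_mono mult_right_mono) auto
          finally show "\<bar>?D ?x\<bar> \<le> (2 * (2 * a + \<tau>) / (1 - \<gamma>) + \<tau>) * d * exp (l r ?x) + a * \<bar>exp (l r ?x) - exp (l t ?x)\<bar>" .
        qed
        also have "\<dots> = (2 * (2 * a + \<tau>) / (1 - \<gamma>) + \<tau>) * d + a * l1_dist (l r) (l t) s"
          using abs_slice_integrable[OF E] slice_integrable[OF Bb_exp[OF normalised_Bb[OF nr]]] nr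
          by (simp add: l1_dist_def normalised_def)
        also have "\<dots> \<le> (2 * (2 * a + \<tau>) / (1 - \<gamma>) + \<tau>) * d + a * (2 * d)"
          using l1_dist_le_sup[OF nr nt d] a by (intro add_left_mono mult_left_mono) auto
        also have "\<dots> = K * d" by (simp add: K_def algebra_simps)
        also have "\<dots> \<le> \<epsilon>" using elim(1) K by (simp add: d_def pos_less_divide_eq mult.commute)
        finally show "tv_norm (\<lambda>B. fr_rhs (\<pi> r) (s, B) - fr_rhs (\<pi> t) (s, B)) \<le> ereal \<epsilon>" by (simp add: tv)
      qed
    qed
  qed
  have "kernel_of (\<pi> t) \<in> bounded_signed_kernels" if "0 \<le> t" for t
    unfolding \<pi>[OF that]
    by (rule density_kernel_bounded_signed[OF Bb_exp[OF normalised_Bb[OF n[OF that]]]]) (rule kernel_of_lpol[OF n[OF that]])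
  then have "C1_path bounded_signed_kernels kernel_norm (\<lambda>t. kernel_of (\<pi> t))"
    unfolding C1_path_def
    by (intro conjI allI impI exI[of _ "\<lambda>t. fr_rhs (\<pi> t)"] path cont)
  then show ?thesis
    unfolding fisher_rao_flow_def using path n by (simp add: \<pi> gibbs_policies_eq fr_rhs_def)
qed

end

section \<open>A priori bounds and uniqueness for the Fisher-Rao flow\<close>

lemma tv_norm_zero: "tv_norm (\<lambda>_. 0) \<le> 0"
  unfolding tv_norm_def by (rule SUP_least) simp

context entropy_mdp
begin

text \<open>A Fisher--Rao flow through log-densities, which it determines only up to null sets; hence the
  norms of kernels appear as integrals and not as suprema over actions.\<close>

definition fr_path :: "(real \<Rightarrow> 's \<times> 'a \<Rightarrow> real) \<Rightarrow> bool" where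
  "fr_path f \<longleftrightarrow>
     (\<forall>t\<ge>0. f t \<in> normalised) \<and>
     (\<forall>t\<ge>0. \<exists>K. \<forall>\<^sub>F r in at t within {0..}. \<forall>s. l1_dist (f r) (f t) s \<le> K * \<bar>r - t\<bar>) \<and>
     (\<forall>t>0. \<forall>\<epsilon>>0. \<forall>\<^sub>F r in at t within {0..}. \<forall>s.
        (LINT a|\<mu>. \<bar>exp (f r (s, a)) - exp (f t (s, a)) - (r - t) * fr_density (f t) (s, a)\<bar>) \<le> \<epsilon> * \<bar>r - t\<bar>) \<and>
     (\<forall>t\<ge>0. \<exists>K. \<forall>\<^sub>F r in at t within {0..}. 0 < r \<longrightarrow> (\<forall>s. (LINT a|\<mu>. \<bar>fr_density (f r) (s, a)\<bar>) \<le> K))"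

text \<open>The local Lipschitz bound comes from the boundedness of the derivative kernel at
  \<open>t\<close>. The local bound on \<open>fr_density\<close> comes from the continuity of the
  derivative; it is the information from which the values will be bounded.\<close>

lemma fisher_rao_flow_fr_path:
  assumes flow: "fisher_rao_flow M \<pi>\<^sub>0 \<pi>"
  obtains f where "fr_path f" "\<And>t. 0 \<le> t \<Longrightarrow> \<pi> t = lpol (f t)"
proof -
  have "\<forall>t. \<exists>l. 0 \<le> t \<longrightarrow> l \<in> normalised \<and> \<pi> t = lpol l"
    using flow by (auto simp: fisher_rao_flow_def gibbs_policies_eq image_iff)
  then obtain f where f: "\<And>t. 0 \<le> t \<Longrightarrow> f t \<in> normalised" "\<And>t. 0 \<le> t \<Longrightarrow> \<pi> t = lpol (f t)" by metis
  let ?k = "\<lambda>t. kernel_of (\<pi> t)"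
  let ?path = "has_path_derivative bounded_signed_kernels kernel_norm ?k"
  obtain z' where z': "\<And>t. 0 \<le> t \<Longrightarrow> ?path (z' t) t"
    "\<And>t. 0 \<le> t \<Longrightarrow> ((\<lambda>r. kernel_norm (\<lambda>x. z' r x - z' t x)) \<longlongrightarrow> 0) (at t within {0..})"
    using flow by (auto simp: fisher_rao_flow_def C1_path_def)
  have rhs: "?path (fr_rhs (\<pi> t)) t" if "0 < t" for t
    using flow that by (simp add: fisher_rao_flow_def fr_rhs_def)
  have bounded: "\<exists>K. \<forall>s. tv_norm (\<lambda>B. z' t (s, B)) \<le> ereal K" if t: "0 \<le> t" for t
  proof -
    have "kernel_norm (z' t) < \<infinity>"
      using z'(1)[OF t] by (simp add: has_path_derivative_def bounded_signed_kernels_def)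
    moreover have "0 \<le> kernel_norm (z' t)" by (rule order_trans[OF tv_norm_nonneg tv_norm_le_kernel_norm])
    ultimately obtain K where "kernel_norm (z' t) = ereal K" by (cases "kernel_norm (z' t)") auto
    then show ?thesis using tv_norm_le_kernel_norm[of "z' t"] by (intro exI[of _ K]) simp
  qed
  have cont: "\<exists>K. \<forall>\<^sub>F r in at t within {0..}. \<forall>s. l1_dist (f r) (f t) s \<le> K * \<bar>r - t\<bar>" if t: "0 \<le> t" for t
  proof -
    obtain K where K: "\<And>s. tv_norm (\<lambda>B. z' t (s, B)) \<le> ereal K" using bounded[OF t] by blast
    let ?q = "\<lambda>r x. (?k r x - ?k t x) / (r - t)"
    have "\<forall>\<^sub>F r in at t within {0..}. \<forall>s. tv_norm (\<lambda>B. ?q r (s, B) - z' t (s, B)) \<le> ereal 1"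
      using kernel_norm_tendsto_zeroD[of "\<lambda>r x. ?q r x - z' t x" _ 1] z'(1)[OF t]
      by (simp add: has_path_derivative_def)
    moreover have "\<forall>\<^sub>F r in at t within {0..}. 0 \<le> r \<and> r \<noteq> t" by (rule eventually_at_within_nonneg) auto
    ultimately have "\<forall>\<^sub>F r in at t within {0..}. \<forall>s. l1_dist (f r) (f t) s \<le> (1 + K) * \<bar>r - t\<bar>"
    proof eventually_elim
      case (elim r)
      show ?case
      proof
        fix s
        have "tv_norm (\<lambda>B. ?q r (s, B)) = tv_norm (\<lambda>B. 1 * (?q r (s, B) - z' t (s, B)) + z' t (s, B))" by simp
        also have "\<dots> \<le> ereal \<bar>1\<bar> * tv_norm (\<lambda>B. ?q r (s, B) - z' t (s, B)) + tv_norm (\<lambda>B. z' t (s, B))"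
          by (rule tv_norm_add_scaled)
        also have "\<dots> \<le> ereal 1 * ereal 1 + ereal K"
          using elim(1) K by (intro add_mono ereal_mult_left_mono) auto
        finally have q: "tv_norm (\<lambda>B. ?q r (s, B)) \<le> ereal (1 + K)" by simp
        have "ereal (l1_dist (f r) (f t) s) = tv_norm (\<lambda>B. (r - t) * ?q r (s, B) + 0)"
          using elim(2) t f by (simp add: tv_norm_lpol[symmetric] kernel_of_def)
        also have "\<dots> \<le> ereal \<bar>r - t\<bar> * tv_norm (\<lambda>B. ?q r (s, B)) + tv_norm (\<lambda>_ :: 'a set. 0)"
          by (rule tv_norm_add_scaled)
        also have "\<dots> \<le> ereal \<bar>r - t\<bar> * ereal (1 + K) + 0"
          by (intro add_mono ereal_mult_left_mono q tv_norm_zero) simp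
        finally show "l1_dist (f r) (f t) s \<le> (1 + K) * \<bar>r - t\<bar>" by (simp add: mult.commute)
      qed
    qed
    then show ?thesis by blast
  qed
  have deriv: "\<forall>\<^sub>F r in at t within {0..}. \<forall>s.
      (LINT a|\<mu>. \<bar>exp (f r (s, a)) - exp (f t (s, a)) - (r - t) * fr_density (f t) (s, a)\<bar>) \<le> \<epsilon> * \<bar>r - t\<bar>"
    if t: "0 < t" and \<epsilon>: "0 < \<epsilon>" for t \<epsilon>
  proof -
    have t0: "0 \<le> t" using t by simp
    show ?thesis
      using kernel_path_derivative_iff[where z = "fr_rhs (\<pi> t)", OF f t0 fr_density_Bb[OF f(1)[OF t0]]] rhs[OF t] \<epsilon>
        fr_rhs_eq[OF f(1)[OF t0]] f(2)[OF t0] by simp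
  qed
  have bound: "\<exists>K. \<forall>\<^sub>F r in at t within {0..}. 0 < r \<longrightarrow> (\<forall>s. (LINT a|\<mu>. \<bar>fr_density (f r) (s, a)\<bar>) \<le> K)"
    if t: "0 \<le> t" for t
  proof -
    obtain K where K: "\<And>s. tv_norm (\<lambda>B. z' t (s, B)) \<le> ereal K" using bounded[OF t] by blast
    have "\<forall>\<^sub>F r in at t within {0..}. \<forall>s. tv_norm (\<lambda>B. z' r (s, B) - z' t (s, B)) \<le> ereal 1"
      using kernel_norm_tendsto_zeroD[OF z'(2)[OF t], of 1] by simp
    then have "\<forall>\<^sub>F r in at t within {0..}. 0 < r \<longrightarrow> (\<forall>s. (LINT a|\<mu>. \<bar>fr_density (f r) (s, a)\<bar>) \<le> 1 + K)"
    proof eventually_elim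
      case (elim r)
      show ?case
      proof (intro impI allI)
        fix s assume r: "0 < r"
        then have r0: "0 \<le> r" by simp
        have "ereal (LINT a|\<mu>. \<bar>fr_density (f r) (s, a)\<bar>) = tv_norm (\<lambda>B. fr_rhs (\<pi> r) (s, B))"
          unfolding f(2)[OF r0]
          by (rule tv_norm_kernel[OF fr_density_Bb[OF f(1)[OF r0]] fr_rhs_eq[OF f(1)[OF r0]], symmetric])
        \<comment> \<open>The two derivatives agree on nonempty Borel sets, which is all that
          \<open>tv_norm\<close> inspects.\<close>
        also have "\<dots> = tv_norm (\<lambda>B. 1 * (z' r (s, B) - z' t (s, B)) + z' t (s, B))"
          using kernel_path_derivative_unique[OF rhs[OF r] z'(1)[OF r0] r0] by (intro tv_norm_cong) simp
        also have "\<dots> \<le> ereal \<bar>1\<bar> * tv_norm (\<lambda>B. z' r (s, B) - z' t (s, B)) + tv_norm (\<lambda>B. z' t (s, B))"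
          by (rule tv_norm_add_scaled)
        also have "\<dots> \<le> ereal 1 * ereal 1 + ereal K"
          using elim K by (intro add_mono ereal_mult_left_mono) auto
        finally show "(LINT a|\<mu>. \<bar>fr_density (f r) (s, a)\<bar>) \<le> 1 + K" by simp
      qed
    qed
    then show ?thesis by blast
  qed
  show ?thesis
    by (rule that[OF _ f(2)]) (simp_all add: fr_path_def f(1) cont deriv bound)
qed

text \<open>At a state where the value is almost maximal, the log-density of the policy is at least a
  multiple of that value up to an integrable error. Closeness in total variation to a policy with
  bounded density excludes this for large values.\<close>

lemma val_bound_of_l1_bounds:
  assumes l: "l \<in> normalised" and k: "k \<in> normalised"
    and K: "\<And>s. (LINT a|\<mu>. \<bar>fr_density l (s, a)\<bar>) \<le> K" and R: "\<And>x. k x \<le> R"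
    and close: "\<And>s. l1_dist l k s \<le> 1 / 4" and C: "\<And>x. c x \<le> C"
  shows "val l s \<le> (\<tau> * R + 2 * (\<tau> + K) + 1 + C) / (1 - \<gamma>)"
proof -
  obtain B where B: "val l \<in> borel_measurable borel" "\<And>s. \<bar>val l s\<bar> \<le> B" "0 \<le> B" by (rule BbE[OF val_Bb[OF l]]) blast
  have bdd: "bdd_above (range (val l))" using B(2) by (auto intro!: bdd_aboveI[of _ B] simp: abs_le_iff)
  define m where "m = (SUP s. val l s)"
  have m: "val l s \<le> m" for s unfolding m_def using bdd by (auto intro: cSUP_upper)
  have "m - 1 < (SUP s. val l s)" by (simp add: m_def)
  \<comment> \<open>The supremum need not be attained; a state within 1 of it costs the summand 1 in
    the bound.\<close>
  then obtain s0 where s0: "m - 1 < val l s0" using bdd by (subst (asm) less_cSUP_iff) auto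
  \<comment> \<open>At \<open>s0\<close> the definition of the advantage gives
    \<open>\<tau> * l - adv l \<ge> \<Delta> + \<tau> * R\<close>, so a large value forces a large
    log-density or a large negative advantage.\<close>
  define \<Delta> where "\<Delta> = (1 - \<gamma>) * m - 1 - C - \<tau> * R"
  have "\<Delta> \<le> 2 * (\<tau> + K)"
  proof (cases "0 \<le> \<Delta>")
    case True
    let ?p = "\<lambda>a. exp (l (s0, a))" and ?q = "\<lambda>a. exp (k (s0, a))"
    have point: "\<Delta> * (?p a - \<bar>?p a - ?q a\<bar>) \<le> \<tau> * \<bar>?p a - ?q a\<bar> + \<bar>fr_density l (s0, a)\<bar>" for a
    proof -
      let ?x = "(s0, a)"
      \<comment> \<open>The overlap of the two densities serves as weight: against it
        \<open>l\<close> is at most \<open>R\<close> up to the difference of the densities, and the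
        advantage is controlled by \<open>fr_density\<close>.\<close>
      define w where "w = min (?p a) (?q a)"
      have w: "0 < w" "w \<le> ?p a" "w \<le> ?q a" "?p a - \<bar>?p a - ?q a\<bar> \<le> w" by (auto simp: w_def)
      have "next_mean (val l) ?x \<le> m"
        using next_mean_mono[OF val_Bb[OF l] Bb_const m] by (simp add: next_mean_const)
      then have "\<gamma> * next_mean (val l) ?x \<le> \<gamma> * m" using \<gamma> by (intro mult_left_mono)
      then have "adv l ?x \<le> C + \<gamma> * m + \<tau> * l ?x - (m - 1)"
        using C[of ?x] s0 unfolding adv_def by (simp only: fst_conv)
      then have "\<Delta> + \<tau> * R \<le> \<tau> * l ?x - adv l ?x" by (simp add: \<Delta>_def algebra_simps)
      then have "w * (\<Delta> + \<tau> * R) \<le> w * (\<tau> * l ?x - adv l ?x)" using w by (intro mult_left_mono) auto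
      also have "\<dots> = \<tau> * (w * l ?x) + w * (- adv l ?x)" by (simp add: algebra_simps)
      also have "\<dots> \<le> \<tau> * (w * R + \<bar>?p a - ?q a\<bar>) + ?p a * \<bar>adv l ?x\<bar>"
      proof (intro add_mono mult_left_mono)
        have "w * (- adv l ?x) \<le> w * \<bar>adv l ?x\<bar>" using w by (intro mult_left_mono) auto
        also have "\<dots> \<le> ?p a * \<bar>adv l ?x\<bar>" using w by (intro mult_right_mono) auto
        finally show "w * (- adv l ?x) \<le> ?p a * \<bar>adv l ?x\<bar>" .
        have wk: "w * k ?x \<le> w * R" using w R by (intro mult_left_mono) auto
        show "w * l ?x \<le> w * R + \<bar>?p a - ?q a\<bar>"
        proof (cases "l ?x \<le> k ?x")
          case True
          then have "w * l ?x \<le> w * k ?x" using w by (intro mult_left_mono) auto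
          then show ?thesis using wk by linarith
        next
          case False
          have "w * (l ?x - k ?x) \<le> ?q a * (l ?x - k ?x)" using w False by (intro mult_right_mono) auto
          also have "\<dots> \<le> ?q a * (exp (l ?x - k ?x) - 1)"
          proof (rule mult_left_mono)
            show "l ?x - k ?x \<le> exp (l ?x - k ?x) - 1" using exp_ge_add_one_self[of "l ?x - k ?x"] by linarith
          qed simp
          also have "\<dots> = ?p a - ?q a" by (simp add: exp_diff right_diff_distrib)
          finally show ?thesis using wk unfolding right_diff_distrib by linarith
        qed
      qed (use \<tau> in simp)
      finally have "w * \<Delta> \<le> \<tau> * \<bar>?p a - ?q a\<bar> + ?p a * \<bar>adv l ?x\<bar>" by (simp add: algebra_simps)
      moreover have "\<Delta> * (?p a - \<bar>?p a - ?q a\<bar>) \<le> \<Delta> * w" using True w by (intro mult_left_mono)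
      ultimately show ?thesis by (simp add: fr_density_def abs_mult mult.commute)
    qed
    have int_p: "integrable \<mu> ?p" by (rule slice_integrable[OF Bb_exp[OF normalised_Bb[OF l]]])
    have int_d: "integrable \<mu> (\<lambda>a. \<bar>?p a - ?q a\<bar>)"
      using abs_slice_integrable[OF Bb_diff[OF Bb_exp[OF normalised_Bb[OF l]] Bb_exp[OF normalised_Bb[OF k]]]] .
    have "(LINT a|\<mu>. \<Delta> * (?p a - \<bar>?p a - ?q a\<bar>)) \<le> (LINT a|\<mu>. \<tau> * \<bar>?p a - ?q a\<bar> + \<bar>fr_density l (s0, a)\<bar>)"
      by (intro integral_mono integrable_mult_right Bochner_Integration.integrable_add Bochner_Integration.integrable_diff
          int_p int_d abs_slice_integrable fr_density_Bb l point)
    also have "\<dots> = \<tau> * l1_dist l k s0 + (LINT a|\<mu>. \<bar>fr_density l (s0, a)\<bar>)"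
      using int_d abs_slice_integrable[OF fr_density_Bb[OF l]] by (simp add: l1_dist_def)
    also have "\<dots> \<le> \<tau> * (1 / 4) + K" using close K \<tau> by (intro add_mono mult_left_mono) auto
    also have "(LINT a|\<mu>. \<Delta> * (?p a - \<bar>?p a - ?q a\<bar>)) = \<Delta> * (1 - l1_dist l k s0)"
      using int_p int_d l by (simp add: l1_dist_def normalised_def)
    finally have "\<Delta> * (1 - l1_dist l k s0) \<le> \<tau> * (1 / 4) + K" .
    \<comment> \<open>The overlap has mass at least 3/4, whence
      \<open>\<Delta> \<le> (\<tau> + 4 * K) / 3\<close>; the bound \<open>2 * (\<tau> + K)\<close>
      is a rounder one.\<close>
    moreover have "\<Delta> * (3 / 4) \<le> \<Delta> * (1 - l1_dist l k s0)" using True close[of s0] by (intro mult_left_mono) auto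
    moreover have "0 \<le> K" using K[of s0] by (rule order_trans[rotated]) (simp add: integral_nonneg_AE)
    ultimately show ?thesis using \<tau> by simp
  next
    case False
    moreover have "0 \<le> K" using K[of s0] by (rule order_trans[rotated]) (simp add: integral_nonneg_AE)
    ultimately show ?thesis using \<tau> by simp
  qed
  then have "m * (1 - \<gamma>) \<le> \<tau> * R + 2 * (\<tau> + K) + 1 + C" unfolding \<Delta>_def by (simp add: mult.commute)
  then have "m \<le> (\<tau> * R + 2 * (\<tau> + K) + 1 + C) / (1 - \<gamma>)" using \<gamma> by (simp add: pos_le_divide_eq)
  then show ?thesis using m[of s] by linarith
qed

text \<open>Near each time \<open>u\<close> the policies are close to that of \<open>u\<close>,
  whose log-density is bounded, so \<open>val_bound_of_l1_bounds\<close> applies; compactness of the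
  time interval, in the form of bisection, joins the local bounds. The optimal value supplies the
  lower bound.\<close>

lemma fr_path_val_bound:
  assumes f: "fr_path f" and T: "0 \<le> T"
  shows "\<exists>C. \<forall>t. 0 \<le> t \<and> t \<le> T \<longrightarrow> (\<forall>s. \<bar>val (f t) s\<bar> \<le> C)"
proof -
  have n: "f t \<in> normalised" if "0 \<le> t" for t using f that by (simp add: fr_path_def)
  obtain Cc where Cc: "c \<in> borel_measurable borel" "\<And>x. \<bar>c x\<bar> \<le> Cc" "0 \<le> Cc" by (rule BbE[OF c_Bb]) blast
  obtain Cv where Cv: "vopt \<in> borel_measurable borel" "\<And>x. \<bar>vopt x\<bar> \<le> Cv" "0 \<le> Cv" by (rule BbE[OF vopt_Bb]) blast
  let ?P = "\<lambda>a b. \<exists>C. \<forall>t. 0 \<le> t \<and> a \<le> t \<and> t \<le> b \<longrightarrow> (\<forall>s. \<bar>val (f t) s\<bar> \<le> C)"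
  have "?P 0 T"
    using T
  proof (rule Bolzano[where P = ?P])
    fix a b e :: real
    assume "?P a b" "?P b e"
    then obtain C1 C2 where "\<forall>t. 0 \<le> t \<and> a \<le> t \<and> t \<le> b \<longrightarrow> (\<forall>s. \<bar>val (f t) s\<bar> \<le> C1)"
      "\<forall>t. 0 \<le> t \<and> b \<le> t \<and> t \<le> e \<longrightarrow> (\<forall>s. \<bar>val (f t) s\<bar> \<le> C2)" by blast
    then show "?P a e"
      by (intro exI[of _ "max C1 C2"]) (metis le_max_iff_disj linear)
  next
    fix u :: real assume u: "0 \<le> u" "u \<le> T"
    obtain K where K: "\<forall>\<^sub>F r in at u within {0..}. 0 < r \<longrightarrow> (\<forall>s. (LINT a|\<mu>. \<bar>fr_density (f r) (s, a)\<bar>) \<le> K)"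
      using f u by (auto simp: fr_path_def)
    obtain K' where K': "\<forall>\<^sub>F r in at u within {0..}. \<forall>s. l1_dist (f r) (f u) s \<le> K' * \<bar>r - u\<bar>"
      using f u by (auto simp: fr_path_def)
    obtain R where R: "f u \<in> borel_measurable borel" "\<And>x. \<bar>f u x\<bar> \<le> R" "0 \<le> R" by (rule BbE[OF normalised_Bb[OF n[OF u(1)]]]) blast
    obtain Cu where Cu: "val (f u) \<in> borel_measurable borel" "\<And>s. \<bar>val (f u) s\<bar> \<le> Cu" "0 \<le> Cu"
      by (rule BbE[OF val_Bb[OF n[OF u(1)]]]) blast
    have "((\<lambda>r. K' * \<bar>r - u\<bar>) \<longlongrightarrow> K' * \<bar>u - u\<bar>) (at u within {0..})"
      by (intro tendsto_mult tendsto_rabs tendsto_diff tendsto_const tendsto_ident_at)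
    then have "\<forall>\<^sub>F r in at u within {0..}. K' * \<bar>r - u\<bar> < 1 / 4" by (rule order_tendstoD) simp
    with K K' have "\<forall>\<^sub>F r in at u within {0..}. 0 < r \<longrightarrow> (\<forall>s. val (f r) s \<le> (\<tau> * R + 2 * (\<tau> + K) + 1 + Cc) / (1 - \<gamma>))"
    proof eventually_elim
      case (elim r)
      show ?case
      proof (intro impI allI)
        fix s assume r: "0 < r"
        have close: "l1_dist (f r) (f u) s \<le> 1 / 4" for s using elim(2)[rule_format, of s] elim(3) by linarith
        have "f u x \<le> R" "c x \<le> Cc" for x using R(2)[of x] Cc(2)[of x] by auto
        moreover have "(LINT a|\<mu>. \<bar>fr_density (f r) (s, a)\<bar>) \<le> K" for s using elim(1) r by blast
        ultimately show "val (f r) s \<le> (\<tau> * R + 2 * (\<tau> + K) + 1 + Cc) / (1 - \<gamma>)"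
          using r u by (intro val_bound_of_l1_bounds[of "f r" "f u"] n close) auto
      qed
    qed
    then obtain d where d: "0 < d" and bound: "\<And>r s. 0 \<le> r \<Longrightarrow> r \<noteq> u \<Longrightarrow> dist r u < d \<Longrightarrow> 0 < r \<Longrightarrow>
        val (f r) s \<le> (\<tau> * R + 2 * (\<tau> + K) + 1 + Cc) / (1 - \<gamma>)"
      unfolding eventually_at by auto
    define C where "C = max Cv (max Cu ((\<tau> * R + 2 * (\<tau> + K) + 1 + Cc) / (1 - \<gamma>)))"
    \<comment> \<open>The local bound holds at positive times other than \<open>u\<close>. For
      \<open>u > 0\<close> an interval shorter than \<open>u\<close> around \<open>u\<close> avoids
      0; for \<open>u = 0\<close> every other admissible time is positive. The time \<open>u\<close>
      itself is covered by \<open>Cu\<close>.\<close>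
    define d' where "d' = (if u = 0 then d else min d u)"
    show "\<exists>d>0. \<forall>a b. a \<le> u \<and> u \<le> b \<and> b - a < d \<longrightarrow> ?P a b"
    proof (intro exI[of _ d'] conjI)
      show "0 < d'" using d u by (auto simp: d'_def)
      show "\<forall>a b. a \<le> u \<and> u \<le> b \<and> b - a < d' \<longrightarrow> ?P a b"
      proof (intro allI impI)
        fix a b :: real assume ab: "a \<le> u \<and> u \<le> b \<and> b - a < d'"
        show "?P a b"
        proof (intro exI[of _ C] allI impI)
          fix t s assume t: "0 \<le> t \<and> a \<le> t \<and> t \<le> b"
          have upper: "val (f t) s \<le> C"
          proof (cases "t = u")
            case True
            then show ?thesis using Cu(2)[of s] by (simp add: C_def abs_le_iff le_max_iff_disj)
          next
            case False
            then have "dist t u < d" "0 < t"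
              using t ab u by (auto simp: dist_real_def d'_def split: if_splits)
            then show ?thesis using bound[of t s] t False by (simp add: C_def le_max_iff_disj)
          qed
          moreover have "- C \<le> val (f t) s"
          proof -
            have "Cv \<le> C" by (simp add: C_def)
            then show ?thesis using vopt_le[OF n[of t], of s] t Cv(2)[of s] by (simp add: abs_le_iff)
          qed
          ultimately show "\<bar>val (f t) s\<bar> \<le> C" by (simp add: abs_le_iff)
        qed
      qed
    qed
  qed
  then obtain C where "\<forall>t. 0 \<le> t \<and> 0 \<le> t \<and> t \<le> T \<longrightarrow> (\<forall>s. \<bar>val (f t) s\<bar> \<le> C)" by blast
  then show ?thesis by auto
qed

text \<open>Applies to quantities that are 1-Lipschitz in the density, since continuity in total
  variation is all that a Fisher-Rao path supplies.\<close>

lemma l1_continuous: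
  assumes f: "fr_path f" and g: "\<And>t. 0 \<le> t \<Longrightarrow> g t \<in> Bb"
    and lip: "\<And>r t a. 0 \<le> r \<Longrightarrow> 0 \<le> t \<Longrightarrow> \<bar>g r (s, a) - g t (s, a)\<bar> \<le> \<bar>exp (f r (s, a)) - exp (f t (s, a))\<bar>"
  shows "continuous_on {0..} (\<lambda>t. LINT a|\<mu>. g t (s, a))"
  unfolding continuous_on_def
proof
  fix t :: real assume "t \<in> {0..}"
  then have t: "0 \<le> t" by simp
  have n: "f t \<in> normalised" if "0 \<le> t" for t using f that by (simp add: fr_path_def)
  obtain K where K: "\<forall>\<^sub>F r in at t within {0..}. \<forall>s. l1_dist (f r) (f t) s \<le> K * \<bar>r - t\<bar>"
    using f t by (auto simp: fr_path_def)
  have "((\<lambda>r. K * \<bar>r - t\<bar>) \<longlongrightarrow> K * \<bar>t - t\<bar>) (at t within {0..})"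
    by (intro tendsto_mult tendsto_rabs tendsto_diff tendsto_const tendsto_ident_at)
  then have lim: "((\<lambda>r. K * \<bar>r - t\<bar>) \<longlongrightarrow> 0) (at t within {0..})" by simp
  have "((\<lambda>r. (LINT a|\<mu>. g r (s, a)) - (LINT a|\<mu>. g t (s, a))) \<longlongrightarrow> 0) (at t within {0..})"
  proof (rule Lim_null_comparison[OF _ lim])
    have "\<forall>\<^sub>F r in at t within {0..}. 0 \<le> r" by (rule eventually_at_within_nonneg) auto
    with K show "\<forall>\<^sub>F r in at t within {0..}. norm ((LINT a|\<mu>. g r (s, a)) - (LINT a|\<mu>. g t (s, a))) \<le> K * \<bar>r - t\<bar>"
    proof eventually_elim
      case (elim r)
      have "(LINT a|\<mu>. g r (s, a)) - (LINT a|\<mu>. g t (s, a)) = (LINT a|\<mu>. g r (s, a) - g t (s, a))"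
        using slice_integrable[OF g[OF elim(2)]] slice_integrable[OF g[OF t]] by simp
      also have "norm \<dots> \<le> (LINT a|\<mu>. \<bar>g r (s, a) - g t (s, a)\<bar>)" by (simp add: integral_abs_bound)
      also have "\<dots> \<le> l1_dist (f r) (f t) s"
        unfolding l1_dist_def
        by (rule integral_mono[OF abs_slice_integrable[OF Bb_diff[OF g[OF elim(2)] g[OF t]]]
            abs_slice_integrable[OF Bb_diff[OF Bb_exp[OF normalised_Bb[OF n[OF elim(2)]]] Bb_exp[OF normalised_Bb[OF n[OF t]]]]]
            lip[OF elim(2) t]])
      finally show ?case using elim(1)[rule_format, of s] by linarith
    qed
  qed
  then show "((\<lambda>t. LINT a|\<mu>. g t (s, a)) \<longlongrightarrow> (LINT a|\<mu>. g t (s, a))) (at t within {0..})" by (rule LIM_zero_cancel)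
qed

text \<open>The sign \<open>\<sigma>\<close> treats upper and lower barriers at once. The mass of
  the density beyond the level \<open>y\<close>, an integral of a positive part, starts at 0 and
  cannot grow because the flow points back wherever the barrier is crossed. The conclusion holds up
  to null sets, as the path is controlled in L1 only.\<close>

lemma fr_path_barrier:
  assumes f: "fr_path f" and \<sigma>: "\<bar>\<sigma>\<bar> = 1"
    and init: "\<And>x. \<sigma> * (exp (f 0 x) - y) \<le> 0"
    and inward: "\<And>t x. 0 < t \<Longrightarrow> t \<le> T \<Longrightarrow> 0 < \<sigma> * (exp (f t x) - y) \<Longrightarrow> 0 \<le> \<sigma> * adv (f t) x"
    and t: "0 \<le> t" "t \<le> T"
  shows "AE a in \<mu>. \<sigma> * (exp (f t (s, a)) - y) \<le> 0"
proof -
  have n: "f t \<in> normalised" if "0 \<le> t" for t using f that by (simp add: fr_path_def)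
  define g where "g t x = max 0 (\<sigma> * (exp (f t x) - y))" for t x
  have g: "g t \<in> Bb" if "0 \<le> t" for t
  proof -
    have "(\<lambda>x. \<sigma> * (exp (f t x) - y)) \<in> Bb" by (intro Bb_cmult Bb_diff Bb_exp Bb_const normalised_Bb n that)
    then obtain C where C: "(\<lambda>x. \<sigma> * (exp (f t x) - y)) \<in> borel_measurable borel" "\<And>x. \<bar>\<sigma> * (exp (f t x) - y)\<bar> \<le> C" "0 \<le> C"
      by (rule BbE) blast
    have "\<bar>g t x\<bar> \<le> C" for x using C(2)[of x] C(3) unfolding g_def by (simp add: abs_le_iff max_def)
    moreover have "g t \<in> borel_measurable borel" unfolding g_def[abs_def] using C(1) by (intro borel_measurable_max borel_measurable_const)
    ultimately show ?thesis by (rule BbI[rotated])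
  qed
  define \<Phi> where "\<Phi> t = (LINT a|\<mu>. g t (s, a))" for t
  have cont: "continuous_on {0..} \<Phi>"
    unfolding \<Phi>_def[abs_def]
  proof (rule l1_continuous[OF f g])
    fix r t a
    have "\<bar>max 0 u - max 0 v\<bar> \<le> \<bar>u - v\<bar>" for u v :: real by (simp add: max_def)
    from this[of "\<sigma> * (exp (f r (s, a)) - y)" "\<sigma> * (exp (f t (s, a)) - y)"]
    have "\<bar>g r (s, a) - g t (s, a)\<bar> \<le> \<bar>\<sigma> * (exp (f r (s, a)) - exp (f t (s, a)))\<bar>"
      by (simp add: g_def algebra_simps)
    then show "\<bar>g r (s, a) - g t (s, a)\<bar> \<le> \<bar>exp (f r (s, a)) - exp (f t (s, a))\<bar>"
      by (simp add: abs_mult \<sigma>)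
  qed
  have "\<Phi> t \<le> 0"
  proof (rule dini_gronwall[where g = \<Phi> and a = 0 and T = T and L = 0])
    show "continuous_on {0..T} \<Phi>" using cont by (rule continuous_on_subset) auto
    have "g 0 x = 0" for x unfolding g_def by (rule max_absorb1[OF init])
    then show "\<Phi> 0 \<le> 0" by (simp add: \<Phi>_def)
    fix u \<epsilon> :: real assume u: "0 < u" "u \<le> T" and \<epsilon>: "0 < \<epsilon>"
    have at_left: "at_left u \<le> at u within {0..}" using u by (intro at_left_le_at_within[of 0]) auto
    have "\<forall>\<^sub>F r in at u within {0..}. \<forall>s.
        (LINT a|\<mu>. \<bar>exp (f r (s, a)) - exp (f u (s, a)) - (r - u) * fr_density (f u) (s, a)\<bar>) \<le> \<epsilon> * \<bar>r - u\<bar>"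
      using f u \<epsilon> by (simp add: fr_path_def)
    from filter_leD[OF at_left this]
    have "\<forall>\<^sub>F r in at_left u. \<forall>s.
        (LINT a|\<mu>. \<bar>exp (f r (s, a)) - exp (f u (s, a)) - (r - u) * fr_density (f u) (s, a)\<bar>) \<le> \<epsilon> * \<bar>r - u\<bar>" .
    moreover have "\<forall>\<^sub>F r in at_left u. 0 < r \<and> r < u"
      using eventually_at_left_real[OF u(1)] by (rule eventually_mono) auto
    ultimately show "\<forall>\<^sub>F r in at_left u. \<Phi> u - \<Phi> r \<le> (u - r) * (0 * \<Phi> u + \<epsilon>)"
    proof eventually_elim
      case (elim r)
      have r: "0 \<le> r" "0 \<le> u" using elim by auto
      let ?E = "\<lambda>x. exp (f r x) - exp (f u x) - (r - u) * fr_density (f u) x"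
      have E: "?E \<in> Bb" by (intro Bb_diff Bb_exp Bb_cmult fr_density_Bb normalised_Bb n r)
      have point: "g u x - g r x \<le> \<bar>?E x\<bar>" for x
      proof (cases "0 < \<sigma> * (exp (f u x) - y)")
        case True
        have "g u x - g r x \<le> \<sigma> * (exp (f u x) - y) - \<sigma> * (exp (f r x) - y)"
          using True by (simp add: g_def)
        also have "\<dots> = - (\<sigma> * ?E x) - (u - r) * (\<sigma> * adv (f u) x) * exp (f u x)"
          by (simp add: fr_density_def algebra_simps)
        also have "\<dots> \<le> - (\<sigma> * ?E x)"
          using inward[OF u True] elim by (simp add: mult_nonneg_nonneg)
        also have "\<dots> \<le> \<bar>\<sigma> * ?E x\<bar>" by (rule abs_ge_minus_self)
        finally show ?thesis by (simp add: abs_mult \<sigma>)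
      next
        case False
        then have "g u x - g r x \<le> 0" by (simp add: g_def)
        then show ?thesis by (rule order_trans) simp
      qed
      have "\<Phi> u - \<Phi> r = (LINT a|\<mu>. g u (s, a) - g r (s, a))"
        unfolding \<Phi>_def using slice_integrable[OF g[OF r(1)]] slice_integrable[OF g[OF r(2)]] by simp
      also have "\<dots> \<le> (LINT a|\<mu>. \<bar>?E (s, a)\<bar>)"
        by (rule integral_mono[OF slice_integrable[OF Bb_diff[OF g[OF r(2)] g[OF r(1)]]] abs_slice_integrable[OF E] point])
      also have "\<dots> \<le> \<epsilon> * \<bar>r - u\<bar>" using elim by blast
      finally show ?case using elim by (simp add: mult.commute)
    qed
  qed (use t in auto)
  moreover have g0: "0 \<le> g t x" for x by (simp add: g_def)
  moreover have "0 \<le> \<Phi> t" unfolding \<Phi>_def by (rule Bochner_Integration.integral_nonneg[OF g0])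
  ultimately have "\<Phi> t = 0" by (intro order_antisym)
  then have "(LINT a|\<mu>. g t (s, a)) = 0" by (simp only: \<Phi>_def)
  then have "AE a in \<mu>. g t (s, a) = 0"
    using integral_nonneg_eq_0_iff_AE[OF slice_integrable[OF g[OF t(1)], of s]] g0 by simp
  then show ?thesis
    by (rule eventually_mono) (metis g_def max.cobounded2)
qed

text \<open>Bounded values leave \<open>adv - \<tau> * l\<close> bounded by some \<open>B\<close>.
  Once \<open>\<tau> * \<bar>l\<bar>\<close> exceeds \<open>B\<close>, the advantage has the sign of
  \<open>l\<close> and the flow pushes the log-density back.\<close>

lemma fr_path_bounds:
  assumes f: "fr_path f" and T: "0 \<le> T"
  obtains R where "0 \<le> R" "\<And>t s. 0 \<le> t \<Longrightarrow> t \<le> T \<Longrightarrow> AE a in \<mu>. \<bar>f t (s, a)\<bar> \<le> R"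
    "\<And>t x. 0 \<le> t \<Longrightarrow> t \<le> T \<Longrightarrow> \<bar>adv (f t) x - \<tau> * f t x\<bar> \<le> R"
proof -
  have n: "f t \<in> normalised" if "0 \<le> t" for t using f that by (simp add: fr_path_def)
  obtain Cc where Cc: "c \<in> borel_measurable borel" "\<And>x. \<bar>c x\<bar> \<le> Cc" "0 \<le> Cc" by (rule BbE[OF c_Bb]) blast
  obtain C where C: "\<And>t s. 0 \<le> t \<Longrightarrow> t \<le> T \<Longrightarrow> \<bar>val (f t) s\<bar> \<le> C" using fr_path_val_bound[OF f T] by blast
  obtain R0 where R0: "f 0 \<in> borel_measurable borel" "\<And>x. \<bar>f 0 x\<bar> \<le> R0" "0 \<le> R0"
    by (rule BbE[OF normalised_Bb[OF n[OF order_refl]]]) blast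
  define B where "B = Cc + 2 * C"
  have B: "\<bar>adv (f t) x - \<tau> * f t x\<bar> \<le> B" if t: "0 \<le> t" "t \<le> T" for t x
  proof -
    have "\<bar>next_mean (val (f t)) x\<bar> \<le> C" by (rule next_mean_bound[OF val_Bb[OF n[OF t(1)]] C[OF t]])
    then have "\<bar>\<gamma> * next_mean (val (f t)) x\<bar> \<le> 1 * C" unfolding abs_mult using \<gamma> by (intro mult_mono) auto
    then show ?thesis using Cc(2)[of x] C[OF t, of "fst x"] unfolding adv_def B_def by linarith
  qed
  \<comment> \<open>\<open>R0\<close> makes the barriers hold at time 0, \<open>B / \<tau>\<close>
    makes the flow point inward beyond them.\<close>
  define R where "R = max R0 (B / \<tau>)"
  have R: "0 \<le> R" "R0 \<le> R" using R0 by (auto simp: R_def)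
  have "B / \<tau> \<le> R" by (simp add: R_def)
  then have \<tau>R: "B \<le> \<tau> * R" using \<tau> by (simp add: pos_divide_le_eq mult.commute)
  have AE_R: "AE a in \<mu>. \<bar>f t (s, a)\<bar> \<le> R" if t: "0 \<le> t" "t \<le> T" for t s
  proof -
    have "AE a in \<mu>. 1 * (exp (f t (s, a)) - exp R) \<le> 0"
    proof (rule fr_path_barrier[OF f _ _ _ t])
      show "1 * (exp (f 0 x) - exp R) \<le> 0" for x using R0(2)[of x] R by simp
      fix u x assume u: "0 < u" "u \<le> T" and "0 < 1 * (exp (f u x) - exp R)"
      then have "R < f u x" by simp
      then have "\<tau> * R \<le> \<tau> * f u x" using \<tau> by simp
      then show "0 \<le> 1 * adv (f u) x" using B[of u x] u \<tau>R by (simp add: abs_le_iff)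
    qed simp
    moreover have "AE a in \<mu>. (- 1) * (exp (f t (s, a)) - exp (- R)) \<le> 0"
    proof (rule fr_path_barrier[OF f _ _ _ t])
      show "(- 1) * (exp (f 0 x) - exp (- R)) \<le> 0" for x using R0(2)[of x] R by simp
      fix u x assume u: "0 < u" "u \<le> T" and "0 < (- 1) * (exp (f u x) - exp (- R))"
      then have "f u x < - R" by simp
      then have "\<tau> * f u x \<le> - (\<tau> * R)" using \<tau> mult_left_mono[of "f u x" "- R" \<tau>] by simp
      then show "0 \<le> (- 1) * adv (f u) x" using B[of u x] u \<tau>R by (simp add: abs_le_iff)
    qed simp
    ultimately show ?thesis by eventually_elim (simp add: abs_le_iff minus_le_iff)
  qed
  show ?thesis
  proof (rule that[of "max R B"])
    show "0 \<le> max R B" using R by simp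
    show "AE a in \<mu>. \<bar>f t (s, a)\<bar> \<le> max R B" if "0 \<le> t" "t \<le> T" for t s
      using AE_R[OF that, of s] by (rule eventually_mono) simp
    show "\<bar>adv (f t) x - \<tau> * f t x\<bar> \<le> max R B" if "0 \<le> t" "t \<le> T" for t x
      using B[OF that, of x] by simp
  qed
qed

text \<open>On \<open>[- R, R]\<close> the logarithm of the density is Lipschitz with constant
  \<open>exp R\<close>, and the weight \<open>exp u\<close> costs another \<open>exp R\<close>. It
  converts a weighted difference of log-densities into a difference of densities.\<close>

lemma abs_diff_le_exp_diff:
  fixes u v R :: real
  assumes "\<bar>u\<bar> \<le> R" "\<bar>v\<bar> \<le> R"
  shows "exp u * \<bar>u - v\<bar> \<le> exp (2 * R) * \<bar>exp u - exp v\<bar>"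
proof -
  have *: "u - v \<le> exp R * (exp u - exp v)" if "v \<le> u" "- R \<le> v" for u v
  proof -
    have "u - v \<le> exp (u - v) - 1" using exp_ge_add_one_self[of "u - v"] by linarith
    also have "\<dots> = exp (- v) * (exp u - exp v)" by (simp add: exp_diff exp_minus field_simps)
    also have "\<dots> \<le> exp R * (exp u - exp v)" using that by (intro mult_right_mono) auto
    finally show ?thesis .
  qed
  have "\<bar>u - v\<bar> \<le> exp R * \<bar>exp u - exp v\<bar>"
    using *[of v u] *[of u v] assms by (cases "v \<le> u") (auto simp: abs_le_iff)
  then have "exp u * \<bar>u - v\<bar> \<le> exp R * (exp R * \<bar>exp u - exp v\<bar>)"
    using assms by (intro mult_mono) auto
  then show ?thesis by (simp add: mult.assoc[symmetric] exp_add[symmetric])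
qed

text \<open>The L1 counterpart of \<open>adv_lipschitz\<close>: differences of log-densities occur
  only under the weight \<open>exp l\<close>, where the almost sure bound \<open>R\<close> turns
  them into total variation. The bound \<open>D\<close> is uniform in the state because the values
  couple all states; \<open>H * D\<close> bounds their difference.\<close>

lemma fr_density_lipschitz:
  assumes l: "l \<in> normalised" and k: "k \<in> normalised" and R: "0 \<le> R"
    and AE_l: "\<And>s. AE a in \<mu>. \<bar>l (s, a)\<bar> \<le> R" and AE_k: "\<And>s. AE a in \<mu>. \<bar>k (s, a)\<bar> \<le> R"
    and adv_k: "\<And>x. \<bar>adv k x - \<tau> * k x\<bar> \<le> R" and D: "\<And>s. l1_dist l k s \<le> D"
  defines "H \<equiv> (R + \<tau> * R + \<tau> * exp (2 * R)) / (1 - \<gamma>)"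
  shows "(LINT a|\<mu>. \<bar>fr_density l (s, a) - fr_density k (s, a)\<bar>)
    \<le> (2 * H + \<tau> * exp (2 * R) + (R + \<tau> * R)) * D"
proof -
  note Bb = normalised_Bb[OF l] normalised_Bb[OF k] adv_Bb[OF l] adv_Bb[OF k]
  let ?p = "\<lambda>x. exp (l x)" and ?q = "\<lambda>x. exp (k x)"
  define b where "b = R + \<tau> * R"
  have b: "0 \<le> b" using R \<tau> by (simp add: b_def)
  have pq: "(\<lambda>x. ?p x - ?q x) \<in> Bb" by (intro Bb_diff Bb_exp Bb)
  note int_pq = abs_slice_integrable[OF pq]
  have D0: "0 \<le> D" using D[of s] by (rule order_trans[rotated]) (simp add: l1_dist_def integral_nonneg_AE)
  have AE_adv: "AE a in \<mu>. \<bar>adv k (s, a)\<bar> \<le> b" for s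
    using AE_k[of s]
  proof eventually_elim
    case (elim a)
    have "\<bar>\<tau> * k (s, a)\<bar> \<le> \<tau> * R" using elim \<tau> by (simp add: abs_mult)
    then show ?case using adv_k[of "(s, a)"] unfolding b_def by linarith
  qed
  have AE_lk: "AE a in \<mu>. exp (l (s, a)) * \<bar>l (s, a) - k (s, a)\<bar> \<le> exp (2 * R) * \<bar>?p (s, a) - ?q (s, a)\<bar>" for s
    using AE_l[of s] AE_k[of s] by eventually_elim (rule abs_diff_le_exp_diff)
  have lk: "(\<lambda>x. l x - k x) \<in> Bb" by (intro Bb_diff Bb)
  have 1: "\<bar>avg l (adv k) s\<bar> \<le> b * D" for s
  proof -
    have "avg l (adv k) s = (LINT a|\<mu>. (?p (s, a) - ?q (s, a)) * adv k (s, a))"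
      using avg_density_diff[OF Bb(1,2,4), of s] avg_adv[OF k, of s] by simp
    also have "\<bar>\<dots>\<bar> \<le> (LINT a|\<mu>. \<bar>(?p (s, a) - ?q (s, a)) * adv k (s, a)\<bar>)" by (rule integral_abs_bound)
    also have "\<dots> \<le> (LINT a|\<mu>. b * \<bar>?p (s, a) - ?q (s, a)\<bar>)"
    proof (rule integral_mono_AE[OF abs_slice_integrable[OF Bb_mult[OF pq Bb(4)]] integrable_mult_right[OF int_pq]])
      show "AE a in \<mu>. \<bar>(?p (s, a) - ?q (s, a)) * adv k (s, a)\<bar> \<le> b * \<bar>?p (s, a) - ?q (s, a)\<bar>"
        using AE_adv[of s] by eventually_elim (simp add: abs_mult mult.commute[of b] mult_left_mono)
    qed
    also have "\<dots> = b * l1_dist l k s" by (simp add: l1_dist_def)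
    also have "\<dots> \<le> b * D" using D b by (intro mult_left_mono)
    finally show ?thesis .
  qed
  have 2: "(LINT a|\<mu>. ?p (s, a) * \<bar>l (s, a) - k (s, a)\<bar>) \<le> exp (2 * R) * D" for s
  proof -
    have "(LINT a|\<mu>. ?p (s, a) * \<bar>l (s, a) - k (s, a)\<bar>) \<le> (LINT a|\<mu>. exp (2 * R) * \<bar>?p (s, a) - ?q (s, a)\<bar>)"
      by (rule integral_mono_AE[OF slice_integrable[OF Bb_mult[OF Bb_exp[OF Bb(1)] Bb_abs[OF lk]]]
          integrable_mult_right[OF int_pq] AE_lk])
    also have "\<dots> = exp (2 * R) * l1_dist l k s" by (simp add: l1_dist_def)
    also have "\<dots> \<le> exp (2 * R) * D" using D by (intro mult_left_mono) auto
    finally show ?thesis .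
  qed
  have 3: "\<bar>avg l (\<lambda>x. l x - k x) s\<bar> \<le> exp (2 * R) * D" for s
  proof -
    have "\<bar>avg l (\<lambda>x. l x - k x) s\<bar> \<le> (LINT a|\<mu>. \<bar>?p (s, a) * (l (s, a) - k (s, a))\<bar>)"
      unfolding avg_eq[OF Bb(1) lk] by (rule integral_abs_bound)
    then show ?thesis using 2[of s] by (simp add: abs_mult)
  qed
  define h where "h s = val l s - val k s" for s
  have h_Bb: "h \<in> Bb" unfolding h_def[abs_def] by (intro Bb_diff val_Bb l k)
  have h: "\<bar>h s\<bar> \<le> H * D" for s
  proof -
    have "\<bar>h s\<bar> \<le> ((b + \<tau> * exp (2 * R)) * D) / (1 - \<gamma>)"
    proof (rule comparison_abs[OF l h_Bb])
      fix s
      have "\<bar>\<tau> * avg l (\<lambda>x. l x - k x) s\<bar> \<le> \<tau> * (exp (2 * R) * D)"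
        unfolding abs_mult using 3[of s] \<tau> by simp
      then show "\<bar>h s - \<gamma> * avg l (next_mean h) s\<bar> \<le> (b + \<tau> * exp (2 * R)) * D"
        using 1[of s] performance_difference[OF l k, of s] unfolding h_def[abs_def] distrib_right mult.assoc by linarith
    qed
    then show ?thesis by (simp add: H_def b_def)
  qed
  have HD: "0 \<le> H * D" using h[of s] by (rule order_trans[rotated]) simp
  have nh: "\<bar>\<gamma> * next_mean h x\<bar> \<le> H * D" for x
  proof -
    have "\<bar>\<gamma> * next_mean h x\<bar> \<le> 1 * (H * D)"
      unfolding abs_mult using \<gamma> next_mean_bound[OF h_Bb h] by (intro mult_mono) auto
    then show ?thesis by simp
  qed
  have point: "AE a in \<mu>. \<bar>fr_density l (s, a) - fr_density k (s, a)\<bar>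
      \<le> 2 * (H * D) * ?p (s, a) + \<tau> * (?p (s, a) * \<bar>l (s, a) - k (s, a)\<bar>) + b * \<bar>?p (s, a) - ?q (s, a)\<bar>"
    using AE_adv[of s]
  proof eventually_elim
    case (elim a)
    let ?x = "(s, a)"
    have "adv l ?x - adv k ?x = \<gamma> * next_mean h ?x + \<tau> * (l ?x - k ?x) - h s"
      by (simp add: adv_def h_def[abs_def] next_mean_diff val_Bb l k algebra_simps)
    moreover have "\<bar>\<tau> * (l ?x - k ?x)\<bar> = \<tau> * \<bar>l ?x - k ?x\<bar>" using \<tau> by (simp add: abs_mult)
    ultimately have "\<bar>adv l ?x - adv k ?x\<bar> \<le> 2 * (H * D) + \<tau> * \<bar>l ?x - k ?x\<bar>"
      using nh[of ?x] h[of s] by linarith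
    then have "\<bar>adv l ?x - adv k ?x\<bar> * ?p ?x \<le> (2 * (H * D) + \<tau> * \<bar>l ?x - k ?x\<bar>) * ?p ?x"
      by (rule mult_right_mono) simp
    moreover have "\<bar>adv k ?x\<bar> * \<bar>?p ?x - ?q ?x\<bar> \<le> b * \<bar>?p ?x - ?q ?x\<bar>" using elim by (rule mult_right_mono) simp
    moreover have "\<bar>fr_density l ?x - fr_density k ?x\<bar> \<le> \<bar>adv l ?x - adv k ?x\<bar> * ?p ?x + \<bar>adv k ?x\<bar> * \<bar>?p ?x - ?q ?x\<bar>"
    proof -
      have "fr_density l ?x - fr_density k ?x = - ((adv l ?x - adv k ?x) * ?p ?x + adv k ?x * (?p ?x - ?q ?x))"
        by (simp add: fr_density_def algebra_simps)
      then show ?thesis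
        using abs_triangle_ineq[of "(adv l ?x - adv k ?x) * ?p ?x" "adv k ?x * (?p ?x - ?q ?x)"] by (simp add: abs_mult)
    qed
    moreover have "(2 * (H * D) + \<tau> * \<bar>l ?x - k ?x\<bar>) * ?p ?x = 2 * (H * D) * ?p ?x + \<tau> * (?p ?x * \<bar>l ?x - k ?x\<bar>)"
      by (simp add: algebra_simps)
    ultimately show ?case by linarith
  qed
  have int_p: "integrable \<mu> (\<lambda>a. ?p (s, a))" by (rule slice_integrable[OF Bb_exp[OF Bb(1)]])
  have int_plk: "integrable \<mu> (\<lambda>a. ?p (s, a) * \<bar>l (s, a) - k (s, a)\<bar>)"
    by (rule slice_integrable[OF Bb_mult[OF Bb_exp[OF Bb(1)] Bb_abs[OF lk]]])
  have "(LINT a|\<mu>. \<bar>fr_density l (s, a) - fr_density k (s, a)\<bar>)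
      \<le> (LINT a|\<mu>. 2 * (H * D) * ?p (s, a) + \<tau> * (?p (s, a) * \<bar>l (s, a) - k (s, a)\<bar>) + b * \<bar>?p (s, a) - ?q (s, a)\<bar>)"
    by (rule integral_mono_AE[OF abs_slice_integrable[OF Bb_diff[OF fr_density_Bb[OF l] fr_density_Bb[OF k]]] _ point])
      (intro Bochner_Integration.integrable_add integrable_mult_right int_p int_plk int_pq)
  also have "\<dots> = 2 * (H * D) * (LINT a|\<mu>. ?p (s, a)) + \<tau> * (LINT a|\<mu>. ?p (s, a) * \<bar>l (s, a) - k (s, a)\<bar>) + b * l1_dist l k s"
    unfolding l1_dist_def using int_p int_plk int_pq[of s] by simp
  also have "\<dots> \<le> 2 * (H * D) * 1 + \<tau> * (exp (2 * R) * D) + b * D"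
  proof (intro add_mono mult_left_mono 2 D b)
    show "(LINT a|\<mu>. ?p (s, a)) \<le> 1" using l by (simp add: normalised_def)
  qed (use HD \<tau> in auto)
  also have "\<dots> = (2 * H + \<tau> * exp (2 * R) + b) * D" by (simp add: algebra_simps)
  finally show ?thesis by (simp add: b_def)
qed

lemma l1_dist_le_2:
  assumes "l \<in> normalised" "k \<in> normalised" shows "l1_dist l k s \<le> 2"
proof -
  note int = slice_integrable[OF Bb_exp[OF normalised_Bb[OF assms(1)]]] slice_integrable[OF Bb_exp[OF normalised_Bb[OF assms(2)]]]
  have "l1_dist l k s \<le> (LINT a|\<mu>. exp (l (s, a)) + exp (k (s, a)))"
    unfolding l1_dist_def
  proof (rule integral_mono)
    show "\<bar>exp (l (s, a)) - exp (k (s, a))\<bar> \<le> exp (l (s, a)) + exp (k (s, a))" for a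
      using exp_gt_zero[of "l (s, a)"] exp_gt_zero[of "k (s, a)"] by linarith
  qed (use int in auto)
  also have "\<dots> = 2" using int assms by (simp add: normalised_def)
  finally show ?thesis .
qed

lemma l1_dist_triangle:
  assumes "l \<in> Bb" "k \<in> Bb" "m \<in> Bb" shows "l1_dist l m s \<le> l1_dist l k s + l1_dist k m s"
proof -
  have int: "integrable \<mu> (\<lambda>a. \<bar>exp (f (s, a)) - exp (g (s, a))\<bar>)" if "f \<in> Bb" "g \<in> Bb" for f g
    using abs_slice_integrable[OF Bb_diff[OF Bb_exp[OF that(1)] Bb_exp[OF that(2)]]] .
  have "l1_dist l m s \<le> (LINT a|\<mu>. \<bar>exp (l (s, a)) - exp (k (s, a))\<bar> + \<bar>exp (k (s, a)) - exp (m (s, a))\<bar>)"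
    unfolding l1_dist_def using assms int by (intro integral_mono Bochner_Integration.integrable_add) auto
  also have "\<dots> = l1_dist l k s + l1_dist k m s"
    unfolding l1_dist_def using assms int by (intro Bochner_Integration.integral_add)
  finally show ?thesis .
qed

text \<open>Gronwall for the supremum over states of the distance of the two policies. Its left
  difference quotient is at most that of the right-hand sides plus two linearisation errors, all
  uniform in the state because the kernel norm is.\<close>

lemma fr_path_unique:
  assumes f: "fr_path f" and g: "fr_path g" and init: "\<And>s. l1_dist (f 0) (g 0) s = 0" and T: "0 \<le> T"
  shows "l1_dist (f T) (g T) s = 0"
proof -
  have nf: "f t \<in> normalised" and ng: "g t \<in> normalised" if "0 \<le> t" for t
    using f g that by (auto simp: fr_path_def)
  obtain Rf where Rf: "0 \<le> Rf" "\<And>t s. 0 \<le> t \<Longrightarrow> t \<le> T \<Longrightarrow> AE a in \<mu>. \<bar>f t (s, a)\<bar> \<le> Rf"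
    by (rule fr_path_bounds[OF f T]) (rule that)
  obtain Rg where Rg: "0 \<le> Rg" "\<And>t s. 0 \<le> t \<Longrightarrow> t \<le> T \<Longrightarrow> AE a in \<mu>. \<bar>g t (s, a)\<bar> \<le> Rg"
    "\<And>t x. 0 \<le> t \<Longrightarrow> t \<le> T \<Longrightarrow> \<bar>adv (g t) x - \<tau> * g t x\<bar> \<le> Rg"
    by (rule fr_path_bounds[OF g T]) (rule that)
  define R where "R = max Rf Rg"
  have R: "0 \<le> R" using Rf by (simp add: R_def)
  define L where "L = 2 * ((R + \<tau> * R + \<tau> * exp (2 * R)) / (1 - \<gamma>)) + \<tau> * exp (2 * R) + (R + \<tau> * R)"
  have L: "0 \<le> L" using R \<tau> \<gamma> by (simp add: L_def)
  define D where "D t = (SUP s. l1_dist (f t) (g t) s)" for t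
  have bdd: "bdd_above (range (\<lambda>s. l1_dist (f t) (g t) s))" if "0 \<le> t" for t
    using l1_dist_le_2[OF nf[OF that] ng[OF that]] by (intro bdd_aboveI[of _ 2]) auto
  have D_ge: "l1_dist (f t) (g t) s \<le> D t" if "0 \<le> t" for t s
    unfolding D_def by (rule cSUP_upper[OF _ bdd[OF that]]) simp
  have D_le: "D t \<le> B" if "\<And>s. l1_dist (f t) (g t) s \<le> B" for t B
    unfolding D_def using that by (intro cSUP_least) auto
  have cont: "continuous_on {0..} D"
    unfolding continuous_on_def
  proof
    fix t :: real assume "t \<in> {0..}"
    then have t: "0 \<le> t" by simp
    obtain K where K: "\<forall>\<^sub>F r in at t within {0..}. \<forall>s. l1_dist (f r) (f t) s \<le> K * \<bar>r - t\<bar>"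
      using f t by (auto simp: fr_path_def)
    obtain K' where K': "\<forall>\<^sub>F r in at t within {0..}. \<forall>s. l1_dist (g r) (g t) s \<le> K' * \<bar>r - t\<bar>"
      using g t by (auto simp: fr_path_def)
    have "((\<lambda>r. (K + K') * \<bar>r - t\<bar>) \<longlongrightarrow> (K + K') * \<bar>t - t\<bar>) (at t within {0..})" by (intro tendsto_intros)
    then have lim: "((\<lambda>r. (K + K') * \<bar>r - t\<bar>) \<longlongrightarrow> 0) (at t within {0..})" by simp
    have "((\<lambda>r. D r - D t) \<longlongrightarrow> 0) (at t within {0..})"
    proof (rule Lim_null_comparison[OF _ lim])
      have "\<forall>\<^sub>F r in at t within {0..}. 0 \<le> r" by (rule eventually_at_within_nonneg) auto
      with K K' show "\<forall>\<^sub>F r in at t within {0..}. norm (D r - D t) \<le> (K + K') * \<bar>r - t\<bar>"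
      proof eventually_elim
        case (elim r)
        note n = nf[OF t] ng[OF t] nf[OF elim(3)] ng[OF elim(3)]
        note Bb = n[THEN normalised_Bb]
        have "D r \<le> D t + (K + K') * \<bar>r - t\<bar>"
        proof (rule D_le)
          fix s
          show "l1_dist (f r) (g r) s \<le> D t + (K + K') * \<bar>r - t\<bar>"
            using l1_dist_triangle[OF Bb(3,1,4), of s] l1_dist_triangle[OF Bb(1,2,4), of s] D_ge[OF t, of s]
              elim(1)[rule_format, of s] elim(2)[rule_format, of s] l1_dist_commute[of "g t" "g r" s]
            unfolding distrib_right by linarith
        qed
        moreover have "D t \<le> D r + (K + K') * \<bar>r - t\<bar>"
        proof (rule D_le)
          fix s
          show "l1_dist (f t) (g t) s \<le> D r + (K + K') * \<bar>r - t\<bar>"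
            using l1_dist_triangle[OF Bb(1,3,2), of s] l1_dist_triangle[OF Bb(3,4,2), of s] D_ge[OF elim(3), of s]
              elim(1)[rule_format, of s] elim(2)[rule_format, of s] l1_dist_commute[of "f t" "f r" s]
            unfolding distrib_right by linarith
        qed
        ultimately show ?case by (simp add: abs_le_iff)
      qed
    qed
    then show "(D \<longlongrightarrow> D t) (at t within {0..})" by (rule LIM_zero_cancel)
  qed
  have "D T \<le> 0"
  proof (rule dini_gronwall[where g = D and a = 0 and T = T and L = L])
    show "continuous_on {0..T} D" using cont by (rule continuous_on_subset) auto
    show "D 0 \<le> 0" by (rule D_le) (simp add: init)
    fix u \<epsilon> :: real assume u: "0 < u" "u \<le> T" and \<epsilon>: "0 < \<epsilon>"
    have at_left: "at_left u \<le> at u within {0..}" using u by (intro at_left_le_at_within[of 0]) auto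
    have ev: "\<forall>\<^sub>F r in at_left u. \<forall>s.
        (LINT a|\<mu>. \<bar>exp (h r (s, a)) - exp (h u (s, a)) - (r - u) * fr_density (h u) (s, a)\<bar>) \<le> \<epsilon> / 2 * \<bar>r - u\<bar>"
      if h: "fr_path h" for h
    proof (rule filter_leD[OF at_left])
      show "\<forall>\<^sub>F r in at u within {0..}. \<forall>s.
        (LINT a|\<mu>. \<bar>exp (h r (s, a)) - exp (h u (s, a)) - (r - u) * fr_density (h u) (s, a)\<bar>) \<le> \<epsilon> / 2 * \<bar>r - u\<bar>"
        using h u(1) half_gt_zero[OF \<epsilon>] unfolding fr_path_def by blast
    qed
    have u0: "0 \<le> u" using u by simp
    have lip: "(LINT a|\<mu>. \<bar>fr_density (f u) (s, a) - fr_density (g u) (s, a)\<bar>) \<le> L * D u" for s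
      unfolding L_def
    proof (rule fr_density_lipschitz[OF nf[OF u0] ng[OF u0] R _ _ _ D_ge[OF u0]])
      show "AE a in \<mu>. \<bar>f u (s, a)\<bar> \<le> R" for s
        using Rf(2)[OF u0 u(2), of s] by (rule eventually_mono) (simp add: R_def)
      show "AE a in \<mu>. \<bar>g u (s, a)\<bar> \<le> R" for s
        using Rg(2)[OF u0 u(2), of s] by (rule eventually_mono) (simp add: R_def)
      show "\<bar>adv (g u) x - \<tau> * g u x\<bar> \<le> R" for x
        using Rg(3)[OF u0 u(2), of x] by (simp add: R_def)
    qed
    have "\<forall>\<^sub>F r in at_left u. 0 < r \<and> r < u"
      using eventually_at_left_real[OF u(1)] by (rule eventually_mono) auto
    with ev[OF f] ev[OF g] show "\<forall>\<^sub>F r in at_left u. D u - D r \<le> (u - r) * (L * D u + \<epsilon>)"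
    proof eventually_elim
      case (elim r)
      have r: "0 \<le> r" using elim by simp
      let ?E = "\<lambda>h x. exp (h r x) - exp (h u x) - (r - u) * fr_density (h u) x"
      have Ef: "?E f \<in> Bb" and Eg: "?E g \<in> Bb"
        by (intro Bb_diff Bb_exp Bb_cmult fr_density_Bb normalised_Bb nf ng r u0)+
      let ?F = "\<lambda>x. fr_density (f u) x - fr_density (g u) x"
      have F: "?F \<in> Bb" by (intro Bb_diff fr_density_Bb nf ng u0)
      have d: "(\<lambda>x. exp (f t x) - exp (g t x)) \<in> Bb" if "0 \<le> t" for t
        by (intro Bb_diff Bb_exp normalised_Bb nf ng that)
      have "D u \<le> D r + (u - r) * (L * D u + \<epsilon>)"
      proof (rule D_le)
        fix s
        have "l1_dist (f u) (g u) s - l1_dist (f r) (g r) s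
            = (LINT a|\<mu>. \<bar>exp (f u (s, a)) - exp (g u (s, a))\<bar> - \<bar>exp (f r (s, a)) - exp (g r (s, a))\<bar>)"
          unfolding l1_dist_def using abs_slice_integrable[OF d[OF u0], of s] abs_slice_integrable[OF d[OF r], of s] by simp
        also have "\<dots> \<le> (LINT a|\<mu>. \<bar>?E f (s, a)\<bar> + \<bar>?E g (s, a)\<bar> + (u - r) * \<bar>?F (s, a)\<bar>)"
        proof (rule integral_mono)
          fix a :: 'a
          let ?x = "(s, a)"
          have "exp (f u ?x) - exp (g u ?x) - (exp (f r ?x) - exp (g r ?x)) = ?E g ?x - ?E f ?x + (u - r) * ?F ?x"
            by (simp add: algebra_simps)
          moreover have "\<bar>(u - r) * ?F ?x\<bar> = (u - r) * \<bar>?F ?x\<bar>" using elim by (simp add: abs_mult)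
          ultimately show "\<bar>exp (f u ?x) - exp (g u ?x)\<bar> - \<bar>exp (f r ?x) - exp (g r ?x)\<bar>
              \<le> \<bar>?E f ?x\<bar> + \<bar>?E g ?x\<bar> + (u - r) * \<bar>?F ?x\<bar>" by linarith
        qed (intro Bochner_Integration.integrable_diff Bochner_Integration.integrable_add integrable_mult_right
            abs_slice_integrable d r u0 Ef Eg F)+
        also have "\<dots> = (LINT a|\<mu>. \<bar>?E f (s, a)\<bar>) + (LINT a|\<mu>. \<bar>?E g (s, a)\<bar>) + (u - r) * (LINT a|\<mu>. \<bar>?F (s, a)\<bar>)"
          using abs_slice_integrable[OF Ef, of s] abs_slice_integrable[OF Eg, of s] abs_slice_integrable[OF F, of s] by simp
        also have "\<dots> \<le> \<epsilon> / 2 * \<bar>r - u\<bar> + \<epsilon> / 2 * \<bar>r - u\<bar> + (u - r) * (L * D u)"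
          using elim lip[of s] by (intro add_mono mult_left_mono) auto
        also have "\<dots> = (u - r) * (L * D u + \<epsilon>)" using elim by (simp add: algebra_simps)
        finally show "l1_dist (f u) (g u) s \<le> D r + (u - r) * (L * D u + \<epsilon>)"
          using D_ge[OF r, of s] by linarith
      qed
      then show ?case by linarith
    qed
  qed (use L T in auto)
  then show ?thesis using D_ge[OF T, of s] l1_dist_nonneg[of "f T" "g T" s] by linarith
qed

lemma lpol_eqI:
  assumes l: "l \<in> normalised" and k: "k \<in> normalised" and eq: "\<And>s. l1_dist l k s = 0"
  shows "lpol l = lpol k"
proof
  fix s
  interpret l: prob_space "lpol l s" by (rule prob_space_lpol[OF l])
  interpret k: prob_space "lpol k s" by (rule prob_space_lpol[OF k])
  show "lpol l s = lpol k s"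
  proof (rule measure_eqI)
    fix B assume "B \<in> sets (lpol l s)"
    then have B: "B \<in> sets borel" by simp
    have "measure (lpol l s) B = measure (lpol k s) B"
    proof (cases "B = {}")
      case False
      from tv_norm_ge_abs[OF B this, of "\<lambda>B. measure (lpol l s) B - measure (lpol k s) B"]
      show ?thesis by (simp add: tv_norm_lpol[OF l k] eq zero_ereal_def[symmetric])
    qed simp
    then show "emeasure (lpol l s) B = emeasure (lpol k s) B"
      by (simp add: l.emeasure_eq_measure k.emeasure_eq_measure)
  qed simp
qed

lemma fisher_rao_flow_unique:
  assumes \<pi>: "fisher_rao_flow M \<pi>\<^sub>0 \<pi>" and \<pi>': "fisher_rao_flow M \<pi>\<^sub>0 \<pi>'" and t: "0 \<le> t"
  shows "\<pi>' t = \<pi> t"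
proof -
  obtain f where f: "fr_path f" "\<And>t. 0 \<le> t \<Longrightarrow> \<pi> t = lpol (f t)" by (rule fisher_rao_flow_fr_path[OF \<pi>]) blast
  obtain g where g: "fr_path g" "\<And>t. 0 \<le> t \<Longrightarrow> \<pi>' t = lpol (g t)" by (rule fisher_rao_flow_fr_path[OF \<pi>']) blast
  have n: "f t \<in> normalised" "g t \<in> normalised" if "0 \<le> t" for t using f(1) g(1) that by (auto simp: fr_path_def)
  have "lpol (f 0) = lpol (g 0)"
    using \<pi> \<pi>' f(2)[of 0] g(2)[of 0] by (simp add: fisher_rao_flow_def)
  then have "ereal (l1_dist (g 0) (f 0) s) = tv_norm (\<lambda>_ :: 'a set. 0)" for s
    using tv_norm_lpol[OF n(2,1)[OF order_refl], of s] by simp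
  moreover have "tv_norm (\<lambda>_ :: 'a set. 0) \<le> 0" by (rule tv_norm_zero)
  ultimately have "l1_dist (g 0) (f 0) s = 0" for s
    using l1_dist_nonneg[of "g 0" "f 0" s] by (metis antisym ereal_less_eq(3) zero_ereal_def)
  then have "l1_dist (g t) (f t) s = 0" for s by (intro fr_path_unique[OF g(1) f(1) _ t])
  from lpol_eqI[OF n(2,1)[OF t] this] show ?thesis using f(2) g(2) t by simp
qed

end

theorem theorem2p8:
  fixes M :: "('s::polish_space, 'a::polish_space) mdp"
  assumes "regularised_mdp M"
  shows
    "(\<forall>Z. log_density_flow M Z \<longrightarrow>
        (\<forall>\<rho>\<in>space (prob_algebra borel). \<forall>t>0.
           ext_integral \<rho> (V_pol M (gibbs M (Z t))) - ext_integral \<rho> (V_pol M (optimal_policy M))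
             \<le> ereal (temperature M / ((1 - discount M) * (exp (temperature M * t) - 1))) *
                ext_integral (occupancy_from M (optimal_policy M) \<rho>)
                  (\<lambda>s. KL (optimal_policy M s) (gibbs M (Z 0) s))
         \<and> ext_integral (occupancy_from M (optimal_policy M) \<rho>)
               (\<lambda>s. (tv_norm (\<lambda>B. measure (gibbs M (Z t) s) B - measure (optimal_policy M s) B))\<^sup>2)
             \<le> ereal (2 * exp (- temperature M * t)) *
                ext_integral (occupancy_from M (optimal_policy M) \<rho>)
                  (\<lambda>s. KL (optimal_policy M s) (gibbs M (Z 0) s))))
   \<and> (\<forall>\<pi>\<^sub>0\<in>gibbs_policies M.
        \<exists>\<pi>. fisher_rao_flow M \<pi>\<^sub>0 \<pi>
          \<and> (\<forall>\<pi>'. fisher_rao_flow M \<pi>\<^sub>0 \<pi>' \<longrightarrow> (\<forall>t\<ge>0. \<pi>' t = \<pi> t))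
          \<and> (\<forall>\<rho>\<in>space (prob_algebra borel). \<forall>t>0.
               ext_integral \<rho> (V_pol M (\<pi> t)) - ext_integral \<rho> (V_pol M (optimal_policy M))
                 \<le> ereal (temperature M / ((1 - discount M) * (exp (temperature M * t) - 1))) *
                    ext_integral (occupancy_from M (optimal_policy M) \<rho>)
                      (\<lambda>s. KL (optimal_policy M s) (\<pi>\<^sub>0 s))
             \<and> ext_integral (occupancy_from M (optimal_policy M) \<rho>)
                   (\<lambda>s. (tv_norm (\<lambda>B. measure (\<pi> t s) B - measure (optimal_policy M s) B))\<^sup>2)
                 \<le> ereal (2 * exp (- temperature M * t)) *
                    ext_integral (occupancy_from M (optimal_policy M) \<rho>)
                      (\<lambda>s. KL (optimal_policy M s) (\<pi>\<^sub>0 s))))"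
proof -
  interpret entropy_mdp M by unfold_locales (rule assms)
  show ?thesis
  proof (intro conjI allI impI ballI)
    fix Z :: "real \<Rightarrow> 's \<times> 'a \<Rightarrow> real" and \<rho> :: "'s measure" and t :: real
    assume "log_density_flow M Z" "\<rho> \<in> space (prob_algebra borel)" "0 < t"
    note conv = log_density_flow_convergence[OF this]
    show "ext_integral \<rho> (V_pol M (gibbs M (Z t))) - ext_integral \<rho> (V_pol M (optimal_policy M))
             \<le> ereal (temperature M / ((1 - discount M) * (exp (temperature M * t) - 1))) *
                ext_integral (occupancy_from M (optimal_policy M) \<rho>)
                  (\<lambda>s. KL (optimal_policy M s) (gibbs M (Z 0) s))" by (rule conv(1))
    show "ext_integral (occupancy_from M (optimal_policy M) \<rho>)
               (\<lambda>s. (tv_norm (\<lambda>B. measure (gibbs M (Z t) s) B - measure (optimal_policy M s) B))\<^sup>2)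
             \<le> ereal (2 * exp (- temperature M * t)) *
                ext_integral (occupancy_from M (optimal_policy M) \<rho>)
                  (\<lambda>s. KL (optimal_policy M s) (gibbs M (Z 0) s))" by (rule conv(2))
  next
    fix \<pi>\<^sub>0 assume "\<pi>\<^sub>0 \<in> gibbs_policies M"
    then obtain Z0 where Z0: "Z0 \<in> Bb" "\<pi>\<^sub>0 = gibbs M Z0" by (auto simp: gibbs_policies_def)
    obtain Z where Z: "log_density_flow M Z" "Z 0 = Z0"
      "\<And>t. 0 \<le> t \<Longrightarrow> has_path_derivative Bb sup_norm Z (zfield (Z t)) t"
      by (rule log_density_flow_exists[OF Z0(1)]) blast
    \<comment> \<open>The solution is the Gibbs policy of a flow \<open>Z\<close> started at any
      representative of the initial policy, so the convergence bounds carry over from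
      \<open>Z\<close>.\<close>
    define \<pi> where "\<pi> t = gibbs M (Z t)" for t
    have Bb: "Z t \<in> Bb" if "0 \<le> t" for t using Z(1) that by (auto simp: log_density_flow_def C1_path_def)
    have "fisher_rao_flow M (\<pi> 0) \<pi>"
    proof (rule fr_flow_exists[where l = "\<lambda>t. nrm (Z t)"])
      show "nrm (Z t) \<in> normalised" if "0 \<le> t" for t by (rule nrm_normalised[OF Bb[OF that]])
      show "((\<lambda>r. Bm (nrm (Z r))) has_vector_derivative Bm (\<lambda>x. - adv (nrm (Z t)) x)) (at t within {0..})"
        if "0 \<le> t" for t by (rule nrm_path_derivative[OF Bb that Z(3)[OF that]])
      show "\<pi> t = lpol (nrm (Z t))" if "0 \<le> t" for t
        unfolding \<pi>_def by (rule gibbs_eq_lpol[OF Bb[OF that]])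
    qed
    then have flow: "fisher_rao_flow M \<pi>\<^sub>0 \<pi>" by (simp add: \<pi>_def Z(2) Z0(2))
    show "\<exists>\<pi>. fisher_rao_flow M \<pi>\<^sub>0 \<pi>
          \<and> (\<forall>\<pi>'. fisher_rao_flow M \<pi>\<^sub>0 \<pi>' \<longrightarrow> (\<forall>t\<ge>0. \<pi>' t = \<pi> t))
          \<and> (\<forall>\<rho>\<in>space (prob_algebra borel). \<forall>t>0.
               ext_integral \<rho> (V_pol M (\<pi> t)) - ext_integral \<rho> (V_pol M (optimal_policy M))
                 \<le> ereal (temperature M / ((1 - discount M) * (exp (temperature M * t) - 1))) *
                    ext_integral (occupancy_from M (optimal_policy M) \<rho>)
                      (\<lambda>s. KL (optimal_policy M s) (\<pi>\<^sub>0 s))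
             \<and> ext_integral (occupancy_from M (optimal_policy M) \<rho>)
                   (\<lambda>s. (tv_norm (\<lambda>B. measure (\<pi> t s) B - measure (optimal_policy M s) B))\<^sup>2)
                 \<le> ereal (2 * exp (- temperature M * t)) *
                    ext_integral (occupancy_from M (optimal_policy M) \<rho>)
                      (\<lambda>s. KL (optimal_policy M s) (\<pi>\<^sub>0 s)))"
    proof (intro exI[of _ \<pi>] conjI allI impI ballI)
      show "fisher_rao_flow M \<pi>\<^sub>0 \<pi>" by (rule flow)
      show "\<pi>' t = \<pi> t" if "fisher_rao_flow M \<pi>\<^sub>0 \<pi>'" "0 \<le> t" for \<pi>' t
        by (rule fisher_rao_flow_unique[OF flow that])
      fix \<rho> :: "'s measure" and t :: real
      assume "\<rho> \<in> space (prob_algebra borel)" "0 < t"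
      note conv = log_density_flow_convergence[OF Z(1) this, unfolded Z(2) Z0(2)[symmetric], folded \<pi>_def]
      show "ext_integral \<rho> (V_pol M (\<pi> t)) - ext_integral \<rho> (V_pol M (optimal_policy M))
                 \<le> ereal (temperature M / ((1 - discount M) * (exp (temperature M * t) - 1))) *
                    ext_integral (occupancy_from M (optimal_policy M) \<rho>)
                      (\<lambda>s. KL (optimal_policy M s) (\<pi>\<^sub>0 s))" by (rule conv(1))
      show "ext_integral (occupancy_from M (optimal_policy M) \<rho>)
                   (\<lambda>s. (tv_norm (\<lambda>B. measure (\<pi> t s) B - measure (optimal_policy M s) B))\<^sup>2)
                 \<le> ereal (2 * exp (- temperature M * t)) *
                    ext_integral (occupancy_from M (optimal_policy M) \<rho>)
                      (\<lambda>s. KL (optimal_policy M s) (\<pi>\<^sub>0 s))" by (rule conv(2))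
    qed
  qed
qed

end
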